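(* Let $\Lambda\subset\mathbb{C}$ be an algebraic Delone set. (a) There exist sets $U$ of four pairwise nonparallel $\Lambda$-directions such that the convex bodies in $\mathbb{C}$ are determined by the continuous X-rays in the directions of $U$. In addition, fewer than four pairwise nonparallel $\Lambda$-directions never suffice for this purpose, i.e., for no set $U$ of fewer than four pairwise nonparallel $\Lambda$-directions are the convex bodies in $\mathbb{C}$ determined by the continuous X-rays in the directions of $U$. (b) There is a natural number $c_\Lambda$ such that, for every set $U$ of $c_\Lambda$ pairwise nonparallel $\Lambda$-directions, the convex bodies in $\mathbb{C}$ are determined by the continuous X-rays in the directions of $U$. Moreover, for any $n\ge 3$ and any $n$-cyclotomic Delone set $\Lambda$, there is a natural number $c_n$ that only depends on $n$ (and not on $\Lambda$) such that, for every set $U$ of $c_n$ pairwise nonparallel $\Lambda$-directions, the convex bodies in $\mathbb{C}$ are determined by the continuous X-rays in the directions of $U$. In particular, one can choose $c_3=c_4=7$, $c_5=11$, $c_8=9$ and $c_{12}=13$.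
   Context: The Euclidean plane is identified with $\mathbb{C}$; natural numbers are positive; $\zeta_n:=e^{2\pi i/n}$. For $r>0$, $B_r(z)$ is the open ball of radius $r$ about $z\in\mathbb{C}$. A set $\Lambda\subset\mathbb{C}$ is uniformly discrete if there is $r>0$ such that every $B_r(z)$, $z\in\mathbb{C}$, contains at most one point of $\Lambda$; it is relatively dense if there is $R>0$ such that every $B_R(z)$, $z\in\mathbb{C}$, contains at least one point of $\Lambda$; it is a Delone set if it is both. Let $\Lambda-\Lambda=\{v-w : v,w\in\Lambda\}$ and let $K_\Lambda:=\mathbb{Q}\big((\Lambda-\Lambda)\cup\overline{(\Lambda-\Lambda)}\big)\subset\mathbb{C}$, the field generated over $\mathbb{Q}$ by all differences of points of $\Lambda$ and their complex conjugates. A homothety of the complex plane is a map $z\mapsto\lambda z+t$ with $\lambda\in\mathbb{R}$, $\lambda>0$, $t\in\mathbb{C}$. Consider the properties: (Alg) $[K_\Lambda:\mathbb{Q}]<\infty$; (Hom) for any finite subset $F$ of $K_\Lambda$ there is a homothety $h$ of the complex plane with $h(F)\subset\Lambda$; ($n$-Cyc) $K_\Lambda\subset\mathbb{Q}(\zeta_n)$. A Delone set $\Lambda\subset\mathbb{C}$ is an algebraic Delone set if it satisfies (Alg) and (Hom); for $n\geq 3$, it is an $n$-cyclotomic Delone set if it satisfies ($n$-Cyc) and (Hom). Elements of the unit circle $\mathbb{S}^1\subset\mathbb{C}$ are called directions. A direction is a $\Lambda$-direction if it is parallel to a nonzero element of $\Lambda-\Lambda$. A convex body in $\mathbb{C}$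 is a compact convex subset with nonempty interior. The continuous X-ray of a convex body $K$ in direction $u$ is the function assigning to each line $\ell$ in direction $u$ the length of the chord $K\cap\ell$ (zero if $K\cap \ell$ is empty). For a finite set $U$ of directions, the convex bodies in $\mathbb{C}$ are determined by the continuous X-rays in the directions of $U$ if any two convex bodies having the same continuous X-ray in direction $u$ for every $u\in U$ are equal. *)

theory Defs
  imports "HOL-Analysis.Analysis" "HOL-Algebra.Generated_Fields" "HOL-Algebra.Algebraic_Closure_Type"
begin

subsection \<open>Delone sets\<close>

definition relatively_dense :: "complex set \<Rightarrow> bool" where
  "relatively_dense \<Lambda> \<longleftrightarrow> (\<exists>R>0. \<forall>z. ball z R \<inter> \<Lambda> \<noteq> {})"

definition Delone :: "complex set \<Rightarrow> bool" where
  "Delone \<Lambda> \<longleftrightarrow> uniform_discrete \<Lambda> \<and> relatively_dense \<Lambda>"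

text \<open>The library phrases uniform discreteness by a minimal distance; this is the formulation
  by balls containing at most one point.\<close>

lemma uniform_discrete_iff_ball:
  fixes \<Lambda> :: "complex set"
  shows "uniform_discrete \<Lambda> \<longleftrightarrow>
    (\<exists>r>0. \<forall>z. \<forall>v \<in> ball z r \<inter> \<Lambda>. \<forall>w \<in> ball z r \<inter> \<Lambda>. v = w)"
proof
  assume "uniform_discrete \<Lambda>"
  then obtain e where e: "e > 0" "\<And>x y. x \<in> \<Lambda> \<Longrightarrow> y \<in> \<Lambda> \<Longrightarrow> dist x y < e \<Longrightarrow> x = y"
    unfolding uniform_discrete_def by blast
  have "v = w" if "v \<in> ball z (e/2) \<inter> \<Lambda>" "w \<in> ball z (e/2) \<inter> \<Lambda>" for z v w
  proof (rule e(2))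
    show "dist v w < e"
      by (rule dist_triangle_half_r[of z]) (use that in auto)
  qed (use that in auto)
  then show "\<exists>r>0. \<forall>z. \<forall>v \<in> ball z r \<inter> \<Lambda>. \<forall>w \<in> ball z r \<inter> \<Lambda>. v = w"
    using e(1) by (intro exI[of _ "e/2"]) auto
next
  assume "\<exists>r>0. \<forall>z. \<forall>v \<in> ball z r \<inter> \<Lambda>. \<forall>w \<in> ball z r \<inter> \<Lambda>. v = w"
  then obtain r where r: "r > 0"
      "\<forall>z. \<forall>v \<in> ball z r \<inter> \<Lambda>. \<forall>w \<in> ball z r \<inter> \<Lambda>. v = w"
    by blast
  have "x = y" if "x \<in> \<Lambda>" "y \<in> \<Lambda>" "dist x y < r" for x y
    using r(2)[rule_format, of x x y] r(1) that by simp
  then show "uniform_discrete \<Lambda>"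
    unfolding uniform_discrete_def using r(1) by blast
qed

subsection \<open>Algebraic and cyclotomic Delone sets\<close>

abbreviation complex_field :: "complex ring" where
  "complex_field \<equiv> ring_of_type_algebra"

text \<open>A subfield of the complex numbers automatically contains the rationals, so
  \<^const>\<open>generate_field\<close> yields the field generated over the rationals.\<close>

definition field_gen :: "complex set \<Rightarrow> complex set" where
  "field_gen S = generate_field complex_field S"

definition differences :: "complex set \<Rightarrow> complex set" where
  "differences \<Lambda> = {v - w | v w. v \<in> \<Lambda> \<and> w \<in> \<Lambda>}"

definition K_field :: "complex set \<Rightarrow> complex set" where
  "K_field \<Lambda> = field_gen (differences \<Lambda> \<union> cnj ` differences \<Lambda>)"

definition zeta :: "nat \<Rightarrow> complex" where
  "zeta n = exp (2 * of_real pi * \<i> / of_nat n)"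

definition homothety :: "(complex \<Rightarrow> complex) \<Rightarrow> bool" where
  "homothety h \<longleftrightarrow> (\<exists>(l::real) (t::complex). l > 0 \<and> h = (\<lambda>z. of_real l * z + t))"

definition Alg :: "complex set \<Rightarrow> bool" where
  "Alg \<Lambda> \<longleftrightarrow> ring.finite_dimension complex_field \<rat> (K_field \<Lambda>)"

definition Hom :: "complex set \<Rightarrow> bool" where
  "Hom \<Lambda> \<longleftrightarrow> (\<forall>F. finite F \<and> F \<subseteq> K_field \<Lambda> \<longrightarrow> (\<exists>h. homothety h \<and> h ` F \<subseteq> \<Lambda>))"

definition Cyc :: "nat \<Rightarrow> complex set \<Rightarrow> bool" where
  "Cyc n \<Lambda> \<longleftrightarrow> K_field \<Lambda> \<subseteq> field_gen {zeta n}"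

definition algebraic_Delone :: "complex set \<Rightarrow> bool" where
  "algebraic_Delone \<Lambda> \<longleftrightarrow> Delone \<Lambda> \<and> Alg \<Lambda> \<and> Hom \<Lambda>"

definition cyclotomic_Delone :: "nat \<Rightarrow> complex set \<Rightarrow> bool" where
  "cyclotomic_Delone n \<Lambda> \<longleftrightarrow> Delone \<Lambda> \<and> Cyc n \<Lambda> \<and> Hom \<Lambda>"

subsection \<open>Directions\<close>

definition parallel :: "complex \<Rightarrow> complex \<Rightarrow> bool" where
  "parallel u v \<longleftrightarrow> (\<exists>c::real. c \<noteq> 0 \<and> v = c *\<^sub>R u)"

definition Lambda_direction :: "complex set \<Rightarrow> complex \<Rightarrow> bool" where
  "Lambda_direction \<Lambda> u \<longleftrightarrow>
     u \<in> sphere 0 1 \<and> (\<exists>z \<in> differences \<Lambda>. z \<noteq> 0 \<and> parallel u z)"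

definition nonparallel_Lambda_directions :: "complex set \<Rightarrow> complex set \<Rightarrow> bool" where
  "nonparallel_Lambda_directions \<Lambda> U \<longleftrightarrow>
     finite U \<and> (\<forall>u\<in>U. Lambda_direction \<Lambda> u) \<and> pairwise (\<lambda>u v. \<not> parallel u v) U"

subsection \<open>Convex bodies and X-rays\<close>

definition convex_body :: "complex set \<Rightarrow> bool" where
  "convex_body K \<longleftrightarrow> compact K \<and> convex K \<and> interior K \<noteq> {}"

text \<open>A line in direction \<open>u\<close> is given by a point \<open>p\<close> on it. As \<open>u\<close> is a unit vector, \<open>t\<close> is an
  arc length parameter on the line, so the value is the length of the chord; it does not depend
  on the choice of \<open>p\<close>.\<close>

definition xray :: "complex \<Rightarrow> complex set \<Rightarrow> complex \<Rightarrow> real" where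
  "xray u K p = measure lborel {t::real. p + t *\<^sub>R u \<in> K}"

definition determined_by_xrays :: "complex set \<Rightarrow> bool" where
  "determined_by_xrays U \<longleftrightarrow>
     (\<forall>K L. convex_body K \<and> convex_body L \<and> (\<forall>u\<in>U. xray u K = xray u L) \<longrightarrow> K = L)"

end

(*
  Let K and L be distinct convex bodies with equal X-rays in the directions of U. Moving along a
  direction u in U pairs the components of (int K - L) \<union> (int L - K), and paired components have the
  same area and centroids on a common line parallel to u. A component is disjoint from the convex
  hull of the others, so the centroids of the components of one fixed area are the vertices of a
  convex polygon w_0, ..., w_(N-1), on which u acts as a reflection w_i ~ w_(r-i). The first discrete
  Fourier coefficient of the vertices turns this into a Moebius transformation that takes the N-th
  root of unity belonging to u to u^2. Hence cross ratios of these roots of unity lie in K_Lambda and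
  in a cyclotomic field, thus in Q(zeta_n) for an n that depends only on Lambda.

  For a coprime to N with a = 1 (mod n) the conjugation zeta_N -> zeta_N^a fixes those cross ratios, so
  w -> w^a agrees with a Moebius transformation on the roots of unity in question. If a is close to a
  small integer modulo their exponent, this is a polynomial equation of small degree, which bounds
  the number of directions. The cross ratio 1/5 of four roots of unity is impossible altogether, which
  gives four good directions, and up to an affine map a triangle and its negative show that three
  directions do not suffice.
*)

theory Submission imports Defs "HOL-Number_Theory.Number_Theory" begin

text \<open>The polygon need not be affinely regular, and nothing bounds its number N of vertices.
  The Fourier coefficients at the frequencies 1 and -1 are enough: every direction relates this one
  pair linearly to its own root of unity and square, and the relation is invertible because three
  directions cannot all satisfy a degenerate one.

  As N is unbounded, the count may use only congruences for the exponent a. If the exponent of the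
  set divides (a - e) h or (a + e) h, then w^a = c w^e or c w^(-e) with c^h = 1; each of the h
  values of c leaves a polynomial of degree at most e + 1, so at most h (e + 1) roots remain. The
  condition a = 1 (mod n) decides which (h, e) are available. The worst cases are (2, 2) for n = 3
  and n = 4, (2, 4) for n = 5, (4, 1) for n = 8, (6, 1) for n = 12, and (n, 2) for general even n;
  the required number of directions is one more. For e = 1 the polynomial may vanish identically,
  and avoiding this causes the inner case distinctions for n = 8 and n = 12.\<close>

section \<open>Lebesgue measure in rotated coordinates\<close>

text \<open>Fubini: each horizontal slice is merely translated.\<close>

lemma lborel_distr_shear:
  fixes g :: "real \<Rightarrow> real"
  assumes [measurable]: "g \<in> borel_measurable borel"
  shows "distr lborel borel (\<lambda>p. (fst p + g (snd p), snd p)) = (lborel :: (real \<times> real) measure)"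
proof (rule measure_eqI)
  fix A :: "(real \<times> real) set"
  assume "A \<in> sets (distr lborel borel (\<lambda>p. (fst p + g (snd p), snd p)))"
  then have A[measurable]: "A \<in> sets borel" by simp
  let ?f = "\<lambda>p. (fst p + g (snd p), snd p)"
  have f[measurable]: "?f \<in> borel \<rightarrow>\<^sub>M borel"
    by (simp add: borel_prod [symmetric])
  have B: "?f -` A \<in> sets borel"
    using measurable_sets_borel[OF f A] by simp
  have fub: "emeasure lborel Z = nn_integral lborel (\<lambda>y. emeasure lborel {x. (x, y) \<in> Z})"
    if "Z \<in> sets borel" for Z :: "(real \<times> real) set"
  proof -
    have "Z \<in> sets (lborel \<Otimes>\<^sub>M lborel)" using that by (simp only: lborel_prod sets_lborel)
    then show ?thesis
      using lborel_pair.emeasure_pair_measure_alt2[of Z] by (simp only: lborel_prod vimage_def)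
  qed
  have tr: "emeasure lborel {x. x + c \<in> Z} = emeasure lborel Z" if "Z \<in> sets borel" for Z and c :: real
    using that by (subst lborel_distr_plus[of c, symmetric]) (auto simp: emeasure_distr vimage_def add.commute)
  have "emeasure (distr lborel borel ?f) A = emeasure lborel (?f -` A)"
    by (simp add: emeasure_distr)
  also have "\<dots> = nn_integral lborel (\<lambda>y. emeasure lborel {x. x + g y \<in> {x. (x, y) \<in> A}})"
    by (subst fub[OF B]) simp
  also have "\<dots> = nn_integral lborel (\<lambda>y. emeasure lborel {x. (x, y) \<in> A})"
  proof (rule nn_integral_cong)
    fix y :: real
    have "(\<lambda>x. (x, y)) \<in> borel \<rightarrow>\<^sub>M borel"
      by (intro borel_measurable_continuous_onI continuous_intros)
    then have "{x. (x, y) \<in> A} \<in> sets borel"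
      using measurable_sets_borel[of "\<lambda>x. (x, y)" borel A] A by (simp add: vimage_def)
    then show "emeasure lborel {x. x + g y \<in> {x. (x, y) \<in> A}} = emeasure lborel {x. (x, y) \<in> A}"
      by (rule tr)
  qed
  also have "\<dots> = emeasure lborel A" by (rule fub[OF A, symmetric])
  finally show "emeasure (distr lborel borel ?f) A = emeasure lborel A" .
qed simp

lemma lborel_distr_swap:
  "distr lborel borel prod.swap = (lborel :: (real \<times> real) measure)"
proof -
  have "distr (lborel \<Otimes>\<^sub>M lborel) (lborel \<Otimes>\<^sub>M lborel) (\<lambda>(x, y). (y, x)) = (lborel \<Otimes>\<^sub>M lborel :: (real \<times> real) measure)"
    by (rule lborel_pair.distr_pair_swap[symmetric])
  moreover have "distr (lborel \<Otimes>\<^sub>M lborel) (lborel \<Otimes>\<^sub>M lborel) (\<lambda>(x, y). (y, x))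
      = distr lborel (borel :: (real \<times> real) measure) prod.swap"
    by (rule distr_cong) (simp_all only: lborel_prod prod.swap_def split_beta sets_lborel)
  ultimately show ?thesis by (simp add: lborel_prod)
qed

lemma lborel_distr_Complex:
  "distr lborel borel (\<lambda>p. Complex (fst p) (snd p)) = lborel"
proof (rule lborel_eqI[symmetric])
  fix l u :: complex
  assume le: "\<And>b. b \<in> Basis \<Longrightarrow> l \<bullet> b \<le> u \<bullet> b"
  have m: "(\<lambda>p. Complex (fst p) (snd p)) \<in> borel \<rightarrow>\<^sub>M borel"
    by (intro borel_measurable_continuous_onI continuous_intros)
  have "(\<lambda>p. Complex (fst p) (snd p)) -` box l u = box (Re l, Im l) (Re u, Im u)"
    by (auto simp: box_def Basis_complex_def Basis_prod_def inner_complex_def)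
  then have "emeasure (distr lborel borel (\<lambda>p. Complex (fst p) (snd p))) (box l u)
     = emeasure lborel (box (Re l, Im l) (Re u, Im u))"
    using m by (simp add: emeasure_distr)
  also have "\<dots> = (\<Prod>b\<in>Basis. (u - l) \<bullet> b)"
    using le[of 1] le[of \<i>]
    by (subst emeasure_lborel_box)
       (auto simp: Basis_complex_def Basis_prod_def inner_complex_def prod.union_disjoint prod.insert_if)
  finally show "emeasure (distr lborel borel (\<lambda>p. Complex (fst p) (snd p))) (box l u)
     = (\<Prod>b\<in>Basis. (u - l) \<bullet> b)" .
qed simp

definition rot :: "complex \<Rightarrow> real \<times> real \<Rightarrow> real \<times> real" where
  "rot u p = (Re u * fst p - Im u * snd p, Im u * fst p + Re u * snd p)"

lemma rot_measurable [measurable]: "rot u \<in> borel \<rightarrow>\<^sub>M borel"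
  unfolding rot_def by (intro borel_measurable_continuous_onI continuous_intros)

text \<open>A rotation is a product of three shears, the vertical one being a horizontal shear
  conjugated by the swap.\<close>

lemma lborel_distr_rot:
  assumes "norm u = 1"
  shows "distr lborel borel (rot u) = (lborel :: (real \<times> real) measure)"
proof -
  have comp: "distr lborel borel (f \<circ> g) = lborel"
    if "f \<in> borel \<rightarrow>\<^sub>M borel" "g \<in> borel \<rightarrow>\<^sub>M borel" "distr lborel borel f = lborel" "distr lborel borel g = lborel"
    for f g :: "real \<times> real \<Rightarrow> real \<times> real"
  proof -
    have "distr (distr lborel borel g) borel f = distr lborel borel (f \<circ> g)"
      using that(1,2) by (intro distr_distr) auto
    then show ?thesis using that(3,4) by simp
  qed
  define S where "S k = (\<lambda>p::real\<times>real. (fst p + k * snd p, snd p))" for k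
  have S: "S k \<in> borel \<rightarrow>\<^sub>M borel" "distr lborel borel (S k) = lborel" for k
    unfolding S_def using lborel_distr_shear[of "\<lambda>y. k * y"]
    by (auto intro!: borel_measurable_continuous_onI continuous_intros)
  have W: "prod.swap \<in> (borel :: (real \<times> real) measure) \<rightarrow>\<^sub>M borel"
    unfolding prod.swap_def by (intro borel_measurable_continuous_onI continuous_intros)
  have main: "distr lborel borel (rot v) = (lborel :: (real \<times> real) measure)"
    if v: "norm v = 1" "Im v \<noteq> 0" for v
  proof -
    \<comment> \<open>This is minus the tangent of half the rotation angle, hence the condition
      \<open>Im v \<noteq> 0\<close>.\<close>
    define k where "k = (Re v - 1) / Im v"
    have n: "Re v ^ 2 + Im v ^ 2 = 1" using v(1) by (simp add: cmod_def)
    have k1: "1 + k * Im v = Re v" using v(2) by (simp add: k_def)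
    have "k * (1 + Re v) * Im v = - Im v * Im v"
      using n v(2) by (simp add: k_def field_simps power2_eq_square)
    then have k2: "k * (1 + Re v) = - Im v" using v(2) mult_right_cancel[of "Im v"] by blast
    have k2': "k + k * Re v = - Im v" using k2 by (simp add: algebra_simps)
    have "rot v = S k \<circ> (prod.swap \<circ> (S (Im v) \<circ> (prod.swap \<circ> S k)))"
    proof (rule ext)
      fix p :: "real \<times> real"
      obtain t y where p: "p = (t, y)" by (cases p)
      have e1: "y + Im v * (t + k * y) = Im v * t + Re v * y"
        unfolding k1[symmetric] by (simp add: algebra_simps)
      have "t + k * y + k * (Im v * t + Re v * y) = (1 + k * Im v) * t + (k + k * Re v) * y"
        by (simp add: algebra_simps)
      then have e2: "t + k * y + k * (Im v * t + Re v * y) = Re v * t - Im v * y"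
        unfolding k1 k2' by simp
      show "rot v p = (S k \<circ> (prod.swap \<circ> (S (Im v) \<circ> (prod.swap \<circ> S k)))) p"
        by (simp add: p rot_def S_def e1 e2)
    qed
    moreover have "distr lborel borel (S k \<circ> (prod.swap \<circ> (S (Im v) \<circ> (prod.swap \<circ> S k)))) = (lborel :: (real \<times> real) measure)"
      by (intro comp S W lborel_distr_swap measurable_comp[where N = borel])
    ultimately show ?thesis by simp
  qed
  show ?thesis
  proof (cases "Im u = 0")
    case False
    then show ?thesis using main assms by blast
  next
    case True
    \<comment> \<open>For real \<open>u\<close> the shear parameter degenerates, so the rotation is
      split into two with nonzero imaginary part.\<close>
    have i: "rot (u * \<i>) \<circ> rot (- \<i>) = rot u"
      by (rule ext) (simp add: rot_def True)
    have "Im (u * \<i>) \<noteq> 0" using assms True by (auto simp: cmod_def)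
    then have "distr lborel borel (rot (u * \<i>) \<circ> rot (- \<i>)) = (lborel :: (real \<times> real) measure)"
      by (intro comp main rot_measurable) (use assms in \<open>auto simp: norm_mult\<close>)
    then show ?thesis unfolding i .
  qed
qed

text \<open>The coordinates along \<open>u\<close> and \<open>\<i> * u\<close> preserve Lebesgue
  measure, so Fubini applies to the lines in direction \<open>u\<close>. The weight \<open>g\<close>
  depends on the line only; the constant 1 will give areas and the identity first moments.\<close>

lemma integral_along_direction:
  fixes S :: "complex set" and g :: "real \<Rightarrow> real"
  assumes "norm u = 1" and S[measurable]: "S \<in> sets borel" and "bounded S" and g: "continuous_on UNIV g"
  shows "(\<integral>z. indicator S z * g (Im (cnj u * z)) \<partial>lborel) =
         (\<integral>y. g y * measure lborel {t. of_real y * (\<i> * u) + t *\<^sub>R u \<in> S} \<partial>lborel)"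
proof -
  define P where "P = (\<lambda>p::real\<times>real. (Complex (fst p) (snd p)) * u)"
  have Pm[measurable]: "P \<in> borel \<rightarrow>\<^sub>M borel"
    unfolding P_def by (intro borel_measurable_continuous_onI continuous_intros)
  have Cm: "(\<lambda>p. Complex (fst p) (snd p)) \<in> borel \<rightarrow>\<^sub>M borel"
    by (intro borel_measurable_continuous_onI continuous_intros)
  have gm[measurable]: "g \<in> borel_measurable borel" using g by (rule borel_measurable_continuous_onI)
  have "P = (\<lambda>p. Complex (fst p) (snd p)) \<circ> rot u"
    by (rule ext) (simp add: P_def rot_def complex_eq_iff algebra_simps)
  then have dP: "distr lborel borel P = lborel"
    using distr_distr[OF Cm, of "rot u" lborel] lborel_distr_rot[OF assms(1)] lborel_distr_Complex
    by simp
  have uu: "cnj u * u = 1" using assms(1) by (metis mult.commute complex_norm_square of_real_1 power_one)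
  have lev: "Im (cnj u * P p) = snd p" for p
  proof -
    have "cnj u * P p = Complex (fst p) (snd p) * (cnj u * u)" by (simp add: P_def)
    then show ?thesis using uu by simp
  qed
  have Peq: "P (t, y) = of_real y * (\<i> * u) + t *\<^sub>R u" for t y
    by (simp add: P_def complex_eq_iff algebra_simps)
  let ?f = "\<lambda>z. indicator S z * g (Im (cnj u * z))"
  have fm[measurable]: "?f \<in> borel_measurable borel"
  proof -
    have "(\<lambda>z. Im (cnj u * z)) \<in> borel_measurable borel"
      by (intro borel_measurable_continuous_onI continuous_intros)
    then show ?thesis by measurable
  qed
  have int: "integrable lborel ?f"
  proof -
    obtain R where R: "S \<subseteq> cball 0 R" using \<open>bounded S\<close> by (auto simp: bounded_iff subset_iff)
    have "continuous_on (cball 0 R) (\<lambda>z. g (Im (cnj u * z)))"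
      by (intro continuous_on_compose2[OF g] continuous_intros) auto
    then have "bounded ((\<lambda>z. g (Im (cnj u * z))) ` cball 0 R)"
      by (intro compact_imp_bounded compact_continuous_image) auto
    then obtain B where B: "\<And>z. z \<in> cball 0 R \<Longrightarrow> norm (g (Im (cnj u * z))) \<le> B"
      unfolding bounded_iff by blast
    have "integrable lborel (\<lambda>z. B * indicator (cball 0 R) z :: real)"
      by (intro integrable_mult_right integrable_real_indicator) (use emeasure_lborel_cball_finite[of 0 R] in \<open>auto simp: less_top\<close>)
    then show ?thesis
    proof (rule Bochner_Integration.integrable_bound)
      show "AE z in lborel. norm (?f z) \<le> norm (B * indicator (cball 0 R) z :: real)"
      proof (rule AE_I2)
        fix z :: complex
        show "norm (?f z) \<le> norm (B * indicator (cball 0 R) z :: real)"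
          using B[of z] R by (cases "z \<in> S") (auto simp: subset_iff)
      qed
    qed simp
  qed
  have "(\<integral>z. ?f z \<partial>lborel) = (\<integral>z. ?f z \<partial>distr lborel borel P)" by (simp add: dP)
  also have "\<dots> = (\<integral>p. ?f (P p) \<partial>lborel)"
    by (rule integral_distr) auto
  also have "\<dots> = (\<integral>p. (case p of (t, y) \<Rightarrow> indicator S (P (t, y)) * g y) \<partial>(lborel \<Otimes>\<^sub>M lborel))"
    by (simp only: lborel_prod lev case_prod_unfold prod.collapse)
  also have "\<dots> = (\<integral>y. (\<integral>t. indicator S (P (t, y)) * g y \<partial>lborel) \<partial>lborel)"
  proof (rule lborel_pair.integral_snd[symmetric])
    have "integrable (distr lborel borel P) ?f" using int by (simp add: dP)
    then have "integrable lborel (\<lambda>p. ?f (P p))"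
      by (subst (asm) integrable_distr_eq) auto
    then show "integrable (lborel \<Otimes>\<^sub>M lborel) (\<lambda>(t, y). indicator S (P (t, y)) * g y)"
      by (simp only: lborel_prod lev case_prod_unfold prod.collapse)
  qed
  also have "\<dots> = (\<integral>y. g y * measure lborel {t. of_real y * (\<i> * u) + t *\<^sub>R u \<in> S} \<partial>lborel)"
  proof (rule Bochner_Integration.integral_cong[OF refl])
    fix y :: real
    have "(\<lambda>t. P (t, y)) \<in> borel \<rightarrow>\<^sub>M borel"
      unfolding P_def by (intro borel_measurable_continuous_onI continuous_intros)
    then have m: "{t. P (t, y) \<in> S} \<in> sets borel"
      using measurable_sets_borel[of "\<lambda>t. P (t, y)" borel S] S by (simp add: vimage_def)
    have "(\<integral>t. indicator S (P (t, y)) * g y \<partial>lborel) = (\<integral>t. indicator {t. P (t, y) \<in> S} t * g y \<partial>lborel)"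
      by (rule Bochner_Integration.integral_cong) (auto simp: indicator_def)
    also have "\<dots> = g y * measure lborel {t. P (t, y) \<in> S}" using m by (simp add: mult.commute)
    finally show "(\<integral>t. indicator S (P (t, y)) * g y \<partial>lborel) = g y * measure lborel {t. of_real y * (\<i> * u) + t *\<^sub>R u \<in> S}"
      by (simp add: Peq)
  qed
  finally show ?thesis .
qed

section \<open>Chords of a convex body in a given direction\<close>

text \<open>The coordinate normal to \<open>u\<close>: for a unit vector its fibres are exactly the
  lines in direction \<open>u\<close>.\<close>

definition level :: "complex \<Rightarrow> complex \<Rightarrow> real" where
  "level u z = Im (cnj u * z)"

lemma level_simps [simp]:
  "level u (a + b) = level u a + level u b" "level u (a - b) = level u a - level u b"
  "level u (t *\<^sub>R a) = t * level u a" "level u u = 0" "level u 0 = 0" "level (- u) a = - level u a"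
  "level u (- a) = - level u a"
  by (auto simp: level_def algebra_simps)

lemma linear_level: "linear (level u)"
  by (rule linearI) auto

lemma continuous_on_level [continuous_intros]: "continuous_on A (level u)"
  unfolding level_def by (intro continuous_intros)

lemma level_normal: "norm u = 1 \<Longrightarrow> level u (\<i> * u) = 1"
  using complex_norm_square[of u] by (auto simp: level_def cmod_def power2_eq_square)

lemma cnj_mult_self_unit: "norm u = 1 \<Longrightarrow> cnj u * u = 1"
  by (metis mult.commute complex_norm_square of_real_1 power_one)

lemma eq_on_line_if_level_eq:
  assumes "norm u = 1" "level u z = level u w"
  shows "z = w + Re (cnj u * (z - w)) *\<^sub>R u"
proof -
  have "Im (cnj u * (z - w)) = 0" using assms(2) by (simp add: level_def right_diff_distrib)
  then have "complex_of_real (Re (cnj u * (z - w))) = cnj u * (z - w)" by (simp add: complex_eq_iff)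
  then have "Re (cnj u * (z - w)) *\<^sub>R u = (cnj u * u) * (z - w)" by (simp add: scaleR_conv_of_real)
  then show ?thesis by (simp add: cnj_mult_self_unit[OF assms(1)])
qed

lemma open_level_image:
  assumes "norm u = 1" "open A" shows "open (level u ` A)"
proof (rule open_surjective_linear_image[OF assms(2) linear_level])
  have "level u (y *\<^sub>R (\<i> * u)) = y" for y using level_normal[OF assms(1)] by simp
  then show "surj (level u)" by (rule surjI)
qed

text \<open>A ball around an interior point extends beyond it on the line, and the open segment from
  an interior point to any point of \<open>K\<close> stays in the interior. The point at
  \<open>t0\<close> excludes lines along an edge, whose chords contain no interior points.\<close>

lemma convex_body_chord:
  assumes K: "convex_body K" and "norm u = 1" and t0: "p + t0 *\<^sub>R u \<in> interior K"
  obtains a b where "a < b" "\<And>t. p + t *\<^sub>R u \<in> K \<longleftrightarrow> a \<le> t \<and> t \<le> b"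
    "\<And>t. p + t *\<^sub>R u \<in> interior K \<longleftrightarrow> a < t \<and> t < b"
proof -
  have K': "compact K" "convex K" using K by (auto simp: convex_body_def)
  let ?T = "{t. p + t *\<^sub>R u \<in> K}"
  have cv: "convex ?T"
  proof (rule convexI)
    fix x y c d :: real
    assume h: "x \<in> ?T" "y \<in> ?T" "0 \<le> c" "0 \<le> d" "c + d = 1"
    have "c *\<^sub>R (p + x *\<^sub>R u) + d *\<^sub>R (p + y *\<^sub>R u) = (c + d) *\<^sub>R p + (c * x + d * y) *\<^sub>R u"
      by (simp add: algebra_simps)
    moreover have "c *\<^sub>R (p + x *\<^sub>R u) + d *\<^sub>R (p + y *\<^sub>R u) \<in> K" using h K'(2) by (intro convexD) auto
    ultimately show "c *\<^sub>R x + d *\<^sub>R y \<in> ?T" using h by simp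
  qed
  have cl: "closed ?T"
  proof -
    have "closed ((\<lambda>t. p + t *\<^sub>R u) -` K)"
      by (intro closed_vimage compact_imp_closed K' continuous_intros)
    then show ?thesis by (simp add: vimage_def)
  qed
  have bd: "bounded ?T"
  proof -
    obtain B where B: "\<And>x. x \<in> K \<Longrightarrow> norm x \<le> B" using K'(1) compact_imp_bounded[of K] bounded_iff by metis
    have "norm t \<le> B + norm p" if "t \<in> ?T" for t
      using norm_triangle_ineq2[of "t *\<^sub>R u" "- p"] B[of "p + t *\<^sub>R u"] that assms(2) by (auto simp: add.commute)
    then show ?thesis unfolding bounded_iff by blast
  qed
  obtain a b where ab: "?T = {a..b}"
    using connected_compact_interval_1[of ?T] convex_connected[OF cv] cl bd compact_eq_bounded_closed by blast
  have in1: "a < t \<and> t < b" if t: "p + t *\<^sub>R u \<in> interior K" for t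
  proof -
    obtain e where e: "e > 0" "ball (p + t *\<^sub>R u) e \<subseteq> K" using t mem_interior by blast
    have "t + e/2 \<in> ?T" "t - e/2 \<in> ?T"
      using e assms(2) by (auto intro!: subsetD[OF e(2)] simp: dist_norm algebra_simps)
    then show ?thesis using e(1) unfolding ab by auto
  qed
  have in2: "p + t *\<^sub>R u \<in> interior K" if t: "a < t" "t < b" for t
  proof -
    have seg: "open_segment (p + t0 *\<^sub>R u) (p + s *\<^sub>R u) \<subseteq> interior K" if "s \<in> {a..b}" for s
      using in_interior_closure_convex_segment[OF K'(2) t0, of "p + s *\<^sub>R u"] that ab closure_subset by blast
    have mem: "p + t *\<^sub>R u \<in> open_segment (p + t0 *\<^sub>R u) (p + s *\<^sub>R u)" if "(t0 < t \<and> t < s) \<or> (s < t \<and> t < t0)" for s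
    proof -
      define k where "k = (t - t0) / (s - t0)"
      have k: "0 < k" "k < 1" "t = (1 - k) * t0 + k * s" using that by (auto simp: k_def field_simps)
      have "p + t *\<^sub>R u = (1 - k) *\<^sub>R (p + t0 *\<^sub>R u) + k *\<^sub>R (p + s *\<^sub>R u)"
        by (subst k(3)) (simp add: algebra_simps)
      moreover have "p + t0 *\<^sub>R u \<noteq> p + s *\<^sub>R u" using that assms(2) by auto
      ultimately show ?thesis using k in_segment(2) by blast
    qed
    have "a < t0" "t0 < b" using in1[OF t0] by auto
    then have ab0: "a \<in> {a..b}" "b \<in> {a..b}" by auto
    consider "t < t0" | "t = t0" | "t0 < t" by linarith
    then show ?thesis
    proof cases
      case 1 then show ?thesis using seg[OF ab0(1)] mem[of a] t by blast
    next
      case 2 then show ?thesis using t0 by simp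
    next
      case 3 then show ?thesis using seg[OF ab0(2)] mem[of b] t by blast
    qed
  qed
  show ?thesis
  proof
    show "a < b" using in1[OF t0] by auto
    show "p + t *\<^sub>R u \<in> K \<longleftrightarrow> a \<le> t \<and> t \<le> b" for t using ab by (auto simp: set_eq_iff)
    show "p + t *\<^sub>R u \<in> interior K \<longleftrightarrow> a < t \<and> t < b" for t using in1 in2 by blast
  qed
qed

lemma xray_chord:
  assumes "\<And>t. p + t *\<^sub>R u \<in> K \<longleftrightarrow> a \<le> t \<and> t \<le> b" "a \<le> b"
  shows "xray u K p = b - a"
proof -
  have "{t. p + t *\<^sub>R u \<in> K} = {a..b}" by (rule Set.set_eqI) (simp add: assms(1))
  then show ?thesis using assms(2) by (simp add: xray_def)
qed

text \<open>Near \<open>z\<close> all lines in direction \<open>u\<close> cut \<open>K\<close> in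
  positive length, so \<open>L\<close> has points on both sides of the line through
  \<open>z\<close>. Joining an interior point of \<open>L\<close> to a point on the other side gives
  an interior point on that line.\<close>

lemma line_meets_interior:
  assumes K: "convex_body K" and L: "convex_body L" and u: "norm u = 1"
    and eq: "xray u K = xray u L" and z: "z \<in> interior K"
  shows "\<exists>s. z + s *\<^sub>R u \<in> interior L"
proof -
  obtain e where e: "e > 0" "ball z e \<subseteq> interior K" using z open_interior open_contains_ball by blast
  have ex: "\<exists>l\<in>L. level u l = level u z + c" if c: "\<bar>c\<bar> < e" for c
  proof -
    let ?q = "z + c *\<^sub>R (\<i> * u)"
    have "?q + 0 *\<^sub>R u \<in> interior K" using e(2) c u by (auto intro!: subsetD[OF e(2)] simp: dist_norm norm_mult)
    from convex_body_chord[OF K u this] obtain a b where "a < b" "\<And>t. ?q + t *\<^sub>R u \<in> K \<longleftrightarrow> a \<le> t \<and> t \<le> b" by metis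
    then have "xray u K ?q > 0" using xray_chord[of ?q u K a b] by auto
    then have "xray u L ?q > 0" by (simp add: eq)
    then have "{t. ?q + t *\<^sub>R u \<in> L} \<noteq> {}" unfolding xray_def by (metis measure_empty less_irrefl)
    then obtain t where "?q + t *\<^sub>R u \<in> L" by blast
    then show ?thesis using level_normal[OF u] by (intro bexI[of _ "?q + t *\<^sub>R u"]) simp_all
  qed
  obtain q0 where q0: "q0 \<in> interior L" using L by (auto simp: convex_body_def)
  have "\<exists>w\<in>interior L. level u w = level u z"
  proof (cases "level u q0 = level u z")
    case True then show ?thesis using q0 by blast
  next
    case False
    define c0 where "c0 = level u q0 - level u z"
    \<comment> \<open>The sign puts the line through \<open>z\<close> strictly between
      \<open>q0\<close> and the point \<open>l\<close> obtained below.\<close>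
    define c where "c = (if c0 > 0 then - e / 2 else e / 2)"
    have c0: "c0 \<noteq> 0" using False by (simp add: c0_def)
    have sg: "c0 > 0 \<and> c < 0 \<or> c0 < 0 \<and> c > 0" using c0 e(1) by (auto simp: c_def)
    have "\<bar>c\<bar> < e" using e(1) by (auto simp: c_def)
    then obtain l where l: "l \<in> L" "level u l = level u z + c" using ex by blast
    define k where "k = c0 / (c0 - c)"
    have kc: "k * (c0 - c) = c0" using sg by (auto simp: k_def)
    have k: "0 < k" "k < 1" "(1 - k) * c0 + k * c = 0"
    proof -
      show "0 < k" "k < 1" using sg by (auto simp: k_def zero_less_divide_iff divide_less_eq)
      show "(1 - k) * c0 + k * c = 0" using kc by (simp add: algebra_simps)
    qed
    let ?w = "(1 - k) *\<^sub>R q0 + k *\<^sub>R l"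
    have "q0 \<noteq> l" using l(2) sg unfolding c0_def by auto
    then have "?w \<in> open_segment q0 l" using k in_segment(2) by blast
    moreover have "open_segment q0 l \<subseteq> interior L"
      using L l q0 closure_subset by (intro in_interior_closure_convex_segment) (auto simp: convex_body_def)
    moreover have "level u ?w = level u z + ((1 - k) * c0 + k * c)"
      by (simp add: l(2) c0_def algebra_simps)
    then have "level u ?w = level u z" by (simp only: k(3) add_0_right)
    ultimately show ?thesis by blast
  qed
  then obtain w where w: "w \<in> interior L" "level u w = level u z" by blast
  show ?thesis using eq_on_line_if_level_eq[OF u w(2)] w(1) by metis
qed

subsection \<open>Components of the difference of two convex bodies\<close>

text \<open>On every line parallel to \<open>u\<close> the chords of \<open>K\<close> and \<open>L\<close> have the same length, so \<open>K\<close> sticks out at one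
  end by the same length as \<open>L\<close> does at the other; this is what pairs the components.\<close>

definition overhang :: "complex set \<Rightarrow> complex set \<Rightarrow> complex \<Rightarrow> complex set" where
  "overhang K L u = {z \<in> interior K - L. \<exists>s>0. z + s *\<^sub>R u \<in> interior L}"

lemma open_overhang:
  assumes "closed L" shows "open (overhang K L u)"
proof -
  have "overhang K L u = (interior K - L) \<inter> (\<Union>s\<in>{0<..}. (\<lambda>z. z + s *\<^sub>R u) -` interior L)"
    by (rule Set.set_eqI) (simp add: overhang_def Bex_def)
  moreover have "open (interior K - L)" using assms by (intro open_Diff) auto
  moreover have "open ((\<lambda>z. z + s *\<^sub>R u) -` interior L)" for s
    by (intro open_vimage continuous_intros) auto
  ultimately show ?thesis by (auto intro!: open_Int open_UN)
qed

lemma overhang_disjoint: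
  assumes "convex L" shows "overhang K L u \<inter> overhang K L (- u) = {}"
proof -
  have False if z: "z \<notin> L" "z + s *\<^sub>R u \<in> L" "z + r *\<^sub>R (- u) \<in> L" "s > 0" "r > 0" for z s r
  proof -
    have one: "r / (s + r) + s / (s + r) = 1" using z(4,5) by (simp add: add_divide_distrib[symmetric])
    have "(r / (s + r)) *\<^sub>R (z + s *\<^sub>R u) + (s / (s + r)) *\<^sub>R (z + r *\<^sub>R (- u)) \<in> L"
      by (rule convexD[OF assms z(2,3) _ _ one]) (use z(4,5) in auto)
    also have "(r / (s + r)) *\<^sub>R (z + s *\<^sub>R u) + (s / (s + r)) *\<^sub>R (z + r *\<^sub>R (- u))
        = (r / (s + r) + s / (s + r)) *\<^sub>R z"
      by (simp add: algebra_simps)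
    also note one
    finally show False using z(1) by simp
  qed
  then show ?thesis unfolding overhang_def using interior_subset by blast
qed

lemma overhang_cover:
  assumes "convex_body K" "convex_body L" "norm u = 1" "xray u K = xray u L"
  shows "interior K - L = overhang K L u \<union> overhang K L (- u)"
proof
  show "interior K - L \<subseteq> overhang K L u \<union> overhang K L (- u)"
  proof
    fix z assume z: "z \<in> interior K - L"
    then obtain s where s: "z + s *\<^sub>R u \<in> interior L" using line_meets_interior[OF assms] by blast
    have "s \<noteq> 0"
    proof
      assume "s = 0"
      with s have "z \<in> interior L" by simp
      then show False using z interior_subset by blast
    qed
    then show "z \<in> overhang K L u \<union> overhang K L (- u)"
      using z s unfolding overhang_def
      by (cases "s > 0") (auto intro: exI[of _ "- s"])
  qed
qed (auto simp: overhang_def)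

text \<open>If the chords of \<open>K\<close> and \<open>L\<close> are [a, b] and [c, d], the
  overhangs are the open intervals from a to min b c and from max b c to d. Their endpoints differ
  by the same amount because b - a = d - c; this includes the case c \<le> a, where both intervals
  are empty, and disjoint chords.\<close>

lemma overhang_chords:
  assumes K: "convex_body K" and L: "convex_body L" and u: "norm u = 1" and eq: "xray u K = xray u L"
  shows "\<exists>a b a' b'. {t. p + t *\<^sub>R u \<in> overhang K L u} = {a<..<b} \<and>
    {t. p + t *\<^sub>R u \<in> overhang L K (- u)} = {a'<..<b'} \<and> b - a = b' - (a'::real)"
proof (cases "\<exists>t. p + t *\<^sub>R u \<in> interior K")
  case False
  have F: "p + t *\<^sub>R u \<notin> interior L" for t
    using line_meets_interior[OF L K u eq[symmetric], of "p + t *\<^sub>R u"] False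
    by (auto simp: add.assoc scaleR_left_distrib[symmetric])
  have "{t. p + t *\<^sub>R u \<in> overhang K L u} = {0<..<0}" "{t. p + t *\<^sub>R u \<in> overhang L K (- u)} = {0<..<0}"
    using False F by (auto simp: overhang_def)
  then show ?thesis by (intro exI[of _ 0]) auto
next
  case True
  then obtain t0 where t0: "p + t0 *\<^sub>R u \<in> interior K" by blast
  from line_meets_interior[OF K L u eq this] obtain t1 where t1: "p + t1 *\<^sub>R u \<in> interior L"
    by (auto simp: add.assoc scaleR_left_distrib[symmetric])
  obtain a b where ab: "a < b" "\<And>t. p + t *\<^sub>R u \<in> K \<longleftrightarrow> a \<le> t \<and> t \<le> b"
    "\<And>t. p + t *\<^sub>R u \<in> interior K \<longleftrightarrow> a < t \<and> t < b" using convex_body_chord[OF K u t0] by metis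
  obtain c d where cd: "c < d" "\<And>t. p + t *\<^sub>R u \<in> L \<longleftrightarrow> c \<le> t \<and> t \<le> d"
    "\<And>t. p + t *\<^sub>R u \<in> interior L \<longleftrightarrow> c < t \<and> t < d" using convex_body_chord[OF L u t1] by metis
  have len: "b - a = d - c"
    using xray_chord[of p u K a b] xray_chord[of p u L c d] ab cd eq by auto
  have A: "p + t *\<^sub>R u + s *\<^sub>R u = p + (t + s) *\<^sub>R u" "p + t *\<^sub>R u - s *\<^sub>R u = p + (t - s) *\<^sub>R u" for s t
    by (auto simp: algebra_simps)
  have 1: "{t. p + t *\<^sub>R u \<in> overhang K L u} = {a<..<min b c}"
  proof -
    have "(a < t \<and> t < b \<and> \<not> (c \<le> t \<and> t \<le> d) \<and> (\<exists>s>0. c < t + s \<and> t + s < d)) \<longleftrightarrow> a < t \<and> t < min b c" for t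
    proof
      assume "a < t \<and> t < min b c"
      then show "a < t \<and> t < b \<and> \<not> (c \<le> t \<and> t \<le> d) \<and> (\<exists>s>0. c < t + s \<and> t + s < d)"
        using cd(1) by (auto intro!: exI[of _ "(c + d) / 2 - t"])
    qed auto
    then show ?thesis by - (rule Set.set_eqI, simp add: overhang_def A ab cd)
  qed
  have 2: "{t. p + t *\<^sub>R u \<in> overhang L K (- u)} = {max b c<..<d}"
  proof -
    have "(c < t \<and> t < d \<and> \<not> (a \<le> t \<and> t \<le> b) \<and> (\<exists>s>0. a < t - s \<and> t - s < b)) \<longleftrightarrow> max b c < t \<and> t < d" for t
    proof
      assume "max b c < t \<and> t < d"
      then show "c < t \<and> t < d \<and> \<not> (a \<le> t \<and> t \<le> b) \<and> (\<exists>s>0. a < t - s \<and> t - s < b)"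
        using ab(1) by (auto intro!: exI[of _ "t - (a + b) / 2"])
    qed auto
    then show ?thesis by - (rule Set.set_eqI, simp add: overhang_def A ab cd)
  qed
  have "min b c - a = d - max b c" using len by (auto simp: min_def max_def)
  then show ?thesis using 1 2 by blast
qed

text \<open>\<open>level u\<close> is an open map, so a separation of \<open>S\<close> projects to
  two open sets covering the levels of \<open>S\<close>. They are disjoint, because a connected
  fibre cannot meet both parts.\<close>

lemma connected_if_fibres_connected:
  assumes u: "norm u = 1" and S: "open S" and J: "connected (level u ` S)"
    and f: "\<And>p. connected {t. p + t *\<^sub>R u \<in> S}"
  shows "connected S"
proof (rule connectedI)
  fix A B :: "complex set"
  assume h: "open A" "open B" "A \<inter> S \<noteq> {}" "B \<inter> S \<noteq> {}" "A \<inter> B \<inter> S = {}" "S \<subseteq> A \<union> B"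
  have dis: "level u ` (A \<inter> S) \<inter> level u ` (B \<inter> S) = {}"
  proof (rule ccontr)
    assume "\<not> ?thesis"
    then obtain x y where xy: "x \<in> A \<inter> S" "y \<in> B \<inter> S" "level u y = level u x" by force
    define r where "r = Re (cnj u * (y - x))"
    have y: "y = x + r *\<^sub>R u" unfolding r_def using eq_on_line_if_level_eq[OF u xy(3)] .
    let ?T = "{t. x + t *\<^sub>R u \<in> S}" and ?g = "\<lambda>t. x + t *\<^sub>R u"
    have op: "open (?g -` A)" "open (?g -` B)"
      by (intro open_vimage h continuous_intros)+
    have "0 \<in> ?g -` A \<inter> ?T" "r \<in> ?g -` B \<inter> ?T" using xy y by auto
    moreover have "?T \<subseteq> ?g -` A \<union> ?g -` B" "?g -` A \<inter> ?g -` B \<inter> ?T = {}" using h(5,6) by auto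
    ultimately show False using connectedD[OF f[of x] op] by blast
  qed
  have "open (level u ` (A \<inter> S))" "open (level u ` (B \<inter> S))"
    using h S u by (auto intro!: open_level_image)
  moreover have "level u ` S \<subseteq> level u ` (A \<inter> S) \<union> level u ` (B \<inter> S)" using h(6) by auto
  ultimately show False using connectedD[OF J, of "level u ` (A \<inter> S)" "level u ` (B \<inter> S)"] dis h(3,4) by auto
qed

text \<open>\<open>P\<close> is open and closed in \<open>D\<close>, so \<open>C\<close> lies inside
  it. The part of \<open>P\<close> over the levels of \<open>C\<close> is connected because its
  fibres are, and it contains \<open>C\<close>.\<close>

lemma component_eq_slab:
  assumes u: "norm u = 1" and D: "open P" "open (D - P)" "P \<subseteq> D" "open D"
    and f: "\<And>p. connected {t. p + t *\<^sub>R u \<in> P}"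
    and C: "C \<in> components D" "C \<inter> P \<noteq> {}"
  shows "C = {z \<in> P. level u z \<in> level u ` C}"
proof -
  have CD: "C \<subseteq> D" "connected C" using C in_components_subset in_components_connected by auto
  have CP: "C \<subseteq> P"
    using connectedD[OF CD(2) D(1,2)] CD(1) C(2) by blast
  let ?S = "{z \<in> P. level u z \<in> level u ` C}"
  have oC: "open (level u ` C)" using open_level_image[OF u] open_components[OF D(4) C(1)] by blast
  have "?S = P \<inter> level u -` (level u ` C)" by auto
  moreover have "open (level u -` (level u ` C))" by (intro open_vimage oC continuous_on_level)
  ultimately have S: "open ?S" using D(1) by auto
  have "level u ` ?S = level u ` C" using CP by auto
  then have J: "connected (level u ` ?S)"
    using CD(2) by (metis connected_continuous_image continuous_on_level)
  have fib: "connected {t. p + t *\<^sub>R u \<in> ?S}" for p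
  proof -
    have "{t. p + t *\<^sub>R u \<in> ?S} = (if level u p \<in> level u ` C then {t. p + t *\<^sub>R u \<in> P} else {})" by auto
    then show ?thesis using f[of p] by simp
  qed
  have "connected ?S" by (rule connected_if_fibres_connected[OF u S J fib])
  moreover have "C \<subseteq> ?S" using CP by auto
  moreover have "C \<noteq> {}" using C in_components_nonempty by auto
  ultimately have "?S \<subseteq> C" using components_maximal[OF C(1), of ?S] D(3) by auto
  then show ?thesis using \<open>C \<subseteq> ?S\<close> by auto
qed

text \<open>The partner is the component of a point of \<open>Q\<close> at the level of some point
  of \<open>C\<close>. Over a connected open set of levels \<open>Q\<close> is connected as well as
  \<open>P\<close>, so both components extend over the same levels.\<close>

lemma component_partner_slab:
  assumes u: "norm u = 1"
    and D: "open D"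
    and P: "open P" "open (D - P)" "P \<subseteq> D" "\<And>p. connected {t. p + t *\<^sub>R u \<in> P}"
    and Q: "open Q" "open (D - Q)" "Q \<subseteq> D" "\<And>p. connected {t. p + t *\<^sub>R u \<in> Q}"
    and PQ: "P \<inter> Q = {}" "level u ` P = level u ` Q"
    and C: "C \<in> components D" "C \<inter> P \<noteq> {}"
  shows "\<exists>C'\<in>components D. C' \<noteq> C \<and> (\<exists>J. C = {z \<in> P. level u z \<in> J} \<and> C' = {z \<in> Q. level u z \<in> J})"
proof -
  have C1: "C = {z \<in> P. level u z \<in> level u ` C}"
    by (rule component_eq_slab[OF u P(1,2,3) D P(4) C])
  obtain z where z: "z \<in> C" "z \<in> P" using C by auto
  obtain w where w: "w \<in> Q" "level u w = level u z" using z PQ(2) by (metis image_iff)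
  obtain C' where C': "C' \<in> components D" "w \<in> C'"
    using Q(3) w by (metis UnionE Union_components subsetD)
  have C2: "C' = {z \<in> Q. level u z \<in> level u ` C'}"
    by (rule component_eq_slab[OF u Q(1,2,3) D Q(4) C'(1)]) (use C' w in auto)
  \<comment> \<open>Stated for arbitrary \<open>P\<close>, \<open>Q\<close>, \<open>A\<close>,
    \<open>B\<close> because it is applied once in each direction.\<close>
  have sub: "level u ` A \<subseteq> level u ` B"
    if "norm u = 1" "open P" "open (D - P)" "P \<subseteq> D" "level u ` P = level u ` Q" "\<And>p. connected {t. p + t *\<^sub>R u \<in> P}"
      "A \<in> components D" "B \<in> components D" "B \<subseteq> Q" "A = {z \<in> P. level u z \<in> level u ` A}"
      "B = {z \<in> Q. level u z \<in> level u ` B}" "a \<in> A" "b \<in> B" "level u a = level u b" "open Q" "\<And>p. connected {t. p + t *\<^sub>R u \<in> Q}" "Q \<subseteq> D"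
    for A B P Q a b
  proof -
    let ?S = "{z \<in> Q. level u z \<in> level u ` A}"
    have oA: "open (level u ` A)" using open_level_image[OF u] open_components[OF D that(7)] by blast
    have "?S = Q \<inter> level u -` (level u ` A)" by auto
    moreover have "open (level u -` (level u ` A))" by (intro open_vimage oA continuous_on_level)
    ultimately have S: "open ?S" using that(15) by auto
    have AP: "A \<subseteq> P" by (subst that(10)) blast
    have lS: "level u ` ?S = level u ` A"
    proof
      show "level u ` A \<subseteq> level u ` ?S"
      proof
        fix y assume y: "y \<in> level u ` A"
        then have "y \<in> level u ` Q" using AP that(5) by blast
        then obtain q where "q \<in> Q" "y = level u q" by auto
        then show "y \<in> level u ` ?S" using y by auto
      qed
    qed auto
    have J: "connected (level u ` ?S)" unfolding lS
      using in_components_connected[OF that(7)] by (metis connected_continuous_image continuous_on_level)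
    have fib: "connected {t. p + t *\<^sub>R u \<in> ?S}" for p
    proof -
      have "{t. p + t *\<^sub>R u \<in> ?S} = (if level u p \<in> level u ` A then {t. p + t *\<^sub>R u \<in> Q} else {})" by auto
      then show ?thesis using that(16)[of p] by simp
    qed
    have "connected ?S" by (rule connected_if_fibres_connected[OF u S J fib])
    moreover have "b \<in> ?S"
    proof -
      have "b \<in> Q" using that(9,13) by blast
      moreover have "level u b \<in> level u ` A" using that(12,14) by (metis imageI)
      ultimately show ?thesis by simp
    qed
    ultimately have "?S \<subseteq> B" using components_maximal[OF that(8), of ?S] that(13,17) by blast
    then show ?thesis using lS by blast
  qed
  have CP: "C \<subseteq> P" by (subst C1) blast
  have CQ: "C' \<subseteq> Q" by (subst C2) blast
  have "level u ` C \<subseteq> level u ` C'"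
    by (rule sub[OF u P(1,2,3) PQ(2) P(4) C(1) C'(1) CQ C1 C2 z(1) C'(2) w(2)[symmetric] Q(1,4,3)])
  moreover have "level u ` C' \<subseteq> level u ` C"
    by (rule sub[OF u Q(1,2,3) PQ(2)[symmetric] Q(4) C'(1) C(1) CP C2 C1 C'(2) z(1) w(2) P(1,4,3)])
  ultimately have lev: "level u ` C' = level u ` C" by blast
  have ne: "C' \<noteq> C" using CP CQ PQ(1) z by auto
  have C2': "C' = {z \<in> Q. level u z \<in> level u ` C}" using C2 unfolding lev .
  show ?thesis
    by (intro bexI[OF _ C'(1)] conjI ne exI[of _ "level u ` C"] C1 C2')
qed

definition difference_region :: "complex set \<Rightarrow> complex set \<Rightarrow> complex set" where
  "difference_region K L = (interior K - L) \<union> (interior L - K)"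

lemma difference_region_commute: "difference_region K L = difference_region L K"
  by (auto simp: difference_region_def)

text \<open>The difference region is the disjoint union of four open overhangs, so each is open and
  closed in it. The overhang of \<open>K\<close> along \<open>u\<close> and that of \<open>L\<close>
  along \<open>- u\<close> have fibres of equal length by \<open>overhang_chords\<close>, hence the
  same levels, and the paired components have the same chord lengths.\<close>

lemma component_partner_overhang:
  assumes K: "convex_body K" and L: "convex_body L" and u: "norm u = 1" and eq: "xray u K = xray u L"
    and C: "C \<in> components (difference_region K L)" "C \<inter> overhang K L u \<noteq> {}"
  shows "\<exists>C'\<in>components (difference_region K L). C' \<noteq> C \<and>
    (\<forall>p. measure lborel {t. p + t *\<^sub>R u \<in> C} = measure lborel {t. p + t *\<^sub>R u \<in> C'})"
proof -
  let ?D = "difference_region K L" and ?P = "overhang K L u" and ?Q = "overhang L K (- u)"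
  have cl: "closed K" "closed L" "convex K" "convex L" using K L by (auto simp: convex_body_def compact_imp_closed)
  note ch = overhang_chords[OF K L u eq]
  have D1: "interior K - L = ?P \<union> overhang K L (- u)" by (rule overhang_cover[OF K L u eq])
  have D2: "interior L - K = ?Q \<union> overhang L K u"
    using overhang_cover[OF L K u eq[symmetric]] by auto
  have d1: "?P \<inter> overhang K L (- u) = {}" using overhang_disjoint[OF cl(4)] .
  have d2: "?Q \<inter> overhang L K u = {}" using overhang_disjoint[OF cl(3), of L u] by auto
  have d3: "(interior K - L) \<inter> (interior L - K) = {}" using interior_subset by blast
  have op: "open ?P" "open ?Q" "open (overhang K L (- u))" "open (overhang L K u)"
    using cl by (auto intro!: open_overhang)
  have oD: "open ?D" unfolding difference_region_def using cl by (intro open_Un open_Diff) auto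
  have "?D - ?P = overhang K L (- u) \<union> (interior L - K)" unfolding difference_region_def using D1 D2 d1 d3 by auto
  then have oP: "open (?D - ?P)" using op cl by (auto intro!: open_Un open_Diff)
  have "?D - ?Q = overhang L K u \<union> (interior K - L)" unfolding difference_region_def using D1 D2 d2 d3 by auto
  then have oQ: "open (?D - ?Q)" using op cl by (auto intro!: open_Un open_Diff)
  have sub: "?P \<subseteq> ?D" "?Q \<subseteq> ?D" unfolding difference_region_def using D1 D2 by auto
  have conP: "connected {t. p + t *\<^sub>R u \<in> ?P}" and conQ: "connected {t. p + t *\<^sub>R u \<in> ?Q}" for p
    using ch[of p] by auto
  have PQ: "?P \<inter> ?Q = {}" using D1 D2 d3 by auto
  have iff: "{t. p + t *\<^sub>R u \<in> ?P} = {} \<longleftrightarrow> {t. p + t *\<^sub>R u \<in> ?Q} = {}" for p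
  proof -
    obtain a b a' b' where h: "{t. p + t *\<^sub>R u \<in> ?P} = {a<..<b}" "{t. p + t *\<^sub>R u \<in> ?Q} = {a'<..<b'}" "b - a = b' - a'"
      using ch[of p] by blast
    then show ?thesis unfolding h(1,2) by (simp add: greaterThanLessThan_empty_iff) (use h(3) in linarith)
  qed
  have lev: "level u ` ?P = level u ` ?Q"
  proof (intro subset_antisym subsetI)
    fix y assume "y \<in> level u ` ?P"
    then obtain p where p: "p + 0 *\<^sub>R u \<in> ?P" "y = level u p" by auto
    then obtain t where "p + t *\<^sub>R u \<in> ?Q" using iff[of p] by blast
    then show "y \<in> level u ` ?Q" using p(2) by (intro image_eqI[of _ _ "p + t *\<^sub>R u"]) auto
  next
    fix y assume "y \<in> level u ` ?Q"
    then obtain p where p: "p + 0 *\<^sub>R u \<in> ?Q" "y = level u p" by auto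
    then obtain t where "p + t *\<^sub>R u \<in> ?P" using iff[of p] by blast
    then show "y \<in> level u ` ?P" using p(2) by (intro image_eqI[of _ _ "p + t *\<^sub>R u"]) auto
  qed
  obtain C' J where C': "C' \<in> components ?D" "C' \<noteq> C" "C = {z \<in> ?P. level u z \<in> J}" "C' = {z \<in> ?Q. level u z \<in> J}"
    using component_partner_slab[OF u oD op(1) oP sub(1) conP op(2) oQ sub(2) conQ PQ lev C] by blast
  have "measure lborel {t. p + t *\<^sub>R u \<in> C} = measure lborel {t. p + t *\<^sub>R u \<in> C'}" for p
  proof -
    obtain a b a' b' where h: "{t. p + t *\<^sub>R u \<in> ?P} = {a<..<b}" "{t. p + t *\<^sub>R u \<in> ?Q} = {a'<..<b'}" "b - a = b' - a'"
      using ch[of p] by blast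
    have "{t. p + t *\<^sub>R u \<in> C} = (if level u p \<in> J then {a<..<b} else {})"
      unfolding C'(3) h(1)[symmetric] by auto
    moreover have "{t. p + t *\<^sub>R u \<in> C'} = (if level u p \<in> J then {a'<..<b'} else {})"
      unfolding C'(4) h(2)[symmetric] by auto
    moreover have "measure lborel {a<..<b} = measure lborel {a'<..<b'}"
      using h(3) by (cases "a \<le> b"; cases "a' \<le> b'") auto
    ultimately show ?thesis by simp
  qed
  then show ?thesis by (intro bexI[OF _ C'(1)] conjI C'(2) allI)
qed

text \<open>Swapping the bodies and reversing \<open>u\<close>, which changes neither X-rays nor
  chord lengths, reduces the four kinds of overhang to one.\<close>

lemma component_partner:
  assumes K: "convex_body K" and L: "convex_body L" and u: "norm u = 1" and eq: "xray u K = xray u L"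
    and C: "C \<in> components (difference_region K L)"
  shows "\<exists>C'\<in>components (difference_region K L). C' \<noteq> C \<and>
    (\<forall>p. measure lborel {t. p + t *\<^sub>R u \<in> C} = measure lborel {t. p + t *\<^sub>R u \<in> C'})"
proof -
  let ?D = "difference_region K L"
  have mneg: "measure lborel {t. p + t *\<^sub>R (- u) \<in> S} = measure lborel {t. p + t *\<^sub>R u \<in> S}" if "open S" for p S
  proof -
    have o: "open ((\<lambda>t. p + t *\<^sub>R u) -` S)" by (intro open_vimage that continuous_intros)
    then have m: "{t. p + t *\<^sub>R u \<in> S} \<in> sets borel" by (simp add: vimage_def)
    have "measure lborel {t. p + t *\<^sub>R u \<in> S} = measure (distr lborel borel uminus) {t. p + t *\<^sub>R u \<in> S}"
      by (simp add: lborel_distr_uminus)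
    also have "\<dots> = measure lborel {t. p + t *\<^sub>R (- u) \<in> S}" using m by (simp add: measure_distr vimage_def)
    finally show ?thesis by simp
  qed
  have x': "xray (- u) M = xray u M" if "convex_body M" for M
  proof (rule ext)
    fix p
    have "closed M" using that by (simp add: convex_body_def compact_imp_closed)
    then have "closed ((\<lambda>t. p + t *\<^sub>R u) -` M)" by (intro closed_vimage continuous_intros)
    then have m: "{t. p + t *\<^sub>R u \<in> M} \<in> sets borel" by (simp add: vimage_def)
    have "xray u M p = measure (distr lborel borel uminus) {t. p + t *\<^sub>R u \<in> M}"
      by (simp add: lborel_distr_uminus xray_def)
    also have "\<dots> = xray (- u) M p" using m by (simp add: measure_distr vimage_def xray_def)
    finally show "xray (- u) M p = xray u M p" by simp
  qed
  have eq': "xray (- u) K = xray (- u) L" using eq x' K L by simp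
  have oD: "open ?D" unfolding difference_region_def using K L
    by (intro open_Un open_Diff) (auto simp: convex_body_def compact_imp_closed)
  have oC: "open C'" if "C' \<in> components ?D" for C' using open_components[OF oD that] .
  obtain z where z: "z \<in> C" using C in_components_nonempty by blast
  have "z \<in> ?D" using z C in_components_subset by blast
  then consider "z \<in> overhang K L u" | "z \<in> overhang K L (- u)" | "z \<in> overhang L K u" | "z \<in> overhang L K (- u)"
    using overhang_cover[OF K L u eq] overhang_cover[OF L K u eq[symmetric]] unfolding difference_region_def by blast
  then show ?thesis
  proof cases
    case 1 then show ?thesis using component_partner_overhang[OF K L u eq C] z by blast
  next
    case 2
    then have "C \<inter> overhang K L (- u) \<noteq> {}" using z by blast
    from component_partner_overhang[OF K L _ eq' C this] u
    obtain C' where C': "C'\<in>components ?D" "C' \<noteq> C" "\<And>p. measure lborel {t. p + t *\<^sub>R (- u) \<in> C} = measure lborel {t. p + t *\<^sub>R (- u) \<in> C'}" by auto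
    then show ?thesis using mneg[OF oC[OF C]] mneg[OF oC[OF C'(1)]] by metis
  next
    case 3
    then show ?thesis using component_partner_overhang[OF L K u eq[symmetric]] C z difference_region_commute by (metis IntI empty_iff)
  next
    case 4
    then have "C \<inter> overhang L K (- u) \<noteq> {}" using z by blast
    moreover have "C \<in> components (difference_region L K)"
      using C difference_region_commute[of K L] by simp
    moreover have "norm (- u) = 1" using u by simp
    ultimately have "\<exists>C'\<in>components (difference_region L K). C' \<noteq> C \<and>
        (\<forall>p. measure lborel {t. p + t *\<^sub>R (- u) \<in> C} = measure lborel {t. p + t *\<^sub>R (- u) \<in> C'})"
      by (intro component_partner_overhang[OF L K _ eq'[symmetric]])
    then
    obtain C' where C': "C'\<in>components ?D" "C' \<noteq> C" "\<And>p. measure lborel {t. p + t *\<^sub>R (- u) \<in> C} = measure lborel {t. p + t *\<^sub>R (- u) \<in> C'}"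
      unfolding difference_region_commute[of L K] by blast
    then show ?thesis using mneg[OF oC[OF C]] mneg[OF oC[OF C'(1)]] by metis
  qed
qed

subsection \<open>Convex hulls of the components\<close>

definition cross :: "complex \<Rightarrow> complex \<Rightarrow> real" where
  "cross a b = Re a * Im b - Im a * Re b"

lemma cross_simps [simp]:
  "cross a (b + c) = cross a b + cross a c" "cross (a + b) c = cross a c + cross b c"
  "cross a (b - c) = cross a b - cross a c" "cross (a - b) c = cross a c - cross b c"
  "cross (t *\<^sub>R a) b = t * cross a b" "cross a (t *\<^sub>R b) = t * cross a b" "cross a a = 0"
  "cross a 0 = 0" "cross 0 a = 0" "cross (- a) b = - cross a b" "cross a (- b) = - cross a b"
  by (auto simp: cross_def algebra_simps)

lemma level_eq_cross: "level u z = cross u z"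
  by (simp add: level_def cross_def)

lemma cross_commute: "cross a b = - cross b a"
  by (simp add: cross_def)

lemma cross_eq_0_imp_scaleR:
  assumes "cross a b = 0" "a \<noteq> 0"
  obtains t where "b = t *\<^sub>R a"
proof
  have "Re a ^ 2 + Im a ^ 2 \<noteq> 0" using assms(2) by (simp add: complex_eq_iff sum_power2_eq_zero_iff)
  then show "b = ((Re a * Re b + Im a * Im b) / (Re a ^ 2 + Im a ^ 2)) *\<^sub>R a"
    using assms(1) by (simp add: cross_def complex_eq_iff field_simps power2_eq_square)
qed

lemma continuous_on_cross [continuous_intros]:
  "continuous_on A f \<Longrightarrow> continuous_on A g \<Longrightarrow> continuous_on A (\<lambda>x. cross (f x) (g x))"
  unfolding cross_def by (intro continuous_intros)

lemma component_disjoint_hull_left: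
  assumes K: "convex K" and L: "convex L"
    and C: "C \<in> components (difference_region K L)" and x: "x \<in> C" "x \<in> interior K" "x \<notin> L"
  shows "x \<notin> convex hull (difference_region K L - C)"
proof -
  \<comment> \<open>The points whose segment from \<open>x\<close> meets \<open>L\<close>. They include every other component: a segment in
    \<open>interior K\<close> that starts at \<open>x\<close> and avoids \<open>L\<close> stays in \<open>C\<close>.\<close>
  define G where "G = {z. \<exists>m. 0 < m \<and> m \<le> 1 \<and> x + m *\<^sub>R (z - x) \<in> L}"
  have "convex G"
  proof (rule convexI)
    fix y z :: complex and c d :: real
    assume h: "y \<in> G" "z \<in> G" "0 \<le> c" "0 \<le> d" "c + d = 1"
    then obtain m n where m: "0 < m" "m \<le> 1" "x + m *\<^sub>R (y - x) \<in> L"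
      and n: "0 < n" "n \<le> 1" "x + n *\<^sub>R (z - x) \<in> L" unfolding G_def by auto
    \<comment> \<open>The segment from \<open>x\<close> to the combination of \<open>y\<close> and
      \<open>z\<close> meets \<open>L\<close> at parameter \<open>1 / q\<close>, in the convex
      combination of the two given points with weights \<open>c / (m * q)\<close> and
      \<open>d / (n * q)\<close>.\<close>
    define q where "q = c / m + d / n"
    have "c / m \<ge> c" "d / n \<ge> d" using m n h by (simp_all add: le_divide_eq mult_left_le)
    then have q: "q \<ge> 1" using h(5) by (simp add: q_def)
    have e: "c / (m * q) + d / (n * q) = 1"
    proof -
      have "c / (m * q) + d / (n * q) = (c / m + d / n) / q" by (simp add: add_divide_distrib)
      then show ?thesis using q by (simp add: q_def[symmetric])
    qed
    have "(c / (m * q)) *\<^sub>R (x + m *\<^sub>R (y - x)) + (d / (n * q)) *\<^sub>R (x + n *\<^sub>R (z - x)) \<in> L"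
      by (rule convexD[OF L m(3) n(3) _ _ e]) (use h m n q in auto)
    also have "(c / (m * q)) *\<^sub>R (x + m *\<^sub>R (y - x)) + (d / (n * q)) *\<^sub>R (x + n *\<^sub>R (z - x))
        = (c / (m * q) + d / (n * q)) *\<^sub>R x + (c / q) *\<^sub>R (y - x) + (d / q) *\<^sub>R (z - x)"
      using m n by (simp add: scaleR_add_right scaleR_add_left)
    also have "\<dots> = x + (1 / q) *\<^sub>R (c *\<^sub>R y + d *\<^sub>R z - (c + d) *\<^sub>R x)"
      unfolding e by (simp add: algebra_simps)
    finally have "x + (1 / q) *\<^sub>R (c *\<^sub>R y + d *\<^sub>R z - x) \<in> L" using h(5) by simp
    then show "c *\<^sub>R y + d *\<^sub>R z \<in> G" using q unfolding G_def by (auto intro!: exI[of _ "1 / q"])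
  qed
  moreover have "difference_region K L - C \<subseteq> G"
  proof
    fix z assume z: "z \<in> difference_region K L - C"
    show "z \<in> G"
    proof (cases "z \<in> L")
      case True
      then show ?thesis unfolding G_def by (auto intro!: exI[of _ 1])
    next
      case False
      then have zK: "z \<in> interior K" using z interior_subset by (auto simp: difference_region_def)
      have seg: "closed_segment x z \<subseteq> interior K"
        using x(2) zK K by (intro closed_segment_subset convex_interior)
      have "\<not> closed_segment x z \<subseteq> - L"
      proof
        assume "closed_segment x z \<subseteq> - L"
        then have "closed_segment x z \<subseteq> difference_region K L" using seg by (auto simp: difference_region_def)
        moreover have "C \<inter> closed_segment x z \<noteq> {}" using x(1) by auto
        ultimately have "closed_segment x z \<subseteq> C"
          using components_maximal[OF C connected_segment(1)] by blast
        then show False using z by auto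
      qed
      then obtain y where y: "y \<in> closed_segment x z" "y \<in> L" by auto
      then obtain m where m: "0 \<le> m" "m \<le> 1" "y = (1 - m) *\<^sub>R x + m *\<^sub>R z" by (auto simp: in_segment)
      then have y': "y = x + m *\<^sub>R (z - x)" by (simp add: algebra_simps)
      have "m \<noteq> 0" using y x(3) y' by auto
      then have "0 < m" using m(1) by simp
      moreover have "x + m *\<^sub>R (z - x) \<in> L" using y(2) y' by simp
      ultimately show ?thesis using m(2) unfolding G_def by blast
    qed
  qed
  moreover have "x \<notin> G" by (simp add: G_def x(3))
  ultimately show ?thesis using hull_minimal[of _ G convex] by blast
qed

lemma component_disjoint_hull:
  assumes "convex K" "convex L" and C: "C \<in> components (difference_region K L)" and x: "x \<in> C"
  shows "x \<notin> convex hull (difference_region K L - C)"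
proof -
  have "x \<in> difference_region K L" using C x in_components_subset by blast
  then consider "x \<in> interior K" "x \<notin> L" | "x \<in> interior L" "x \<notin> K" by (auto simp: difference_region_def)
  then show ?thesis
  proof cases
    case 1 then show ?thesis using component_disjoint_hull_left[OF assms] by blast
  next
    case 2 then show ?thesis
      using component_disjoint_hull_left[OF assms(2,1) _ x] C difference_region_commute[of K L] by simp
  qed
qed

text \<open>\<open>C\<close> lies in one of the open half planes bounded by the line through
  \<open>w\<close>, and these are convex.\<close>

lemma connected_avoids_line:
  assumes "connected C" "\<And>x. x \<in> C \<Longrightarrow> cross b (x - w) \<noteq> 0"
  shows "w \<notin> convex hull C"
proof
  assume w: "w \<in> convex hull C"
  let ?f = "\<lambda>x. cross b (x - w)"
  have oP: "open {x. ?f x > 0}" and oN: "open {x. ?f x < 0}"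
    by (intro open_Collect_less continuous_intros)+
  have "C \<subseteq> {x. ?f x > 0} \<or> C \<subseteq> {x. ?f x < 0}"
  proof (rule ccontr)
    assume "\<not> ?thesis"
    then have "{x. ?f x < 0} \<inter> C \<noteq> {}" "{x. ?f x > 0} \<inter> C \<noteq> {}" using assms(2) by force+
    moreover have "C \<subseteq> {x. ?f x > 0} \<union> {x. ?f x < 0}" using assms(2) by force
    ultimately show False using connectedD[OF assms(1) oP oN] by force
  qed
  moreover have "convex {x. ?f x > 0}" "convex {x. ?f x < 0}"
  proof -
    have "{x. ?f x > 0} = {x. inner (- \<i> * b) x < - cross b w}" "{x. ?f x < 0} = {x. inner (- \<i> * b) x > - cross b w}"
      by (auto simp: cross_def inner_complex_def algebra_simps)
    then show "convex {x. ?f x > 0}" "convex {x. ?f x < 0}" by (simp_all add: convex_halfspace_lt convex_halfspace_gt)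
  qed
  ultimately have "convex hull C \<subseteq> {x. ?f x > 0} \<or> convex hull C \<subseteq> {x. ?f x < 0}"
    using hull_minimal[of C _ convex] by blast
  then show False using w by auto
qed

text \<open>The boundary rays of the cone at \<open>w\<close> are avoided, so \<open>C\<close>,
  having a point in the closed cone, lies in the open one and hence strictly on one side of a line
  through \<open>w\<close>.\<close>

lemma connected_avoids_cone:
  assumes C: "connected C" and av: "\<And>x k. x \<in> C \<Longrightarrow> k \<ge> 0 \<Longrightarrow> x \<noteq> w + k *\<^sub>R b \<and> x \<noteq> w + k *\<^sub>R c"
    and x: "w + s *\<^sub>R b + t *\<^sub>R c \<in> C" "s \<ge> 0" "t \<ge> 0" and pos: "cross b c > 0"
  shows "w \<notin> convex hull C"
proof -
  have b0: "b \<noteq> 0" "c \<noteq> 0" using pos by auto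
  let ?P = "{x. cross b (x - w) > 0} \<inter> {x. cross (x - w) c > 0}"
  let ?N = "{x. cross b (x - w) < 0} \<union> {x. cross (x - w) c < 0}"
  have o: "open ?P" "open ?N"
    by (intro open_Int open_Un open_Collect_less continuous_intros)+
  have cov: "y \<in> ?P \<union> ?N" if y: "y \<in> C" for y
  proof (rule ccontr)
    assume n: "y \<notin> ?P \<union> ?N"
    then have "cross b (y - w) = 0 \<or> cross (y - w) c = 0" "cross b (y - w) \<ge> 0" "cross (y - w) c \<ge> 0" by auto
    then consider "cross b (y - w) = 0" "cross (y - w) c \<ge> 0" | "cross c (y - w) = 0" "cross b (y - w) \<ge> 0"
      using cross_commute[of "y - w" c] by auto
    then show False
    proof cases
      case 1
      obtain k where k: "y - w = k *\<^sub>R b" using cross_eq_0_imp_scaleR[OF 1(1) b0(1)] .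
      then have "k \<ge> 0" using 1(2) pos by (simp add: zero_le_mult_iff k)
      then show False using av[OF y, of k] k by (simp add: algebra_simps)
    next
      case 2
      obtain k where k: "y - w = k *\<^sub>R c" using cross_eq_0_imp_scaleR[OF 2(1) b0(2)] .
      then have "k \<ge> 0" using 2(2) pos by (simp add: zero_le_mult_iff k)
      then show False using av[OF y, of k] k by (simp add: algebra_simps)
    qed
  qed
  let ?x = "w + s *\<^sub>R b + t *\<^sub>R c"
  have "cross b (?x - w) = t * cross b c" "cross (?x - w) c = s * cross b c" by simp_all
  then have "?x \<notin> ?N" using x pos by (simp add: mult_less_0_iff)
  then have xP: "?x \<in> ?P" using cov[OF x(1)] by blast
  have "?N \<inter> C = {}"
    using connectedD[OF C o] cov xP x(1) by force
  then have "C \<subseteq> ?P" using cov by blast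
  then show ?thesis by (intro connected_avoids_line[OF C, of b]) auto
qed

text \<open>The connectedness of \<open>C\<close> is essential: for the end points of the two
  diagonals of a square the hulls cross, although neither contains a point of the other set.\<close>

lemma convex_hulls_disjoint:
  fixes C R :: "complex set"
  assumes C: "connected C" and CR: "\<And>x. x \<in> C \<Longrightarrow> x \<notin> convex hull R" and RC: "\<And>z. z \<in> R \<Longrightarrow> z \<notin> convex hull C"
  shows "convex hull C \<inter> convex hull R = {}"
proof (rule ccontr)
  assume "\<not> ?thesis"
  then obtain w where w: "w \<in> convex hull C" "w \<in> convex hull R" by blast
  have A: "x \<noteq> w + k *\<^sub>R (z - w)" if h: "x \<in> C" "z \<in> R" "k \<ge> 0" for x z k
  proof
    assume x: "x = w + k *\<^sub>R (z - w)"
    show False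
    proof (cases "k \<le> 1")
      case True
      have "(1 - k) *\<^sub>R w + k *\<^sub>R z \<in> convex hull R"
        using True h w(2) hull_inc[of z R convex] by (intro convexD[OF convex_convex_hull]) auto
      moreover have "x = (1 - k) *\<^sub>R w + k *\<^sub>R z" by (simp add: x algebra_simps)
      ultimately show False using CR h(1) by simp
    next
      case False
      have "(1 - 1 / k) *\<^sub>R w + (1 / k) *\<^sub>R x \<in> convex hull C"
        using False h w(1) hull_inc[of x C convex] by (intro convexD[OF convex_convex_hull]) auto
      moreover have "z = (1 - 1 / k) *\<^sub>R w + (1 / k) *\<^sub>R x"
        using False by (simp add: x algebra_simps)
      ultimately show False using RC h(2) by simp
    qed
  qed
  have wz: "z - w \<noteq> 0" if "z \<in> R" for z using RC[OF that] w(1) by auto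
  \<comment> \<open>\<open>C\<close> meets no ray from \<open>w\<close> through \<open>R\<close>, hence meets the opposite rays. By Caratheodory the ray
    opposite to some \<open>z1 \<in> R\<close> lies in the cone at \<open>w\<close> over two points of \<open>R\<close>; as \<open>C\<close> does not meet the
    boundary of this cone, it stays inside and cannot have \<open>w\<close> in its hull.\<close>
  have B: "\<exists>s>0. w - s *\<^sub>R (z - w) \<in> C" if z: "z \<in> R" for z
  proof -
    obtain x where x: "x \<in> C" "cross (z - w) (x - w) = 0"
      using connected_avoids_line[OF C, of "z - w" w] w(1) by blast
    then obtain k where k: "x - w = k *\<^sub>R (z - w)" using cross_eq_0_imp_scaleR[OF x(2) wz[OF z]] by blast
    then have xk: "x = w + k *\<^sub>R (z - w)" by (simp add: algebra_simps)
    then have "k < 0" using A[OF x(1) z, of k] by force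
    then show ?thesis using xk x(1) by (intro exI[of _ "- k"]) simp
  qed
  have "\<exists>S. finite S \<and> S \<subseteq> R \<and> card S \<le> 3 \<and> w \<in> convex hull S"
    using w(2) by (subst (asm) caratheodory) simp
  then obtain S where S: "finite S" "S \<subseteq> R" "card S \<le> 3" "w \<in> convex hull S" by blast
  obtain a where a: "\<And>v. v \<in> S \<Longrightarrow> 0 \<le> a v" "sum a S = 1" "(\<Sum>v\<in>S. a v *\<^sub>R v) = w"
    using S(4) unfolding convex_hull_finite[OF S(1)] by auto
  have "\<exists>z1\<in>S. a z1 \<noteq> 0"
  proof (rule ccontr)
    assume "\<not> ?thesis" then have "sum a S = 0" by simp
    then show False using a(2) by simp
  qed
  then obtain z1 where z1: "z1 \<in> S" "a z1 > 0" using a(1) by force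
  have "(\<Sum>v\<in>S. a v *\<^sub>R (v - w)) = (\<Sum>v\<in>S. a v *\<^sub>R v) - (\<Sum>v\<in>S. a v) *\<^sub>R w"
    by (simp add: scaleR_diff_right sum_subtractf scaleR_sum_left)
  then have sum0: "(\<Sum>v\<in>S. a v *\<^sub>R (v - w)) = 0" using a by simp
  have rest: "a z1 *\<^sub>R (z1 - w) + (\<Sum>v\<in>S - {z1}. a v *\<^sub>R (v - w)) = 0"
    using sum0 sum.remove[OF S(1) z1(1), of "\<lambda>v. a v *\<^sub>R (v - w)"] by simp
  have "card (S - {z1}) \<le> 2" using S z1 by simp
  then have "card (S - {z1}) = 0 \<or> card (S - {z1}) = 1 \<or> card (S - {z1}) = 2" by linarith
  then consider "S - {z1} = {}" | z where "S - {z1} = {z}" | y z where "S - {z1} = {y, z}" "y \<noteq> z"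
  proof (elim disjE)
    assume "card (S - {z1}) = 0"
    then have "S - {z1} = {}" using S(1) by (subst (asm) card_0_eq) auto
    then show thesis by (rule that(1))
  next
    assume "card (S - {z1}) = 1"
    then obtain z where "S - {z1} = {z}" using card_1_singletonE by blast
    then show thesis by (rule that(2))
  next
    assume "card (S - {z1}) = 2"
    then obtain y z where "S - {z1} = {y, z}" "y \<noteq> z" by (meson card_2_iff)
    then show thesis by (rule that(3))
  qed
  \<comment> \<open>Missing points are padded with coefficient 0, so that two points of
    \<open>R\<close> always carry the sum.\<close>
  then have "\<exists>z2\<in>R. \<exists>z3\<in>R. \<exists>p\<ge>0. \<exists>q\<ge>0. (\<Sum>v\<in>S - {z1}. a v *\<^sub>R (v - w)) = p *\<^sub>R (z2 - w) + q *\<^sub>R (z3 - w)"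
  proof cases
    case 1
    show ?thesis unfolding 1 using z1 S(2) by (intro bexI[of _ z1] exI[of _ 0] conjI) auto
  next
    case (2 z)
    then have "z \<in> S" by auto
    then show ?thesis unfolding 2 using S(2) a(1) by (intro bexI[of _ z] exI[of _ "a z"] conjI exI[of _ 0]) auto
  next
    case (3 y z)
    then have "y \<in> S" "z \<in> S" by auto
    then show ?thesis unfolding 3(1) using S(2) a(1) 3(2)
      by (intro bexI[of _ y] exI[of _ "a y"] conjI bexI[of _ z] exI[of _ "a z"]) auto
  qed
  then obtain z2 z3 p q where z23: "z2 \<in> R" "z3 \<in> R" "p \<ge> 0" "q \<ge> 0"
    "(\<Sum>v\<in>S - {z1}. a v *\<^sub>R (v - w)) = p *\<^sub>R (z2 - w) + q *\<^sub>R (z3 - w)" by blast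
  obtain s where s: "s > 0" "w - s *\<^sub>R (z1 - w) \<in> C" using B z1(1) S(2) by blast
  \<comment> \<open>Rescaled so that the combination becomes the displacement from \<open>w\<close>
    to the point of \<open>C\<close> on the ray opposite to \<open>z1\<close>.\<close>
  define p' q' where "p' = s / a z1 * p" and "q' = s / a z1 * q"
  have pq: "p' \<ge> 0" "q' \<ge> 0" using s z1 z23 by (auto simp: p'_def q'_def)
  have "a z1 *\<^sub>R (z1 - w) = - (p *\<^sub>R (z2 - w) + q *\<^sub>R (z3 - w))"
    using rest z23(5) by (metis add.commute eq_neg_iff_add_eq_0)
  then have "(s / a z1) *\<^sub>R (a z1 *\<^sub>R (z1 - w)) = - (p' *\<^sub>R (z2 - w) + q' *\<^sub>R (z3 - w))"
    by (simp add: p'_def q'_def scaleR_add_right scaleR_diff_right)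
  then have "- (s *\<^sub>R (z1 - w)) = p' *\<^sub>R (z2 - w) + q' *\<^sub>R (z3 - w)" using z1 by simp
  then have x: "w + p' *\<^sub>R (z2 - w) + q' *\<^sub>R (z3 - w) \<in> C" using s(2) by (metis add.assoc diff_conv_add_uminus)
  consider "cross (z2 - w) (z3 - w) > 0" | "cross (z3 - w) (z2 - w) > 0" | "cross (z2 - w) (z3 - w) = 0"
    using cross_commute[of "z2 - w" "z3 - w"] by linarith
  then show False
  proof cases
    case 1
    then show False using connected_avoids_cone[OF C _ x pq 1] A z23(1,2) w(1) by blast
  next
    case 2
    have x': "w + q' *\<^sub>R (z3 - w) + p' *\<^sub>R (z2 - w) \<in> C" using x by (simp add: add_ac)
    show False using connected_avoids_cone[OF C _ x' pq(2,1) 2] A z23(1,2) w(1) by blast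
  next
    case 3
    \<comment> \<open>The cone degenerates to a line through \<open>w\<close>. The point of
      \<open>C\<close> on it avoids the ray towards \<open>z2\<close>, which forces
      \<open>z3\<close> to the opposite side, and then it lies on the ray towards
      \<open>z3\<close>.\<close>
    obtain k where k: "z3 - w = k *\<^sub>R (z2 - w)" using cross_eq_0_imp_scaleR[OF 3 wz[OF z23(1)]] .
    have xx: "w + p' *\<^sub>R (z2 - w) + q' *\<^sub>R (z3 - w) = w + (p' + q' * k) *\<^sub>R (z2 - w)"
      unfolding k by (simp add: scaleR_left_distrib)
    have neg: "p' + q' * k < 0" using A[OF x z23(1), of "p' + q' * k"] xx by force
    have k0: "k < 0" using neg pq by (smt (verit) mult_nonneg_nonneg)
    have "w + (p' + q' * k) *\<^sub>R (z2 - w) = w + ((p' + q' * k) / k) *\<^sub>R (z3 - w)"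
    proof -
      have kne: "k \<noteq> 0" using k0 by simp
      have "((p' + q' * k) / k) * k = p' + q' * k"
        by (simp only: times_divide_eq_left nonzero_mult_div_cancel_right[OF kne])
      then show ?thesis unfolding k by (simp only: scaleR_scaleR)
    qed
    moreover have "(p' + q' * k) / k \<ge> 0" by (rule divide_nonpos_neg) (use neg k0 in simp_all)
    ultimately show False using A[OF x z23(2)] xx by metis
  qed
qed

subsection \<open>Centroids\<close>

definition centroid :: "complex set \<Rightarrow> complex" where
  "centroid S = (1 / measure lborel S) *\<^sub>R (\<integral>z. indicator S z *\<^sub>R z \<partial>lborel)"

lemma measure_open_pos:
  fixes S :: "complex set"
  assumes "open S" "bounded S" "S \<noteq> {}" shows "measure lborel S > 0"
proof -
  have "emeasure lborel S \<noteq> 0"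
  proof
    assume "emeasure lborel S = 0"
    then have "S \<in> null_sets lebesgue" using assms(1) by (intro null_sets_completionI null_setsI) auto
    then show False using open_not_negligible[OF assms(1,3)] negligible_iff_null_sets by blast
  qed
  moreover have "emeasure lborel S < \<infinity>" using assms(2) emeasure_bounded_finite by blast
  ultimately show ?thesis by (simp add: measure_def enn2real_positive_iff less_top zero_less_iff_neq_zero)
qed

lemma integrable_indicator_times_id:
  fixes S :: "complex set"
  assumes S: "S \<in> sets borel" and "bounded S"
  shows "integrable lborel (\<lambda>z. indicator S z *\<^sub>R z)"
proof -
  obtain B where B: "\<And>z. z \<in> S \<Longrightarrow> norm z \<le> B" using \<open>bounded S\<close> bounded_iff by metis
  have "integrable lborel (\<lambda>z. B * indicator S z :: real)"
    using S emeasure_bounded_finite[OF assms(2)] by (intro integrable_mult_right integrable_real_indicator) auto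
  then show ?thesis
    by (rule Bochner_Integration.integrable_bound)
       (use S in \<open>auto intro!: AE_I2 borel_measurable_scaleR simp: indicator_def intro: order_trans[OF B]\<close>)
qed

lemma integrable_indicator_bounded:
  fixes S :: "complex set"
  assumes "S \<in> sets borel" and "bounded S"
  shows "integrable lborel (indicator S :: complex \<Rightarrow> real)"
  using assms emeasure_bounded_finite[OF assms(2)] by (intro integrable_real_indicator) auto

lemma bounded_linear_centroid:
  fixes S :: "complex set" and f :: "complex \<Rightarrow> real"
  assumes "S \<in> sets borel" "bounded S" "bounded_linear f" "measure lborel S > 0"
  shows "measure lborel S * f (centroid S) = (\<integral>z. indicator S z * f z \<partial>lborel)"
proof -
  interpret bounded_linear f by fact
  have "f (\<integral>z. indicator S z *\<^sub>R z \<partial>lborel) = (\<integral>z. f (indicator S z *\<^sub>R z) \<partial>lborel)"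
    by (rule integral_bounded_linear[symmetric, OF assms(3) integrable_indicator_times_id[OF assms(1,2)]])
  then show ?thesis using assms(4) by (simp add: centroid_def scaleR)
qed

lemma centroid_halfplane:
  fixes S :: "complex set" and a :: complex
  assumes S: "open S" "bounded S" "S \<noteq> {}" and le: "\<And>z. z \<in> S \<Longrightarrow> a \<bullet> z \<le> b"
  shows "a \<bullet> centroid S \<le> b"
proof -
  have m: "measure lborel S > 0" using measure_open_pos[OF S] .
  have bl: "bounded_linear ((\<bullet>) a)" by (rule bounded_linear_inner_right)
  have Sb: "S \<in> sets borel" using S by simp
  have i1: "integrable lborel (\<lambda>z. indicator S z * (a \<bullet> z))"
    using integrable_bounded_linear[OF bl integrable_indicator_times_id[OF Sb S(2)]] by simp
  have i2: "integrable lborel (\<lambda>z. indicator S z * b)"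
    using integrable_indicator_bounded[OF Sb S(2)] by (intro integrable_mult_left)
  have "measure lborel S * (a \<bullet> centroid S) = (\<integral>z. indicator S z * (a \<bullet> z) \<partial>lborel)"
    by (rule bounded_linear_centroid[OF Sb S(2) bl m])
  also have "\<dots> \<le> (\<integral>z. indicator S z * b \<partial>lborel)"
    by (rule integral_mono[OF i1 i2]) (auto simp: indicator_def le)
  also have "\<dots> = measure lborel S * b" using Sb by simp
  finally show ?thesis using m by simp
qed

lemma centroid_halfplane_strict:
  fixes S :: "complex set" and a :: complex
  assumes S: "open S" "bounded S" "S \<noteq> {}" and less: "\<And>z. z \<in> S \<Longrightarrow> a \<bullet> z < b"
  shows "a \<bullet> centroid S < b"
proof (rule ccontr)
  assume n: "\<not> ?thesis"
  have m: "measure lborel S > 0" using measure_open_pos[OF S] .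
  have bl: "bounded_linear ((\<bullet>) a)" by (rule bounded_linear_inner_right)
  have Sb: "S \<in> sets borel" using S by simp
  have i1: "integrable lborel (\<lambda>z. indicator S z * (a \<bullet> z))"
    using integrable_bounded_linear[OF bl integrable_indicator_times_id[OF Sb S(2)]] by simp
  have i2: "integrable lborel (\<lambda>z. indicator S z * b)"
    using integrable_indicator_bounded[OF Sb S(2)] by (intro integrable_mult_left)
  have i: "integrable lborel (\<lambda>z. indicator S z * b - indicator S z * (a \<bullet> z))" using i1 i2 by simp
  have "(\<integral>z. indicator S z * b - indicator S z * (a \<bullet> z) \<partial>lborel) = measure lborel S * b - measure lborel S * (a \<bullet> centroid S)"
    using Sb by (subst Bochner_Integration.integral_diff[OF i2 i1]) (simp add: bounded_linear_centroid[OF Sb S(2) bl m])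
  also have "\<dots> \<le> 0" using n m by simp
  finally have le: "(\<integral>z. indicator S z * b - indicator S z * (a \<bullet> z) \<partial>lborel) \<le> 0" .
  have nn: "AE z in lborel. 0 \<le> indicator S z * b - indicator S z * (a \<bullet> z)"
    using less by (intro AE_I2) (auto simp: indicator_def less_imp_le)
  have "AE z in lborel. indicator S z * b - indicator S z * (a \<bullet> z) = 0"
    using integral_nonneg_eq_0_iff_AE[OF i nn] le integral_nonneg_AE[OF nn] by linarith
  then have "AE z in lborel. z \<notin> S"
    by (rule AE_mp) (use less in \<open>auto intro!: AE_I2 simp: indicator_def split: if_splits\<close>)
  then have "emeasure lborel S = 0"
    using AE_iff_measurable[of S lborel "\<lambda>z. z \<notin> S"] Sb by auto
  then show False using m by (simp add: measure_def)
qed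

text \<open>The difference region may have infinitely many components; this is why the polygon is
  built from the components of one area.\<close>

lemma finite_components_same_measure:
  fixes D :: "complex set"
  assumes D: "open D" "bounded D" and "m > 0"
  shows "finite {C \<in> components D. measure lborel C = m}"
proof (rule ccontr)
  assume inf: "infinite {C \<in> components D. measure lborel C = m}"
  obtain n :: nat where n: "measure lborel D < n * m" using reals_Archimedean3[OF \<open>m > 0\<close>] by blast
  obtain F where F: "finite F" "card F = n" "F \<subseteq> {C \<in> components D. measure lborel C = m}"
    using infinite_arbitrarily_large[OF inf] by blast
  have op: "open C" "C \<subseteq> D" if "C \<in> F" for C
    using that F(3) open_components[OF D(1)] in_components_subset by blast+
  have fin: "emeasure lborel C \<noteq> \<infinity>" if "C \<in> F" for C
    using emeasure_bounded_finite[of C] bounded_subset[OF D(2)] op[OF that] by auto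
  have un: "measure lborel (\<Union>C\<in>F. C) = (\<Sum>C\<in>F. measure lborel C)"
  proof (rule measure_finite_Union[OF F(1)])
    show "disjoint_family_on (\<lambda>C. C) F"
      using F(3) components_nonoverlap unfolding disjoint_family_on_def by blast
  qed (use op fin in auto)
  have nm: "(\<Sum>C\<in>F. measure lborel C) = n * m" using F by (simp add: subset_iff)
  have "measure lborel (\<Union>C\<in>F. C) \<le> measure lborel D"
  proof (rule measure_mono_fmeasurable)
    show "D \<in> fmeasurable lborel" using D emeasure_bounded_finite[of D] by (auto simp: fmeasurable_def)
  qed (use op in \<open>auto intro!: borel_open open_UN\<close>)
  then show False using n un nm by simp
qed

text \<open>\<open>integral_along_direction\<close> with the constant 1 and with the identity as
  weight.\<close>

lemma equal_fibres_measure_centroid: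
  fixes C C' :: "complex set"
  assumes u: "norm u = 1" and C: "open C" "bounded C" "C \<noteq> {}" and C': "open C'" "bounded C'"
    and eq: "\<And>p. measure lborel {t. p + t *\<^sub>R u \<in> C} = measure lborel {t. p + t *\<^sub>R u \<in> C'}"
  shows "measure lborel C' = measure lborel C" "level u (centroid C') = level u (centroid C)"
proof -
  have b: "C \<in> sets borel" "C' \<in> sets borel" using C C' by auto
  have I: "(\<integral>z. indicator C z * g (level u z) \<partial>lborel) = (\<integral>z. indicator C' z * g (level u z) \<partial>lborel)"
    if "continuous_on UNIV g" for g :: "real \<Rightarrow> real"
    using integral_along_direction[OF u b(1) C(2) that] integral_along_direction[OF u b(2) C'(2) that] eq
    by (simp add: level_def)
  show m: "measure lborel C' = measure lborel C" using I[of "\<lambda>_. 1"] b by simp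
  have pos: "measure lborel C > 0" using measure_open_pos[OF C] .
  have bl: "bounded_linear (level u)" using linear_level by (simp add: linear_conv_bounded_linear)
  have "measure lborel C * level u (centroid C') = (\<integral>z. indicator C' z * level u z \<partial>lborel)"
    using bounded_linear_centroid[OF b(2) C'(2) bl] pos m by simp
  also have "\<dots> = (\<integral>z. indicator C z * level u z \<partial>lborel)"
    using I[of "\<lambda>x. x"] by simp
  also have "\<dots> = measure lborel C * level u (centroid C)"
    by (rule bounded_linear_centroid[OF b(1) C(2) bl pos, symmetric])
  finally show "level u (centroid C') = level u (centroid C)" using pos by simp
qed

section \<open>The polygon of centroids\<close>

text \<open>The pairing preserves area, so the components of one area are closed under it. A line
  separating the hull of one component from the hull of the rest of the region separates the
  centroids as well.\<close>

lemma exists_convex_polygon: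
  assumes K: "convex_body K" and L: "convex_body L" and KL: "K \<noteq> L"
    and U: "\<And>u. u \<in> U \<Longrightarrow> norm u = 1" "\<And>u. u \<in> U \<Longrightarrow> xray u K = xray u L"
  obtains V where "finite V" "V \<noteq> {}" "\<And>v. v \<in> V \<Longrightarrow> v \<notin> convex hull (V - {v})"
    "\<And>u v. u \<in> U \<Longrightarrow> v \<in> V \<Longrightarrow> \<exists>v'\<in>V. v' \<noteq> v \<and> level u v' = level u v"
proof -
  let ?D = "difference_region K L"
  have cK: "compact K" "convex K" "interior K \<noteq> {}" and cL: "compact L" "convex L" "interior L \<noteq> {}"
    using K L by (auto simp: convex_body_def)
  have oD: "open ?D" unfolding difference_region_def using cK cL
    by (intro open_Un open_Diff) (auto simp: compact_imp_closed)
  have bD: "bounded ?D"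
  proof (rule bounded_subset)
    show "bounded (K \<union> L)" using cK cL by (simp add: compact_imp_bounded)
    show "?D \<subseteq> K \<union> L" using interior_subset by (auto simp: difference_region_def)
  qed
  \<comment> \<open>Convex bodies are the closures of their interiors, so an empty difference region
    would force \<open>K = L\<close>.\<close>
  have "?D \<noteq> {}"
  proof
    assume e: "?D = {}"
    have sub: "A \<subseteq> B" if "compact A" "convex A" "interior A \<noteq> {}" "compact B" "interior A \<subseteq> B" for A B :: "complex set"
    proof -
      have "A \<subseteq> closure (interior A)"
        using convex_closure_interior[OF that(2,3)] closure_subset[of A] by simp
      also have "\<dots> \<subseteq> B" using that by (simp add: closure_minimal compact_imp_closed)
      finally show ?thesis .
    qed
    have "interior K \<subseteq> L" "interior L \<subseteq> K" using e by (auto simp: difference_region_def)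
    then show False using sub[of K L] sub[of L K] cK cL KL by blast
  qed
  then obtain C0 where C0: "C0 \<in> components ?D" using components_eq_empty by blast
  have comp: "open C" "bounded C" "C \<noteq> {}" if "C \<in> components ?D" for C
    using open_components[OF oD that] in_components_nonempty[OF that] bounded_subset[OF bD in_components_subset[OF that]] by auto
  define m where "m = measure lborel C0"
  have m: "m > 0" unfolding m_def by (intro measure_open_pos comp C0)
  define F where "F = {C \<in> components ?D. measure lborel C = m}"
  have finF: "finite F" unfolding F_def by (rule finite_components_same_measure[OF oD bD m])
  have sep: "centroid C \<notin> convex hull (centroid ` (F - {C}))" if C: "C \<in> F" for C
  proof (cases "?D - C = {}")
    case True
    have "F - {C} = {}"
    proof (rule ccontr)
      assume "F - {C} \<noteq> {}"
      then obtain C' where "C' \<in> components ?D" "C' \<noteq> C" by (auto simp: F_def)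
      then have "C' \<inter> C = {}" using C components_nonoverlap[of C' ?D C] by (auto simp: F_def)
      then show False using True in_components_subset[OF \<open>C' \<in> components ?D\<close>] comp(3)[OF \<open>C' \<in> components ?D\<close>] by blast
    qed
    then have "centroid ` (F - {C}) = {}" by (simp only: image_empty)
    then show ?thesis by (simp only: convex_hull_empty empty_iff not_False_eq_True)
  next
    case False
    have Cc: "C \<in> components ?D" using C by (simp add: F_def)
    have 1: "x \<notin> convex hull (?D - C)" if "x \<in> C" for x
      by (rule component_disjoint_hull[OF cK(2) cL(2) Cc that])
    have 2: "z \<notin> convex hull C" if z: "z \<in> ?D - C" for z
    proof -
      obtain C' where C': "C' \<in> components ?D" "z \<in> C'" using z Union_components by blast
      have "C \<noteq> C'" using C' z by auto
      then have "C \<inter> C' = {}" using components_nonoverlap[OF Cc C'(1)] by simp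
      then have "C \<subseteq> ?D - C'" using in_components_subset[OF Cc] by auto
      then show ?thesis using component_disjoint_hull[OF cK(2) cL(2) C'] hull_mono[of C "?D - C'" convex] by blast
    qed
    have "convex hull C \<inter> convex hull (?D - C) = {}"
      by (rule convex_hulls_disjoint[OF in_components_connected[OF Cc] 1 2])
    moreover have "convex hull C \<noteq> {}" "convex hull (?D - C) \<noteq> {}"
      using comp(3)[OF Cc] False by (simp_all add: convex_hull_eq_empty)
    ultimately have "\<exists>a b. a \<noteq> 0 \<and> (\<forall>x\<in>convex hull C. a \<bullet> x \<le> b) \<and> (\<forall>x\<in>convex hull (?D - C). a \<bullet> x \<ge> b)"
      by (intro separating_hyperplane_sets convex_convex_hull)
    then obtain a b where ab: "a \<noteq> 0" "\<And>x. x \<in> convex hull C \<Longrightarrow> a \<bullet> x \<le> b" "\<And>x. x \<in> convex hull (?D - C) \<Longrightarrow> a \<bullet> x \<ge> b"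
      by blast
    \<comment> \<open>\<open>C\<close> is open, so a point of it on the separating line could be
      pushed across.\<close>
    have lt: "a \<bullet> z < b" if z: "z \<in> C" for z
    proof -
      obtain e where e: "e > 0" "ball z e \<subseteq> C" using comp(1)[OF Cc] z open_contains_ball by blast
      define w where "w = z + (e / (2 * norm a)) *\<^sub>R a"
      have "w \<in> C" using e ab(1) by (intro subsetD[OF e(2)]) (simp add: w_def dist_norm)
      then have "a \<bullet> w \<le> b" by (intro ab(2) hull_inc)
      moreover have "a \<bullet> w = a \<bullet> z + (e / (2 * norm a)) * (a \<bullet> a)" by (simp add: w_def inner_add_right)
      moreover have "(e / (2 * norm a)) * (a \<bullet> a) > 0" using e ab(1) by simp
      ultimately show ?thesis by linarith
    qed
    have c1: "a \<bullet> centroid C < b" by (rule centroid_halfplane_strict[OF comp[OF Cc] lt])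
    have c2: "a \<bullet> centroid C' \<ge> b" if C': "C' \<in> F - {C}" for C'
    proof -
      have C'c: "C' \<in> components ?D" using C' by (simp add: F_def)
      have "C' \<inter> C = {}" using components_nonoverlap[OF C'c Cc] C' by auto
      then have "C' \<subseteq> ?D - C" using in_components_subset[OF C'c] by auto
      then have "a \<bullet> z \<ge> b" if "z \<in> C'" for z using that by (intro ab(3) hull_inc) auto
      then have "(- a) \<bullet> centroid C' \<le> - b" by (intro centroid_halfplane[OF comp[OF C'c]]) simp
      then show ?thesis by simp
    qed
    have "convex hull (centroid ` (F - {C})) \<subseteq> {x. a \<bullet> x \<ge> b}"
      by (intro hull_minimal) (use c2 in \<open>auto simp: convex_halfspace_ge\<close>)
    then show ?thesis using c1 by force
  qed
  show ?thesis
  proof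
    show "finite (centroid ` F)" using finF by simp
    show "centroid ` F \<noteq> {}" using C0 by (auto simp: F_def m_def)
    show "v \<notin> convex hull (centroid ` F - {v})" if v: "v \<in> centroid ` F" for v
    proof -
      obtain C where C: "C \<in> F" "v = centroid C" using v by auto
      have "centroid ` F - {v} \<subseteq> centroid ` (F - {C})" using C by auto
      then show ?thesis using sep[OF C(1)] C(2) hull_mono[of "centroid ` F - {v}" "centroid ` (F - {C})" convex] by blast
    qed
    show "\<exists>v'\<in>centroid ` F. v' \<noteq> v \<and> level u v' = level u v" if u: "u \<in> U" and v: "v \<in> centroid ` F" for u v
    proof -
      obtain C where C: "C \<in> F" "v = centroid C" using v by auto
      have Cc: "C \<in> components ?D" using C by (simp add: F_def)
      obtain C' where C': "C' \<in> components ?D" "C' \<noteq> C"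
        "\<And>p. measure lborel {t. p + t *\<^sub>R u \<in> C} = measure lborel {t. p + t *\<^sub>R u \<in> C'}"
        using component_partner[OF K L U(1)[OF u] U(2)[OF u] Cc] by blast
      note ef = equal_fibres_measure_centroid[OF U(1)[OF u] comp[OF Cc] comp(1,2)[OF C'(1)] C'(3)]
      have "C' \<in> F" using ef(1) C C'(1) by (simp add: F_def)
      moreover have "centroid C' \<noteq> centroid C"
      proof
        assume e: "centroid C' = centroid C"
        have "centroid C' \<in> convex hull (centroid ` (F - {C}))"
          using \<open>C' \<in> F\<close> C'(2) by (intro hull_inc) auto
        then show False using sep[OF C(1)] e by simp
      qed
      ultimately show ?thesis using ef(2) C(2) by blast
    qed
  qed
qed

subsection \<open>Reflections of a convex polygon\<close>

lemma inner_cross_identity: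
  "(a \<bullet> a) * cross p q = (a \<bullet> p) * cross a q - cross a p * (a \<bullet> q)"
  by (simp add: cross_def inner_complex_def algebra_simps)

text \<open>Cramer's rule with the denominator cleared.\<close>

lemma cross_expansion:
  "cross p r *\<^sub>R q = cross q r *\<^sub>R p + cross p q *\<^sub>R r"
  by (simp add: cross_def complex_eq_iff algebra_simps)

lemma cross_rotate: "cross (q - p) (r - p) = cross (r - q) (p - q)"
  by (simp add: cross_def algebra_simps)

text \<open>A vertex \<open>v0\<close> is separated from the others by a line, so they can be sorted
  by slope as seen from it. Convex position excludes equal slopes and makes sorted triples turn
  left: otherwise the middle vertex would lie in the triangle formed by \<open>v0\<close> and the
  other two.\<close>

lemma convex_polygon_enumeration:
  fixes V :: "complex set"
  assumes V: "finite V" "V \<noteq> {}" and cp: "\<And>v. v \<in> V \<Longrightarrow> v \<notin> convex hull (V - {v})"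
  obtains v :: "nat \<Rightarrow> complex" where "bij_betw v {..<card V} V"
    "\<And>i j k. i < j \<Longrightarrow> j < k \<Longrightarrow> k < card V \<Longrightarrow> cross (v j - v i) (v k - v i) > 0"
proof -
  obtain v0 where v0: "v0 \<in> V" using V by blast
  define W where "W = V - {v0}"
  have W: "finite W" "card V = Suc (card W)" "v0 \<notin> W" "V = insert v0 W"
    using V v0 card_Suc_Diff1[OF V(1) v0] by (auto simp: W_def simp del: card_Diff_insert)
  have "closed (convex hull W)" using W(1) finite_imp_compact_convex_hull compact_imp_closed by blast
  moreover have "v0 \<notin> convex hull W" using cp[OF v0] by (simp add: W_def)
  ultimately obtain a b where ab: "a \<bullet> v0 < b" "\<And>x. x \<in> convex hull W \<Longrightarrow> a \<bullet> x > b"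
    using separating_hyperplane_closed_point[of "convex hull W" v0] convex_convex_hull by blast
  have pos: "a \<bullet> (x - v0) > 0" if "x \<in> W" for x
    using ab(1) ab(2)[OF hull_inc[OF that]] by (simp add: inner_diff_right)
  \<comment> \<open>The tangent of the angle from \<open>a\<close> to \<open>x - v0\<close>; by
    \<open>pos\<close> the angle is acute in absolute value, so the tangent orders the
    directions.\<close>
  define \<kappa> where "\<kappa> x = cross a (x - v0) / (a \<bullet> (x - v0))" for x
  have kap: "\<kappa> p < \<kappa> q \<longleftrightarrow> cross (p - v0) (q - v0) > 0" "\<kappa> p = \<kappa> q \<longleftrightarrow> cross (p - v0) (q - v0) = 0"
    if "p \<in> W" "q \<in> W" for p q
  proof -
    have a0: "a \<bullet> a > 0" using pos[OF that(1)] by auto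
    define c where "c = (a \<bullet> a) / ((a \<bullet> (p - v0)) * (a \<bullet> (q - v0)))"
    have c: "c > 0" using a0 pos that by (simp add: c_def)
    have d: "\<kappa> q - \<kappa> p = c * cross (p - v0) (q - v0)"
      unfolding c_def times_divide_eq_left inner_cross_identity
      using pos[OF that(1)] pos[OF that(2)] by (simp add: \<kappa>_def diff_frac_eq mult.commute)
    have "\<kappa> q - \<kappa> p > 0 \<longleftrightarrow> cross (p - v0) (q - v0) > 0"
      unfolding d using mult_less_cancel_left_pos[OF c, of 0] by (simp only: mult_zero_right)
    then show "\<kappa> p < \<kappa> q \<longleftrightarrow> cross (p - v0) (q - v0) > 0" by simp
    have "\<kappa> q - \<kappa> p = 0 \<longleftrightarrow> cross (p - v0) (q - v0) = 0"
      unfolding d mult_eq_0_iff using c by auto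
    then show "\<kappa> p = \<kappa> q \<longleftrightarrow> cross (p - v0) (q - v0) = 0" by auto
  qed
  have nothull: "q \<noteq> (1 - s - t) *\<^sub>R v0 + s *\<^sub>R p + t *\<^sub>R r"
    if "p \<in> W" "q \<in> W" "r \<in> W" "p \<noteq> q" "r \<noteq> q" "s \<ge> 0" "t \<ge> 0" "s + t \<le> 1" for p q r s t
  proof
    assume q: "q = (1 - s - t) *\<^sub>R v0 + s *\<^sub>R p + t *\<^sub>R r"
    have "q \<in> convex hull {v0, p, r}"
      unfolding convex_hull_3 using that q by (intro CollectI exI[of _ "1 - s - t"] exI[of _ s] exI[of _ t]) auto
    moreover have "{v0, p, r} \<subseteq> V - {q}" using that W by auto
    ultimately have "q \<in> convex hull (V - {q})" using hull_mono by blast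
    then show False using cp[of q] that(2) W(4) by blast
  qed
  have inj: "inj_on \<kappa> W"
  proof (rule inj_onI, rule ccontr)
    fix p q assume h: "p \<in> W" "q \<in> W" "\<kappa> p = \<kappa> q" "p \<noteq> q"
    have c: "cross (p - v0) (q - v0) = 0" using kap(2) h by blast
    have "p - v0 \<noteq> 0" using h(1) W(3) by auto
    then obtain t where t: "q - v0 = t *\<^sub>R (p - v0)" using cross_eq_0_imp_scaleR[OF c] by blast
    have "a \<bullet> (q - v0) = t * (a \<bullet> (p - v0))" unfolding t by simp
    then have t0: "t > 0" using pos[OF h(1)] pos[OF h(2)] by (simp add: zero_less_mult_iff)
    have q: "q = v0 + t *\<^sub>R (p - v0)" using t by (simp add: algebra_simps)
    show False
    proof (cases "t \<le> 1")
      case True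
      have "q = (1 - t - 0) *\<^sub>R v0 + t *\<^sub>R p + 0 *\<^sub>R p" by (subst q) (simp add: algebra_simps)
      then show False using nothull[OF h(1,2,1) h(4,4), of t 0] t0 True by simp
    next
      case False
      have "p = (1 - 1 / t - 0) *\<^sub>R v0 + (1 / t) *\<^sub>R q + 0 *\<^sub>R q" using t0 by (subst q) (simp add: algebra_simps)
      then show False using nothull[OF h(2,1,2), of "1 / t" 0] h(4) t0 False by simp
    qed
  qed
  define ks where "ks = sorted_list_of_set (\<kappa> ` W)"
  have ks: "length ks = card W" "set ks = \<kappa> ` W" "sorted_wrt (<) ks"
    using W(1) inj by (auto simp: ks_def card_image)
  define v where "v i = (case i of 0 \<Rightarrow> v0 | Suc i \<Rightarrow> the_inv_into W \<kappa> (ks ! i))" for i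
  have vS: "v (Suc i) \<in> W" "\<kappa> (v (Suc i)) = ks ! i" if "i < card W" for i
  proof -
    have "ks ! i \<in> \<kappa> ` W" using that ks by (metis nth_mem)
    then show "v (Suc i) \<in> W" "\<kappa> (v (Suc i)) = ks ! i"
      by (auto simp: v_def the_inv_into_into[OF inj] f_the_inv_into_f[OF inj])
  qed
  have v_0: "v 0 = v0" by (simp add: v_def)
  have lt: "\<kappa> (v i) < \<kappa> (v j)" if "0 < i" "i < j" "j < card V" for i j
  proof -
    obtain i' j' where ij: "i = Suc i'" "j = Suc j'" using \<open>0 < i\<close> \<open>i < j\<close> by (metis gr0_implies_Suc less_trans)
    then have "ks ! i' < ks ! j'" using that ks W(2) by (simp add: sorted_wrt_nth_less)
    then show ?thesis using vS(2)[of i'] vS(2)[of j'] ij that W(2) by simp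
  qed
  have vW: "v i \<in> W" if "0 < i" "i < card V" for i
    using vS(1)[of "i - 1"] that W(2) by (cases i) auto
  have c0: "cross (v i - v0) (v j - v0) > 0" if "0 < i" "i < j" "j < card V" for i j
    using kap(1)[OF vW vW, of i j] lt[OF that] that by auto
  have main: "cross (v j - v i) (v k - v i) > 0" if h: "i < j" "j < k" "k < card V" for i j k
  proof (cases "i = 0")
    case True
    then show ?thesis using c0[of j k] h v_0 by simp
  next
    case False
    let ?p = "v i - v0" and ?q = "v j - v0" and ?r = "v k - v0"
    have pos3: "cross ?p ?q > 0" "cross ?q ?r > 0" "cross ?p ?r > 0" using c0 h False by auto
    show ?thesis
    proof (rule ccontr)
      assume "\<not> ?thesis"
      moreover have "cross (v j - v i) (v k - v i) = cross ?q ?r + cross ?p ?q - cross ?p ?r"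
        by (simp add: cross_def algebra_simps)
      ultimately have le: "cross ?q ?r + cross ?p ?q \<le> cross ?p ?r" by linarith
      \<comment> \<open>The coefficients of \<open>?q\<close> in the basis \<open>?p\<close>,
        \<open>?r\<close>; by \<open>le\<close> their sum is at most 1, which places
        \<open>v j\<close> in the triangle with corners \<open>v0\<close>, \<open>v i\<close>,
        \<open>v k\<close>.\<close>
      define s t where "s = cross ?q ?r / cross ?p ?r" and "t = cross ?p ?q / cross ?p ?r"
      have st: "s \<ge> 0" "t \<ge> 0" "s + t \<le> 1"
        using pos3 le by (auto simp: s_def t_def add_divide_distrib[symmetric])
      have div: "Q = (y / d) *\<^sub>R P + (z / d) *\<^sub>R R" if "d *\<^sub>R Q = y *\<^sub>R P + z *\<^sub>R R" "d > 0"
        for d y z :: real and P Q R :: complex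
      proof -
        have "(1 / d) *\<^sub>R (d *\<^sub>R Q) = (1 / d) *\<^sub>R (y *\<^sub>R P + z *\<^sub>R R)" using that(1) by (simp only:)
        then show ?thesis using that(2) by (simp add: scaleR_add_right)
      qed
      have "?q = s *\<^sub>R ?p + t *\<^sub>R ?r"
        unfolding s_def t_def by (rule div[OF cross_expansion pos3(3)])
      then have "v j = v0 + s *\<^sub>R ?p + t *\<^sub>R ?r" by (simp add: algebra_simps)
      also have "\<dots> = (1 - s - t) *\<^sub>R v0 + s *\<^sub>R v i + t *\<^sub>R v k" by (simp add: algebra_simps)
      finally have e: "v j = (1 - s - t) *\<^sub>R v0 + s *\<^sub>R v i + t *\<^sub>R v k" .
      have W3: "v i \<in> W" "v j \<in> W" "v k \<in> W" using vW h False by auto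
      have "v i \<noteq> v j" "v k \<noteq> v j" using lt[of i j] lt[of j k] h False by auto
      then show False using nothull[OF W3] st e by blast
    qed
  qed
  have vinj: "inj_on v {..<card V}"
  proof (rule linorder_inj_onI)
    fix i j assume h: "i < j" "i \<in> {..<card V}" "j \<in> {..<card V}"
    show "v i \<noteq> v j"
    proof (cases "i = 0")
      case True then show ?thesis using vW[of j] h W(3) v_0 by auto
    next
      case False then show ?thesis using lt[of i j] h by auto
    qed
  qed auto
  have "v ` {..<card V} \<subseteq> V"
  proof
    fix x assume "x \<in> v ` {..<card V}"
    then obtain i where "i < card V" "x = v i" by auto
    then show "x \<in> V" using vW[of i] v_0 v0 W(4) by (cases "i = 0") auto
  qed
  then have "v ` {..<card V} = V"
    using card_image[OF vinj] V(1) by (intro card_subset_eq) auto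
  then have "bij_betw v {..<card V} V" using vinj by (simp add: bij_betw_def)
  then show ?thesis using main that by blast
qed

text \<open>Reduction modulo \<open>N\<close> keeps the three indices in cyclic order, and
  \<open>cross_rotate\<close> makes the orientation independent of the starting point of the cycle.
  The cases count how many of \<open>j\<close>, \<open>k\<close> wrap around.\<close>

lemma cyclic_polygon:
  fixes v :: "nat \<Rightarrow> complex"
  assumes N: "N > 0" and ccw: "\<And>i j k. i < j \<Longrightarrow> j < k \<Longrightarrow> k < N \<Longrightarrow> cross (v j - v i) (v k - v i) > 0"
    and h: "i < j" "j < k" "k < i + N"
  shows "cross (v (j mod N) - v (i mod N)) (v (k mod N) - v (i mod N)) > 0"
proof -
  define q where "q = i div N"
  define i0 where "i0 = i mod N"
  have i: "i = q * N + i0" "i0 < N" using N by (auto simp: q_def i0_def)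
  have im: "i mod N = i0" by (simp add: i0_def)
  have red: "x mod N = (if x < q * N + N then x - q * N else x - q * N - N)" if "i < x" "x < i + N" for x
  proof (cases "x < q * N + N")
    case True
    have "x = (x - q * N) + q * N" using that i by simp
    then have "x mod N = (x - q * N) mod N" by (metis mod_mult_self1)
    also have "\<dots> = x - q * N" using True that i by simp
    finally show ?thesis using True by simp
  next
    case False
    have "x = (x - q * N - N) + (Suc q) * N" using that i False by simp
    then have "x mod N = (x - q * N - N) mod N" by (metis mod_mult_self1)
    also have "\<dots> = x - q * N - N" using False that i by simp
    finally show ?thesis using False by simp
  qed
  have jm: "j mod N = (if j < q * N + N then j - q * N else j - q * N - N)" using h by (intro red) auto
  have km: "k mod N = (if k < q * N + N then k - q * N else k - q * N - N)" using h by (intro red) auto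
  consider "k < q * N + N" | "j < q * N + N" "\<not> k < q * N + N" | "\<not> j < q * N + N" by blast
  then show ?thesis
  proof cases
    case 1
    then show ?thesis unfolding im jm km using ccw[of i0 "j - q * N" "k - q * N"] h i by simp
  next
    case 2
    then have "cross (v i0 - v (k - q * N - N)) (v (j - q * N) - v (k - q * N - N)) > 0"
      using h i by (intro ccw) auto
    then show ?thesis unfolding im jm km using 2 cross_rotate[of "v i0" "v (k - q * N - N)" "v (j - q * N)"] by simp
  next
    case 3
    then have "cross (v (k - q * N - N) - v (j - q * N - N)) (v i0 - v (j - q * N - N)) > 0"
      using h i by (intro ccw) auto
    moreover have "\<not> k < q * N + N" using 3 h by simp
    ultimately show ?thesis unfolding im jm km using 3 cross_rotate[of "v (j - q * N - N)" "v i0" "v (k - q * N - N)"] by simp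
  qed
qed

text \<open>Periodic indexing lets any \<open>N\<close> consecutive indices enumerate the polygon,
  so that an arc may start at any vertex.\<close>

locale ccw_polygon =
  fixes N :: nat and w :: "nat \<Rightarrow> complex"
  assumes N: "N \<ge> 3" and periodic: "w (i + N) = w i"
    and ccw: "i < j \<Longrightarrow> j < k \<Longrightarrow> k < i + N \<Longrightarrow> cross (w j - w i) (w k - w i) > 0"
begin

lemma periodic_mult: "w (i + m * N) = w i"
proof (induction m)
  case (Suc m)
  have "i + Suc m * N = (i + m * N) + N" by simp
  then show ?case using Suc periodic by metis
qed simp

lemma representative:
  obtains m' where "b \<le> m'" "m' < b + N" "w m' = w m"
proof
  \<comment> \<open>In the natural numbers \<open>(N - 1) * b\<close> plays the role of
    \<open>- b\<close> modulo \<open>N\<close>.\<close>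
  let ?m = "b + (m + (N - 1) * b) mod N"
  show "b \<le> ?m" "?m < b + N" using N by auto
  have "w ?m = w (?m + ((m + (N - 1) * b) div N) * N)" by (rule periodic_mult[symmetric])
  also have "?m + ((m + (N - 1) * b) div N) * N = b + (m + (N - 1) * b)" by simp
  also have "\<dots> = m + b * N" using N by (cases N) (auto simp: algebra_simps)
  finally show "w ?m = w m" by (simp add: periodic_mult)
qed

text \<open>The chord from \<open>p\<close> to \<open>q\<close> is parallel to \<open>u\<close> and
  separates the two arcs. The factor \<open>c\<close> carries the unknown sign of \<open>u\<close>
  relative to the chord.\<close>

lemma sides:
  assumes "norm u = 1" "p < q" "q < p + N" "level u (w p) = level u (w q)"
  obtains c where "\<And>k. p < k \<Longrightarrow> k < q \<Longrightarrow> c * (level u (w k) - level u (w p)) < 0"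
    "\<And>k. q < k \<Longrightarrow> k < p + N \<Longrightarrow> c * (level u (w k) - level u (w p)) > 0"
proof -
  have u0: "u \<noteq> 0" using assms(1) by auto
  have "cross u (w q - w p) = 0" using assms(4) by (simp add: level_eq_cross)
  then obtain c where c: "w q - w p = c *\<^sub>R u" using cross_eq_0_imp_scaleR u0 by blast
  show ?thesis
  proof
    fix k assume "p < k" "k < q"
    then have "cross (w k - w p) (w q - w p) > 0" using assms by (intro ccw) auto
    then have "c * cross (w k - w p) u > 0" by (simp only: c cross_simps)
    moreover have "cross (w k - w p) u = - (level u (w k) - level u (w p))"
      by (simp add: level_eq_cross cross_def algebra_simps)
    ultimately have "c * (- (level u (w k) - level u (w p))) > 0" by (simp only:)
    then show "c * (level u (w k) - level u (w p)) < 0" unfolding mult_minus_right by linarith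
  next
    fix k assume "q < k" "k < p + N"
    then have "cross (w q - w p) (w k - w p) > 0" using assms by (intro ccw) auto
    then have "c * cross u (w k - w p) > 0" by (simp only: c cross_simps(5))
    moreover have "cross u (w k - w p) = level u (w k) - level u (w p)" by (simp add: level_eq_cross)
    ultimately show "c * (level u (w k) - level u (w p)) > 0" by (simp only:)
  qed
qed

lemma inner_step:
  assumes u: "norm u = 1" and partner: "\<And>i. \<exists>m. w m \<noteq> w i \<and> level u (w m) = level u (w i)"
    and ij: "i < j" "j < i + N" "i + 2 \<le> j" "level u (w i) = level u (w j)"
  shows "level u (w (i + 1)) = level u (w (j - 1))"
proof (rule ccontr)
  \<comment> \<open>If the next vertices \<open>x\<close> and \<open>y\<close> have different levels, the one nearer to the chord from \<open>i\<close> to \<open>j\<close>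
    has its partner between \<open>x\<close> and \<open>y\<close>. The line through the two separates the farther one from the
    adjacent end of the chord, although both lie on the same arc.\<close>
  let ?l = "\<lambda>k. level u (w k)"
  assume ne: "?l (i + 1) \<noteq> ?l (j - 1)"
  define x y where "x = i + 1" and "y = j - 1"
  have xy: "i < x" "x < y" "y < j" using ij ne by (auto simp: x_def y_def intro: le_neq_implies_less)
  obtain c where c: "\<And>k. i < k \<Longrightarrow> k < j \<Longrightarrow> c * (?l k - ?l i) < 0"
    "\<And>k. j < k \<Longrightarrow> k < i + N \<Longrightarrow> c * (?l k - ?l i) > 0" using sides[OF u ij(1,2,4)] by blast
  have neg: "c * (?l x - ?l i) < 0" "c * (?l y - ?l i) < 0" using c(1) xy by auto
  have between: "\<exists>m. x < m \<and> m < y \<and> ?l m = ?l z" if z: "z = x \<or> z = y" for z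
  proof -
    obtain m0 where m0: "w m0 \<noteq> w z" "?l m0 = ?l z" using partner by blast
    obtain m where m: "i \<le> m" "m < i + N" "w m = w m0" by (rule representative)
    have lm: "?l m = ?l z" "m \<noteq> z" using m0 m(3) by auto
    have "c * (?l m - ?l i) < 0" using neg z lm by auto
    then have "m \<noteq> i" "m \<noteq> j" "\<not> j < m" using ij(4) c(2)[of m] m(2) by auto
    moreover have "m \<noteq> x" "m \<noteq> y" using lm z ne by (auto simp: x_def y_def)
    ultimately show ?thesis using m(1) lm by (intro exI[of _ m]) (auto simp: x_def y_def)
  qed
  have prod: False if "d * a > 0" "d * b > 0" "c * a > 0" "c * b < 0" for a b d :: real
    using that by (auto simp: zero_less_mult_iff mult_less_0_iff)
  have "c * ?l x \<noteq> c * ?l y" using ne neg by (auto simp: x_def y_def)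
  then consider "c * ?l x < c * ?l y" | "c * ?l y < c * ?l x" by linarith
  then show False
  proof cases
    case 1
    obtain m where m: "x < m" "m < y" "?l m = ?l y" using between by blast
    have mN: "y < m + N" using m xy ij by linarith
    obtain d where d: "\<And>k. y < k \<Longrightarrow> k < m + N \<Longrightarrow> d * (?l k - ?l m) > 0"
      using sides[OF u m(2) mN m(3)] m(3) by metis
    \<comment> \<open>In the window of indices from \<open>m\<close> to \<open>m + N\<close> the
      vertices \<open>i\<close> and \<open>x\<close> reappear as \<open>i + N\<close> and
      \<open>x + N\<close>, both beyond \<open>y\<close>.\<close>
    have "d * (?l (i + N) - ?l m) > 0" by (rule d; use m(1,2) xy ij in linarith)
    moreover have "d * (?l (x + N) - ?l m) > 0" by (rule d; use m(1,2) xy ij in linarith)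
    ultimately have "d * (?l i - ?l m) > 0" "d * (?l x - ?l m) > 0" by (simp_all only: periodic)
    moreover have "c * (?l i - ?l m) > 0" using neg(2) m(3) by (simp add: right_diff_distrib)
    moreover have "c * (?l x - ?l m) < 0" using 1 m(3) by (simp add: right_diff_distrib)
    ultimately show False by (rule prod)
  next
    case 2
    obtain m where m: "x < m" "m < y" "?l m = ?l x" using between by blast
    have mN: "m < x + N" using m xy ij by simp
    obtain d where d: "\<And>k. m < k \<Longrightarrow> k < x + N \<Longrightarrow> d * (?l k - ?l x) > 0"
      using sides[OF u m(1) mN m(3)[symmetric]] by metis
    have "d * (?l j - ?l x) > 0" "d * (?l y - ?l x) > 0" using m xy ij by (auto intro!: d)
    moreover have "c * (?l j - ?l x) > 0" using neg(1) ij(4) by (simp add: right_diff_distrib)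
    moreover have "c * (?l y - ?l x) < 0" using 2 by (simp add: right_diff_distrib)
    ultimately show False by (rule prod)
  qed
qed

text \<open>From the chord between \<open>p\<close> and \<open>q\<close> inwards,
  \<open>inner_step\<close> matches the next vertices on both sides until the indices meet; the
  remaining \<open>k\<close> give the same pairs read backwards.\<close>

lemma inner_reflection:
  assumes u: "norm u = 1" and partner: "\<And>i. \<exists>m. w m \<noteq> w i \<and> level u (w m) = level u (w i)"
    and pq: "p < q" "q < p + N" "level u (w p) = level u (w q)"
  shows "k \<le> q - p \<Longrightarrow> level u (w (p + k)) = level u (w (q - k))"
proof -
  have half: "level u (w (p + k)) = level u (w (q - k))" if "p + k \<le> q - k" for k
    using that
  proof (induction k)
    case 0
    then show ?case using pq by simp
  next
    case (Suc k)
    then have IH: "level u (w (p + k)) = level u (w (q - k))" by simp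
    have "level u (w (p + k + 1)) = level u (w (q - k - 1))"
      using Suc.prems pq by (intro inner_step[OF u partner _ _ _ IH]) auto
    then show ?case by simp
  qed
  assume k: "k \<le> q - p"
  show ?thesis
  proof (cases "p + k \<le> q - k")
    case False
    have "level u (w (p + (q - p - k))) = level u (w (q - (q - p - k)))"
      using False k pq by (intro half) auto
    moreover have "p + (q - p - k) = q - k" "q - (q - p - k) = p + k" using k pq by auto
    ultimately show ?thesis by simp
  qed (rule half)
qed

text \<open>\<open>r\<close> is the partner of vertex 0. The chord between them cuts the polygon
  into two arcs, and \<open>inner_reflection\<close> applies to each; on both the reflection is
  subtraction from \<open>r\<close> modulo \<open>N\<close>, with \<open>+ N\<close> added so that
  the subtraction is not truncated.\<close>

lemma reflection:
  assumes u: "norm u = 1" and partner: "\<And>i. \<exists>m. w m \<noteq> w i \<and> level u (w m) = level u (w i)"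
  obtains r where "0 < r" "r < N" "level u (w r) = level u (w 0)"
    "\<And>i. i \<le> N \<Longrightarrow> level u (w i) = level u (w (r + N - i))"
proof -
  obtain m0 where m0: "w m0 \<noteq> w 0" "level u (w m0) = level u (w 0)" using partner by blast
  obtain r where r: "0 \<le> r" "r < 0 + N" "w r = w m0" by (rule representative)
  have r0: "0 < r" using r m0 by (cases r) auto
  have lr: "level u (w 0) = level u (w r)" using m0 r by simp
  have lr': "level u (w r) = level u (w N)" using lr periodic[of 0] by simp
  have "level u (w i) = level u (w (r + N - i))" if "i \<le> N" for i
  proof (cases "i \<le> r")
    case True
    have "level u (w (0 + i)) = level u (w (r - i))"
      using r r0 lr True by (intro inner_reflection[OF u partner]) auto
    also have "w (r - i) = w (r + N - i)" using periodic[of "r - i"] True by simp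
    finally show ?thesis by simp
  next
    case False
    have "level u (w (r + (i - r))) = level u (w (N - (i - r)))"
      using r r0 lr' False that by (intro inner_reflection[OF u partner]) auto
    moreover have "r + (i - r) = i" "N - (i - r) = r + N - i" using False that r by auto
    ultimately show ?thesis by simp
  qed
  moreover have "r < N" using r by simp
  ultimately show ?thesis using that[OF r0 _ lr[symmetric]] by blast
qed

section \<open>Fourier coefficients of the polygon\<close>

definition unity_root :: complex where "unity_root = cis (2 * pi / N)"

lemma root_pow: "unity_root ^ k = cis (2 * pi * k / N)"
  unfolding unity_root_def Complex.DeMoivre by (rule arg_cong[of _ _ cis]) simp

lemma root_N: "unity_root ^ N = 1"
  using N by (simp add: root_pow)

lemma norm_root: "norm unity_root = 1" by (simp add: unity_root_def)

lemma cnj_root: "unity_root * cnj unity_root = 1"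
  using norm_root by (simp add: complex_norm_square[symmetric])

lemma cnj_root_pow: "unity_root ^ k * cnj unity_root ^ k = 1"
  by (simp add: cnj_root power_mult_distrib[symmetric])

lemma root_pow_inj: "i < N \<Longrightarrow> j < N \<Longrightarrow> unity_root ^ i = unity_root ^ j \<Longrightarrow> i = j"
  unfolding root_pow
  by (rule inj_onD[OF bij_betw_imp_inj_on[OF Complex.bij_betw_roots_unity[of N]]]) (use N in auto)

lemma sum_root_pow: "(\<Sum>k<N. unity_root ^ k) = 0"
proof -
  have "(\<Sum>k<N. unity_root ^ k) = \<Sum>{z::complex. z ^ N = 1}"
    unfolding root_pow
    by (rule sum.reindex_bij_betw[OF Complex.bij_betw_roots_unity[of N]]) (use N in simp)
  also have "\<dots> = 0" using N by (intro Complex.sum_roots_unity) simp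
  finally show ?thesis .
qed

lemma sum_reflect:
  fixes g :: "nat \<Rightarrow> complex"
  assumes "\<And>i. g (i + N) = g i" "r < N"
  shows "(\<Sum>i<N. g (r + N - i)) = (\<Sum>i<N. g i)"
proof (rule sum.reindex_bij_witness[where i = "\<lambda>i. (r + N - i) mod N" and j = "\<lambda>i. (r + N - i) mod N"])
  have inv: "(r + N - (r + N - i) mod N) mod N = i" if "i < N" for i
  proof (cases "i \<le> r")
    case True
    then have "r + N - i = (r - i) + N" by simp
    then have "(r + N - i) mod N = r - i"
      using assms(2) by (simp only: mod_add_self2) (intro mod_less, linarith)
    moreover have "r + N - (r - i) = i + N" using True by simp
    ultimately show ?thesis using that by (simp only: mod_add_self2 mod_less)
  next
    case False
    then have "(r + N - i) mod N = r + N - i" using N by (intro mod_less) auto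
    moreover have "r + N - (r + N - i) = i" using that by simp
    ultimately show ?thesis using that by (simp only: mod_less)
  qed
  show "(r + N - (r + N - i) mod N) mod N = i" if "i \<in> {..<N}" for i using inv that by simp
  show "(r + N - (r + N - i) mod N) mod N = i" if "i \<in> {..<N}" for i using inv that by simp
  show "(r + N - i) mod N \<in> {..<N}" for i using N by simp
  show "(r + N - i) mod N \<in> {..<N}" for i using N by simp
  show "g ((r + N - i) mod N) = g (r + N - i)" if "i \<in> {..<N}" for i
  proof (cases "i \<le> r")
    case True
    then have "r + N - i = (r - i) + N" by simp
    moreover have "(r - i + N) mod N = r - i" using assms(2) by (simp only: mod_add_self2) (intro mod_less, linarith)
    ultimately show ?thesis using assms(1)[of "r - i"] by (simp only:)
  next
    case False
    then have "(r + N - i) mod N = r + N - i" using N by (intro mod_less) auto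
    then show ?thesis by (simp only:)
  qed
qed

text \<open>The Fourier coefficient of the vertices at frequency 1; \<open>fB\<close> below is the
  conjugate of the one at frequency -1. A reflection of the indices exchanges the two
  frequencies.\<close>

definition fA :: complex where "fA = (\<Sum>i<N. w i * cnj unity_root ^ i)"
definition fB :: complex where "fB = (\<Sum>i<N. cnj (w i) * cnj unity_root ^ i)"

text \<open>A real multiple d of the unit vector \<open>u\<close> satisfies
  \<open>d = u ^ 2 * cnj d\<close>. This holds for each difference of a vertex and its mirror image,
  and is summed against the frequency 1.\<close>

lemma fourier_relation:
  assumes u: "norm u = 1" and r: "r < N" and refl: "\<And>i. i \<le> N \<Longrightarrow> level u (w i) = level u (w (r + N - i))"
  shows "unity_root ^ r * fA - cnj fB = u ^ 2 * (unity_root ^ r * fB - cnj fA)"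
proof -
  have cr: "cnj unity_root ^ i = cnj unity_root ^ r * unity_root ^ (r + N - i)" if "i \<le> N" for i
  proof -
    have "cnj unity_root ^ r * unity_root ^ (r + N - i) * (unity_root ^ i) = cnj unity_root ^ r * unity_root ^ (r + N)"
      using that by (simp add: power_add[symmetric] mult.assoc)
    also have "\<dots> = (unity_root ^ r * cnj unity_root ^ r) * unity_root ^ N" by (simp add: power_add)
    also have "\<dots> = 1" by (simp add: cnj_root_pow root_N)
    finally have "cnj unity_root ^ r * unity_root ^ (r + N - i) * (unity_root ^ i * cnj unity_root ^ i) = cnj unity_root ^ i"
      by (simp add: mult.assoc[symmetric])
    then show ?thesis by (simp add: cnj_root_pow)
  qed
  have R: "(\<Sum>i<N. f (w (r + N - i)) * cnj unity_root ^ i) = cnj unity_root ^ r * (\<Sum>i<N. f (w i) * unity_root ^ i)" for f :: "complex \<Rightarrow> complex"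
  proof -
    have "(\<Sum>i<N. f (w (r + N - i)) * cnj unity_root ^ i) = (\<Sum>i<N. cnj unity_root ^ r * (f (w (r + N - i)) * unity_root ^ (r + N - i)))"
      by (rule sum.cong) (auto simp: cr[of i for i] mult_ac)
    also have "\<dots> = cnj unity_root ^ r * (\<Sum>i<N. f (w (r + N - i)) * unity_root ^ (r + N - i))" by (simp add: sum_distrib_left)
    also have "(\<Sum>i<N. f (w (r + N - i)) * unity_root ^ (r + N - i)) = (\<Sum>i<N. f (w i) * unity_root ^ i)"
      by (rule sum_reflect[where g = "\<lambda>i. f (w i) * unity_root ^ i"]) (auto simp: periodic power_add root_N r)
    finally show ?thesis .
  qed
  have uu: "cnj u * u = 1" using cnj_mult_self_unit[OF u] .
  have pt: "w i - w (r + N - i) = u ^ 2 * (cnj (w i) - cnj (w (r + N - i)))" if "i \<le> N" for i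
  proof -
    define t where "t = Re (cnj u * (w i - w (r + N - i)))"
    have "w i = w (r + N - i) + t *\<^sub>R u" unfolding t_def using eq_on_line_if_level_eq[OF u refl[OF that]] .
    then have d: "w i - w (r + N - i) = t *\<^sub>R u" by (metis add_diff_cancel_left')
    then have "cnj (w i) - cnj (w (r + N - i)) = t *\<^sub>R cnj u" by (metis complex_cnj_diff complex_cnj_scaleR)
    moreover have "u ^ 2 * cnj u = u * (cnj u * u)" by (simp add: power2_eq_square mult_ac)
    then have "u ^ 2 * cnj u = u" by (simp only: uu mult_1_right)
    ultimately show ?thesis unfolding d by simp
  qed
  have "(\<Sum>i<N. (w i - w (r + N - i)) * cnj unity_root ^ i) = (\<Sum>i<N. u ^ 2 * (cnj (w i) - cnj (w (r + N - i))) * cnj unity_root ^ i)"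
    by (rule sum.cong) (auto simp: pt)
  also have "\<dots> = u ^ 2 * (\<Sum>i<N. cnj (w i) * cnj unity_root ^ i - cnj (w (r + N - i)) * cnj unity_root ^ i)"
    by (simp add: sum_distrib_left left_diff_distrib mult.assoc)
  finally have "fA - (\<Sum>i<N. (\<lambda>z. z) (w (r + N - i)) * cnj unity_root ^ i) = u ^ 2 * (fB - (\<Sum>i<N. cnj (w (r + N - i)) * cnj unity_root ^ i))"
    by (simp add: fA_def fB_def left_diff_distrib sum_subtractf)
  then have "fA - cnj unity_root ^ r * cnj fB = u ^ 2 * (fB - cnj unity_root ^ r * cnj fA)"
    using R[of "\<lambda>z. z"] R[of cnj] by (simp add: fA_def fB_def)
  then have "unity_root ^ r * (fA - cnj unity_root ^ r * cnj fB) = unity_root ^ r * (u ^ 2 * (fB - cnj unity_root ^ r * cnj fA))" by simp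
  then have "unity_root ^ r * fA - (unity_root ^ r * cnj unity_root ^ r) * cnj fB = u ^ 2 * (unity_root ^ r * fB - (unity_root ^ r * cnj unity_root ^ r) * cnj fA)"
    by (simp add: algebra_simps)
  then show ?thesis by (simp add: cnj_root_pow)
qed

text \<open>The sine is a combination of the two frequencies, so if both coefficients vanished, the
  sine-weighted sum of the vertices would be zero, against convexity.\<close>

lemma fourier_nonzero: "fA \<noteq> 0 \<or> fB \<noteq> 0"
proof (rule ccontr)
  assume "\<not> ?thesis"
  then have z: "fA = 0" "fB = 0" by auto
  define T where "T i = Im (unity_root ^ i)" for i
  have Tc: "complex_of_real (T i) = (unity_root ^ i - cnj unity_root ^ i) / (2 * \<i>)" for i
  proof -
    have e: "unity_root ^ i - cnj unity_root ^ i = complex_of_real (T i) * (2 * \<i>)"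
      using complex_diff_cnj[of "unity_root ^ i"] by (simp add: T_def)
    show ?thesis unfolding e by (rule nonzero_mult_div_cancel_right[symmetric]) simp
  qed
  have cfB: "(\<Sum>i<N. w i * unity_root ^ i) = cnj fB" by (simp add: fB_def)
  have "(\<Sum>i<N. T i *\<^sub>R w i) = (\<Sum>i<N. (w i * unity_root ^ i - w i * cnj unity_root ^ i) / (2 * \<i>))"
    by (rule sum.cong) (auto simp: scaleR_conv_of_real Tc algebra_simps)
  also have "\<dots> = ((\<Sum>i<N. w i * unity_root ^ i) - (\<Sum>i<N. w i * cnj unity_root ^ i)) / (2 * \<i>)"
    by (simp only: sum_subtractf[symmetric] sum_divide_distrib)
  also have "\<dots> = 0" using z cfB by (simp add: fA_def)
  finally have s1: "(\<Sum>i<N. T i *\<^sub>R w i) = 0" .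
  have s2: "(\<Sum>i<N. T i) = 0" unfolding T_def using sum_root_pow by (metis Im_sum zero_complex.sel(2))
  \<comment> \<open>The two middle indices, equal for even \<open>N\<close>: together they serve as
    the vertex opposite to \<open>w 0\<close> in either parity.\<close>
  define a b where "a = N div 2" and "b = (N + 1) div 2"
  \<comment> \<open>The line through \<open>w 0\<close> in direction \<open>q\<close> separates the vertices with \<open>T i > 0\<close> from those with \<open>T i < 0\<close>.\<close>
  define q where "q = (w a - w 0) + (w b - w 0)"
  have lin: "(\<Sum>i<N. T i * cross (w i - w 0) q) = cross (\<Sum>i<N. T i *\<^sub>R (w i - w 0)) q"
  proof -
    have "linear (\<lambda>z. cross z q)" by (rule linearI) auto
    then show ?thesis
      using linear_sum[of "\<lambda>z. cross z q" "\<lambda>i. T i *\<^sub>R (w i - w 0)" "{..<N}"] by (simp only: cross_simps(5))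
  qed
  have "(\<Sum>i<N. T i *\<^sub>R (w i - w 0)) = (\<Sum>i<N. T i *\<^sub>R w i) - (\<Sum>i<N. T i) *\<^sub>R w 0"
    by (simp add: scaleR_diff_right sum_subtractf scaleR_sum_left)
  then have zero: "(\<Sum>i<N. T i * cross (w i - w 0) q) = 0" unfolding lin using s1 s2 by simp
  have ab: "0 < a" "a \<le> b" "b < N" "N \<le> 2 * b" "2 * a \<le> N" "b \<le> a + 1" using N by (auto simp: a_def b_def)
  have Tsin: "T i = sin (2 * pi * i / N)" for i by (simp add: T_def root_pow)
  have Tpos: "T i > 0" if "0 < i" "2 * i < N" for i
  proof -
    have "real (2 * i) < real N" using that(2) by (simp only: of_nat_less_iff)
    then have "2 * pi * i / N < pi" using that N by (simp add: divide_less_eq)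
    then show ?thesis unfolding Tsin using that N by (intro sin_gt_zero) auto
  qed
  have Tneg: "T i < 0" if "i < N" "2 * i > N" for i
  proof -
    have "real (2 * i) > real N" using that(2) by (simp only: of_nat_less_iff)
    then have "2 * pi * i / N > pi" using that N by (simp add: less_divide_eq)
    moreover have "2 * pi * i / N < 2 * pi" using that N by (simp add: divide_less_eq)
    ultimately have "sin (2 * pi * i / N) < 0" by (intro sin_lt_zero) auto
    then show ?thesis by (simp add: Tsin)
  qed
  have T0: "T i = 0" if "2 * i = N" for i
  proof -
    have "real N = 2 * real i" using that by auto
    then have "2 * pi * i / N = pi" using N by simp
    then show ?thesis by (simp add: Tsin)
  qed
  have cw: "cross (w i - w 0) (w c - w 0) > 0" if "0 < i" "i < c" "c < N" for i c
    using ccw[of 0 i c] that by simp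
  have cw': "cross (w i - w 0) (w c - w 0) < 0" if "0 < c" "c < i" "i < N" for i c
    using cw[OF that] by (subst cross_commute) simp
  have ge0: "cross (w i - w 0) (w c - w 0) \<ge> 0" if "i \<le> c" "c < N" for i c
    using cw[of i c] that by (cases "i = 0"; cases "i = c") auto
  have le0: "cross (w i - w 0) (w c - w 0) \<le> 0" if "c \<le> i" "i < N" for i c
    using cw'[of c i] that by (cases "c = 0"; cases "i = c") auto
  have nonneg: "T i * cross (w i - w 0) q \<ge> 0" if "i < N" for i
  proof -
    consider "i = 0" | "0 < i" "2 * i < N" | "2 * i = N" | "2 * i > N" by linarith
    then show ?thesis
    proof cases
      case 2
      have "i \<le> a" "i \<le> b" "a < N" using 2 ab by (auto simp: a_def)
      then have "cross (w i - w 0) q \<ge> 0" unfolding q_def cross_simps(1) using ge0[of i a] ge0[of i b] ab by simp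
      then show ?thesis using Tpos[OF 2] by simp
    next
      case 4
      have "a \<le> i" "b \<le> i" using 4 ab by (auto simp: b_def)
      then have "cross (w i - w 0) q \<le> 0" unfolding q_def cross_simps(1) using le0[of a i] le0[of b i] that by simp
      then show ?thesis using Tneg[OF that 4] by (simp add: mult_nonpos_nonpos)
    qed (use T0 in auto)
  qed
  \<comment> \<open>For \<open>N = 3\<close> index 1 is \<open>a\<close> itself, so strictness has
    to come from \<open>b\<close>.\<close>
  have one: "T 1 * cross (w 1 - w 0) q > 0"
  proof -
    have "T 1 > 0" using N by (intro Tpos) auto
    moreover have "1 \<le> a" "1 < b" "a < N" using N by (auto simp: a_def b_def)
    then have "cross (w 1 - w 0) q > 0" unfolding q_def cross_simps(1) using ge0[of 1 a] cw[of 1 b] ab by simp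
    ultimately show ?thesis by simp
  qed
  have "(\<Sum>i<N. T i * cross (w i - w 0) q) > 0"
    by (rule sum_pos2[of _ 1]) (use one nonneg N in auto)
  then show False using zero by simp
qed

end

section \<open>From equal X-rays to roots of unity\<close>

lemma parallel_if_cross_0:
  assumes "norm u = 1" "norm v = 1" "cross u v = 0"
  shows "parallel u v"
proof -
  have "u \<noteq> 0" "v \<noteq> 0" using assms by auto
  obtain t where "v = t *\<^sub>R u" using cross_eq_0_imp_scaleR[OF assms(3) \<open>u \<noteq> 0\<close>] .
  then show ?thesis using \<open>v \<noteq> 0\<close> unfolding parallel_def by (intro exI[of _ t]) auto
qed

lemma unit_square_eq_imp_parallel:
  assumes "norm u = 1" "u ^ 2 = v ^ 2"
  shows "parallel u v"
proof -
  have "(v - u) * (v + u) = 0" using assms(2) by (simp add: power2_eq_square algebra_simps)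
  then have "v = u \<or> v = - u" by (auto simp: add_eq_0_iff2)
  then show ?thesis unfolding parallel_def by (auto intro: exI[of _ 1] exI[of _ "-1"])
qed

text \<open>The root \<open>\<omega> u\<close> records the index of the partner of vertex 0 in
  direction \<open>u\<close>. Two nonparallel lines through vertex 0 meet nowhere else, hence the
  injectivity.\<close>

lemma not_determined_imp_roots_of_unity:
  assumes "\<not> determined_by_xrays U" and U: "\<And>u. u \<in> U \<Longrightarrow> norm u = 1"
    and par: "pairwise (\<lambda>u v. \<not> parallel u v) U" and card: "card U \<ge> 3"
  obtains N :: nat and \<omega> :: "complex \<Rightarrow> complex" and A B :: complex
    where "N > 0" "inj_on \<omega> U" "\<And>u. u \<in> U \<Longrightarrow> \<omega> u ^ N = 1" "A * cnj A \<noteq> B * cnj B"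
      "\<And>u. u \<in> U \<Longrightarrow> \<omega> u * A - cnj B = u ^ 2 * (\<omega> u * B - cnj A)"
proof -
  obtain K L where KL: "convex_body K" "convex_body L" "K \<noteq> L" "\<And>u. u \<in> U \<Longrightarrow> xray u K = xray u L"
    using assms(1) unfolding determined_by_xrays_def by blast
  obtain V where V: "finite V" "V \<noteq> {}" "\<And>v. v \<in> V \<Longrightarrow> v \<notin> convex hull (V - {v})"
    "\<And>u v. u \<in> U \<Longrightarrow> v \<in> V \<Longrightarrow> \<exists>v'\<in>V. v' \<noteq> v \<and> level u v' = level u v"
    using exists_convex_polygon[OF KL(1,2,3) U KL(4)] by metis
  have npar: "cross u u' \<noteq> 0" if "u \<in> U" "u' \<in> U" "u \<noteq> u'" for u u'
    using parallel_if_cross_0[OF U[OF that(1)] U[OF that(2)]] par that by (auto simp: pairwise_def)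
  have crossing: "z = z'" if h: "u \<in> U" "u' \<in> U" "u \<noteq> u'" "level u z = level u z'" "level u' z = level u' z'" for u u' z z'
  proof (rule ccontr)
    assume ne: "z \<noteq> z'"
    have "z = z' + Re (cnj u * (z - z')) *\<^sub>R u" using eq_on_line_if_level_eq[OF U[OF h(1)] h(4)] .
    then obtain t where t: "z = z' + t *\<^sub>R u" by blast
    have "t \<noteq> 0" using t ne by auto
    moreover have "t * level u' u = 0" using h(5) unfolding t by simp
    ultimately have "cross u' u = 0" by (simp add: level_eq_cross)
    then show False using npar[OF h(2,1)] h(3) by simp
  qed
  obtain T where T: "T \<subseteq> U" "card T = 3" using card obtain_subset_with_card_n by metis
  then obtain u1 u2 u3 where u3: "u1 \<in> U" "u2 \<in> U" "u3 \<in> U" "u1 \<noteq> u2" "u1 \<noteq> u3" "u2 \<noteq> u3"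
    by (auto simp: card_3_iff)
  define N where "N = card V"
  have N3: "N \<ge> 3"
  proof -
    obtain v where v: "v \<in> V" using V(2) by blast
    obtain v1 where v1: "v1 \<in> V" "v1 \<noteq> v" "level u1 v1 = level u1 v" using V(4)[OF u3(1) v] by blast
    obtain v2 where v2: "v2 \<in> V" "v2 \<noteq> v" "level u2 v2 = level u2 v" using V(4)[OF u3(2) v] by blast
    have "v1 \<noteq> v2" using crossing[OF u3(1,2,4), of v1 v] v1 v2 by auto
    then have "card {v, v1, v2} = 3" using v1 v2 by auto
    moreover have "{v, v1, v2} \<subseteq> V" using v v1 v2 by auto
    ultimately show ?thesis unfolding N_def using card_mono[OF V(1)] by metis
  qed
  obtain v :: "nat \<Rightarrow> complex" where v: "bij_betw v {..<N} V"
    "\<And>i j k. i < j \<Longrightarrow> j < k \<Longrightarrow> k < N \<Longrightarrow> cross (v j - v i) (v k - v i) > 0"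
    using convex_polygon_enumeration[OF V(1,2,3)] unfolding N_def by metis
  define w where "w i = v (i mod N)" for i
  interpret ccw_polygon N w
  proof
    show "N \<ge> 3" by (rule N3)
    show "w (i + N) = w i" for i by (simp add: w_def)
    show "cross (w j - w i) (w k - w i) > 0" if "i < j" "j < k" "k < i + N" for i j k
      unfolding w_def by (rule cyclic_polygon[OF _ v(2) that]) (use N3 in auto)
  qed
  have wV: "w i \<in> V" for i
    using bij_betwE[OF v(1)] N3 by (auto simp: w_def)
  have Vw: "\<exists>i. w i = x" if "x \<in> V" for x
  proof -
    have "x \<in> v ` {..<N}" using v(1) that by (simp add: bij_betw_def)
    then obtain i where "i < N" "v i = x" by auto
    then show ?thesis by (intro exI[of _ i]) (simp add: w_def)
  qed
  have partner: "\<exists>m. w m \<noteq> w i \<and> level u (w m) = level u (w i)" if "u \<in> U" for u i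
    using V(4)[OF that wV[of i]] Vw by metis
  have "\<forall>u\<in>U. \<exists>r. 0 < r \<and> r < N \<and> level u (w r) = level u (w 0) \<and> (\<forall>i\<le>N. level u (w i) = level u (w (r + N - i)))"
    using reflection[OF U partner] by metis
  then obtain r where r: "\<And>u. u \<in> U \<Longrightarrow> 0 < r u" "\<And>u. u \<in> U \<Longrightarrow> r u < N" "\<And>u. u \<in> U \<Longrightarrow> level u (w (r u)) = level u (w 0)"
    "\<And>u i. u \<in> U \<Longrightarrow> i \<le> N \<Longrightarrow> level u (w i) = level u (w (r u + N - i))" by metis
  define \<omega> where "\<omega> u = unity_root ^ r u" for u
  have rel: "\<omega> u * fA - cnj fB = u ^ 2 * (\<omega> u * fB - cnj fA)" if "u \<in> U" for u
    unfolding \<omega>_def by (rule fourier_relation[OF U[OF that] r(2)[OF that] r(4)[OF that]])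
  have inj: "inj_on \<omega> U"
  proof (rule inj_onI, rule ccontr)
    fix u u' assume h: "u \<in> U" "u' \<in> U" "\<omega> u = \<omega> u'" "u \<noteq> u'"
    have "r u = r u'" using root_pow_inj[OF r(2)[OF h(1)] r(2)[OF h(2)]] h(3) by (simp add: \<omega>_def)
    then have "w (r u) = w 0" using crossing[OF h(1,2,4), of "w (r u)" "w 0"] r(3)[OF h(1)] r(3)[OF h(2)] by simp
    then have "v (r u) = v 0" using r(2)[OF h(1)] N3 by (simp add: w_def)
    then have "r u = 0" using bij_betw_imp_inj_on[OF v(1)] r(2)[OF h(1)] N3 by (auto dest: inj_onD)
    then show False using r(1)[OF h(1)] by simp
  qed
  have sq: "u ^ 2 \<noteq> u' ^ 2" if "u \<in> U" "u' \<in> U" "u \<noteq> u'" for u u'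
    using unit_square_eq_imp_parallel[OF U[OF that(1)]] par that by (auto simp: pairwise_def)
  \<comment> \<open>With equal moduli the relation factors, so every direction has one fixed value
    either as its square or as its root. Squares and roots are pairwise distinct, so at most two
    directions could satisfy this.\<close>
  have nondeg: "fA * cnj fA \<noteq> fB * cnj fB"
  proof
    assume e: "fA * cnj fA = fB * cnj fB"
    then have AB: "fA \<noteq> 0" "fB \<noteq> 0" using fourier_nonzero by auto
    define \<kappa> where "\<kappa> = fA / fB"
    have k: "fA = \<kappa> * fB" "cnj fB = \<kappa> * cnj fA" using AB e by (auto simp: \<kappa>_def field_simps)
    have alt: "u ^ 2 = \<kappa> \<or> \<omega> u = cnj fA / fB" if "u \<in> U" for u
    proof -
      have "\<omega> u * fA - cnj fB = \<kappa> * (\<omega> u * fB - cnj fA)" by (subst k(1), subst k(2)) (simp add: algebra_simps)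
      then have "(u ^ 2 - \<kappa>) * (\<omega> u * fB - cnj fA) = 0" using rel[OF that] by (simp add: left_diff_distrib)
      then have "u ^ 2 = \<kappa> \<or> \<omega> u * fB = cnj fA" by simp
      then show ?thesis using AB by (auto simp: eq_divide_eq)
    qed
    have \<omega>ne: "\<omega> u \<noteq> \<omega> u'" if "u \<in> U" "u' \<in> U" "u \<noteq> u'" for u u' using inj that by (auto dest: inj_onD)
    show False using alt[OF u3(1)] alt[OF u3(2)] alt[OF u3(3)] sq[OF u3(1,2,4)] sq[OF u3(1,3,5)] sq[OF u3(2,3,6)]
      \<omega>ne[OF u3(1,2,4)] \<omega>ne[OF u3(1,3,5)] \<omega>ne[OF u3(2,3,6)] by metis
  qed
  show ?thesis
  proof (rule that[OF _ inj _ nondeg rel])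
    show "N > 0" using N3 by simp
    show "\<omega> u ^ N = 1" for u
      unfolding \<omega>_def power_mult[symmetric] by (subst mult.commute) (simp add: power_mult root_N)
  qed
qed

subsection \<open>Cross ratios and integer polynomials\<close>

definition cross_ratio :: "complex \<Rightarrow> complex \<Rightarrow> complex \<Rightarrow> complex \<Rightarrow> complex" where
  "cross_ratio a b c d = ((a - c) * (b - d)) / ((a - d) * (b - c))"

text \<open>Each difference of two values \<open>y\<close> is that of the \<open>x\<close> times the
  determinant over two denominators, and these factors cancel. The relation is stated without
  division; the determinant keeps the denominators from vanishing.\<close>

lemma cross_ratio_moebius:
  fixes A B C D :: complex
  assumes det: "A * D \<noteq> B * C"
    and rel: "\<And>i. i \<in> {1,2,3,4::nat} \<Longrightarrow> A * x i + B = y i * (C * x i + D)"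
  shows "cross_ratio (y 1) (y 2) (y 3) (y 4) = cross_ratio (x 1) (x 2) (x 3) (x 4)"
proof -
  have den: "C * x i + D \<noteq> 0" if "i \<in> {1,2,3,4}" for i
  proof
    assume e: "C * x i + D = 0"
    then have e': "A * x i + B = 0" using rel[OF that] by simp
    have "A * D - B * C = A * (C * x i + D) - C * (A * x i + B)" by (simp add: algebra_simps)
    then show False using e e' det by simp
  qed
  define E where "E = A * D - B * C"
  have E: "E \<noteq> 0" using det by (simp add: E_def)
  have diff: "y i - y j = E * (x i - x j) / ((C * x i + D) * (C * x j + D))"
    if i: "i \<in> {1,2,3,4}" and j: "j \<in> {1,2,3,4}" for i j
  proof -
    have "y i = (A * x i + B) / (C * x i + D)" "y j = (A * x j + B) / (C * x j + D)"
      using rel[OF i] rel[OF j] den[OF i] den[OF j] by (simp_all add: field_simps)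
    then show ?thesis using den[OF i] den[OF j] by (simp add: diff_frac_eq E_def algebra_simps)
  qed
  define p where "p i = C * x i + D" for i
  have p: "p i \<noteq> 0" if "i \<in> {1,2,3,4}" for i using den[OF that] by (simp add: p_def)
  have "cross_ratio (y 1) (y 2) (y 3) (y 4) =
    ((E * (x 1 - x 3) / (p 1 * p 3)) * (E * (x 2 - x 4) / (p 2 * p 4))) / ((E * (x 1 - x 4) / (p 1 * p 4)) * (E * (x 2 - x 3) / (p 2 * p 3)))"
    unfolding cross_ratio_def p_def by (simp only: diff[of 1 3] diff[of 2 4] diff[of 1 4] diff[of 2 3] insert_iff simp_thms)
  also have "\<dots> = cross_ratio (x 1) (x 2) (x 3) (x 4)"
    using p[of 1] p[of 2] p[of 3] p[of 4] E unfolding cross_ratio_def by simp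
  finally show ?thesis .
qed

text \<open>Elements of the ring generated by a root of unity are written as \<open>ev p z\<close>,
  so that conjugation becomes a change of \<open>z\<close> for a fixed \<open>p\<close>.\<close>

definition ev :: "int poly \<Rightarrow> complex \<Rightarrow> complex" where
  "ev p z = poly (map_poly of_int p) z"

lemma ev_0 [simp]: "ev 0 z = 0"
  by (simp add: ev_def)

lemma ev_pCons [simp]: "ev (pCons a p) z = of_int a + z * ev p z"
  by (simp add: ev_def map_poly_pCons)

lemma ev_add [simp]: "ev (p + q) z = ev p z + ev q z"
  by (induction p q rule: poly_induct2) (auto simp: algebra_simps)

lemma ev_smult [simp]: "ev (Polynomial.smult c p) z = of_int c * ev p z"
  by (induction p) (auto simp: algebra_simps)

lemma ev_uminus [simp]: "ev (- p) z = - ev p z"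
  by (induction p) (auto simp: algebra_simps)

lemma ev_diff [simp]: "ev (p - q) z = ev p z - ev q z"
  using ev_add[of p "- q" z] by simp

lemma ev_mult [simp]: "ev (p * q) z = ev p z * ev q z"
  by (induction p) (auto simp: algebra_simps)

lemma ev_1 [simp]: "ev 1 z = 1"
  by (simp add: one_pCons)

lemma ev_power [simp]: "ev (p ^ n) z = ev p z ^ n"
  by (induction n) auto

lemma ev_of_nat [simp]: "ev (of_nat n) z = of_nat n"
  by (induction n) auto

lemma ev_monom [simp]: "ev (Polynomial.monom c n) z = of_int c * z ^ n"
  by (induction n) (auto simp: monom_Suc monom_0)

lemma ev_power_arg: "\<exists>q. \<forall>z. ev p (z ^ k) = ev q z"
proof (induction p)
  case 0
  then show ?case by (intro exI[of _ 0]) simp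
next
  case (pCons a p)
  then obtain q where q: "\<And>z. ev p (z ^ k) = ev q z" by blast
  then show ?case by (intro exI[of _ "[:a:] + Polynomial.monom 1 k * q"]) simp
qed

subsection \<open>An integrality functional\<close>

interpretation rat_vs: vector_space "\<lambda>(q::rat) (z::complex). of_rat q * z"
  by unfold_locales (auto simp: algebra_simps of_rat_add of_rat_mult)

interpretation rat_vs_pair: vector_space_pair "\<lambda>(q::rat) (z::complex). of_rat q * z" "(*) :: rat \<Rightarrow> rat \<Rightarrow> rat"
  by unfold_locales (auto simp: algebra_simps)

text \<open>A rational linear functional with \<open>1 \<mapsto> 1\<close> takes the place of a theory of algebraic integers: its
  values on \<open>\<int>[z]\<close> have a common denominator when \<open>z\<close> is a root of unity.\<close>

definition rat_functional :: "complex \<Rightarrow> rat" where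
  "rat_functional = (SOME f. Vector_Spaces.linear (\<lambda>(q::rat) (z::complex). of_rat q * z) (*) f \<and> f 1 = 1)"

lemma rat_functional: "Vector_Spaces.linear (\<lambda>(q::rat) (z::complex). of_rat q * z) (*) rat_functional"
  and rat_functional_1 [simp]: "rat_functional 1 = 1"
proof -
  have "rat_vs.independent {1}" by simp
  then have "\<exists>f. Vector_Spaces.linear (\<lambda>(q::rat) (z::complex). of_rat q * z) (*) f \<and> (\<forall>x\<in>{1}. f x = (1::rat))"
    using rat_vs_pair.linear_independent_extend[of "{1}" "\<lambda>_. 1"] by simp
  then have "\<exists>f. Vector_Spaces.linear (\<lambda>(q::rat) (z::complex). of_rat q * z) (*) f \<and> f 1 = (1::rat)" by auto
  from someI_ex[OF this] show "Vector_Spaces.linear (\<lambda>(q::rat) (z::complex). of_rat q * z) (*) rat_functional"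
    "rat_functional 1 = 1" unfolding rat_functional_def by auto
qed

lemma rat_functional_add [simp]: "rat_functional (x + y) = rat_functional x + rat_functional y"
  using rat_functional by (simp add: Vector_Spaces.linear_iff)

lemma rat_functional_scale: "rat_functional (of_rat q * x) = q * rat_functional x"
  using rat_functional by (simp add: Vector_Spaces.linear_iff)

lemma rat_functional_int [simp]: "rat_functional (of_int k * x) = of_int k * rat_functional x"
  using rat_functional_scale[of "of_int k"] by simp

lemma rat_functional_of_nat [simp]: "rat_functional (of_nat k * x) = of_nat k * rat_functional x"
  using rat_functional_int[of "int k"] by simp

lemma rat_functional_0 [simp]: "rat_functional 0 = 0"
  using rat_functional_int[of 0 0] by simp

lemma rat_functional_diff [simp]: "rat_functional (x - y) = rat_functional x - rat_functional y"
  using rat_functional_add[of "x - y" y] by simp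

lemma root_power_mod:
  fixes z :: "'a::monoid_mult" assumes "z ^ N = 1" shows "z ^ k = z ^ (k mod N)"
proof -
  have "z ^ k = z ^ (N * (k div N) + k mod N)" by simp
  also have "\<dots> = (z ^ N) ^ (k div N) * z ^ (k mod N)" by (simp only: power_add power_mult)
  finally show ?thesis using assms by simp
qed

lemma common_denominator:
  fixes z :: complex
  assumes z: "z ^ N = 1" "N > 0"
  shows "\<exists>m::int. m > 0 \<and> (\<forall>p. of_int m * rat_functional (ev p z) \<in> \<int>)"
proof -
  have den: "\<exists>m>0. of_int m * q \<in> \<int>" for q :: rat
  proof -
    obtain a b where ab: "quotient_of q = (a, b)" by (cases "quotient_of q") auto
    have "b > 0" "q = of_int a / of_int b" using quotient_of_denom_pos[OF ab] quotient_of_div[OF ab] by auto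
    then show ?thesis by (intro exI[of _ b]) auto
  qed
  then obtain d :: "rat \<Rightarrow> int" where d: "\<And>q. d q > 0" "\<And>q. of_int (d q) * q \<in> \<int>" by metis
  define m where "m = (\<Prod>j<N. d (rat_functional (z ^ j)))"
  have m: "m > 0" unfolding m_def by (intro prod_pos) (auto simp: d)
  have 1: "of_int m * rat_functional (z ^ j) \<in> \<int>" if "j < N" for j
  proof -
    have "m = d (rat_functional (z ^ j)) * (\<Prod>j\<in>{..<N}-{j}. d (rat_functional (z ^ j)))"
      unfolding m_def using that by (intro prod.remove) auto
    then have "of_int m * rat_functional (z ^ j) = of_int (\<Prod>j\<in>{..<N}-{j}. d (rat_functional (z ^ j))) *
        (of_int (d (rat_functional (z ^ j))) * rat_functional (z ^ j))" by simp
    also have "\<dots> \<in> \<int>" by (intro Ints_mult d Ints_of_int)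
    finally show ?thesis .
  qed
  have 2: "of_int m * rat_functional (z ^ j) \<in> \<int>" for j
    using 1[of "j mod N"] root_power_mod[OF z(1), of j] z(2) by simp
  have 3: "of_int m * rat_functional (z ^ i * ev p z) \<in> \<int>" for p i
  proof (induction p arbitrary: i)
    case (pCons a p)
    have "z ^ i * ev (pCons a p) z = of_int a * z ^ i + z ^ Suc i * ev p z" by (simp add: algebra_simps)
    then have "of_int m * rat_functional (z ^ i * ev (pCons a p) z)
       = of_int a * (of_int m * rat_functional (z ^ i)) + of_int m * rat_functional (z ^ Suc i * ev p z)"
      by (simp only: rat_functional_add rat_functional_int) (simp only: algebra_simps)
    also have "\<dots> \<in> \<int>" by (intro Ints_add Ints_mult[OF Ints_of_int] 2 pCons.IH)
    finally show ?case .
  qed simp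
  show ?thesis using m 3[of 0] by auto
qed

text \<open>If 1 / l lay in the ring generated by \<open>z\<close>, so would its powers. The
  functional is the identity on rationals, so \<open>l ^ k\<close> would divide the common
  denominator \<open>m\<close> for every \<open>k\<close>, and \<open>k = m\<close> is already too
  large.\<close>

lemma ev_ne_inverse_nat:
  fixes z :: complex
  assumes z: "z ^ N = 1" "N > 0" and l: "l \<ge> 2"
  shows "of_nat l * ev p z \<noteq> 1"
proof
  assume e: "of_nat l * ev p z = 1"
  obtain m :: int where m: "m > 0" "\<And>p. of_int m * rat_functional (ev p z) \<in> \<int>"
    using common_denominator[OF z] by blast
  define k where "k = nat m"
  have "(of_nat l * ev p z) ^ k = 1" by (simp add: e)
  then have "of_nat (l ^ k) * ev (p ^ k) z = 1" by (simp add: power_mult_distrib)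
  then have "rat_functional (of_nat (l ^ k) * ev (p ^ k) z) = 1" by simp
  then have "of_nat (l ^ k) * rat_functional (ev (p ^ k) z) = 1" by (simp only: rat_functional_of_nat)
  moreover obtain c where c: "of_int m * rat_functional (ev (p ^ k) z) = of_int c" using m(2) Ints_cases by metis
  ultimately have "(of_int m :: rat) = of_nat (l ^ k) * of_int c" by (metis mult.assoc mult.commute mult.right_neutral)
  then have "(of_int m :: rat) = of_int (int (l ^ k) * c)" by simp
  then have mc: "m = int (l ^ k) * c" by (simp only: of_int_eq_iff)
  then have "c > 0" using m(1) by (simp add: zero_less_mult_iff)
  then have "m \<ge> int (l ^ k)" using mc by (simp add: mult_le_cancel_left1)
  moreover have "k < l ^ k" using l by (metis less_exp less_le_trans power_mono zero_le)
  then have "int k < int (l ^ k)" by (simp only: of_nat_less_iff)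
  moreover have "int k = m" using m(1) by (simp add: k_def)
  ultimately show False by linarith
qed

subsection \<open>Conjugates of roots of unity\<close>

lemma frobenius_dvd:
  fixes s t :: "'a::comm_ring_1"
  assumes "Factorial_Ring.prime l"
  shows "of_nat l dvd (s + t) ^ l - (s ^ l + t ^ l)"
proof -
  have l: "l \<ge> 2" using assms prime_ge_2_nat by blast
  have "(s + t) ^ l = (\<Sum>k\<le>l. of_nat (l choose k) * s ^ k * t ^ (l - k))" by (rule binomial_ring)
  also have "{..l} = insert 0 (insert l {1..<l})" using l by auto
  also have "(\<Sum>k\<in>insert 0 (insert l {1..<l}). of_nat (l choose k) * s ^ k * t ^ (l - k))
      = t ^ l + s ^ l + (\<Sum>k\<in>{1..<l}. of_nat (l choose k) * s ^ k * t ^ (l - k))" using l by simp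
  finally have "(s + t) ^ l - (s ^ l + t ^ l) = (\<Sum>k\<in>{1..<l}. of_nat (l choose k) * s ^ k * t ^ (l - k))" by simp
  also have "of_nat l dvd \<dots>"
  proof (rule dvd_sum)
    fix k assume k: "k \<in> {1..<l}"
    have "l dvd (l choose k)" using k assms by (intro dvd_choose_prime) auto
    then obtain c where "l choose k = l * c" by blast
    then have "of_nat (l choose k) * s ^ k * t ^ (l - k) = of_nat l * (of_nat c * s ^ k * t ^ (l - k))"
      by (simp add: mult.assoc)
    then show "of_nat l dvd of_nat (l choose k) * s ^ k * t ^ (l - k)" by simp
  qed
  finally show ?thesis .
qed

lemma int_fermat:
  fixes a :: int assumes "Factorial_Ring.prime l" shows "int l dvd a ^ l - a"
proof -
  have l: "l \<ge> 2" using assms prime_ge_2_nat by blast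
  have nn: "int l dvd int n ^ l - int n" for n
  proof (induction n)
    case 0
    then show ?case using l by (simp add: zero_power)
  next
    case (Suc n)
    have "int l dvd (int n + 1) ^ l - (int n ^ l + 1 ^ l)" using frobenius_dvd[OF assms, of "int n" 1] by simp
    from dvd_add[OF this Suc.IH] show ?case by (simp add: algebra_simps)
  qed
  have neg: "int l dvd (a + - a) ^ l - (a ^ l + (- a) ^ l)" using frobenius_dvd[OF assms, of a "- a"] by simp
  show ?thesis
  proof (cases "a \<ge> 0")
    case True
    then show ?thesis using nn[of "nat a"] by simp
  next
    case False
    then have "int l dvd (- a) ^ l - (- a)" using nn[of "nat (- a)"] by simp
    then have "int l dvd (- a) ^ l + a" by simp
    moreover have "int l dvd - (a ^ l + (- a) ^ l)" using neg l by (simp add: zero_power)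
    ultimately have "int l dvd ((- a) ^ l + a) + - (a ^ l + (- a) ^ l)" by (rule dvd_add)
    then have "int l dvd - (a ^ l - a)" by (simp add: algebra_simps)
    then show ?thesis by (simp only: dvd_minus_iff)
  qed
qed

text \<open>The Frobenius congruence modulo \<open>l\<close>, by induction on the coefficients;
  \<open>int_fermat\<close> treats the constants.\<close>

lemma ev_frobenius:
  assumes l: "Factorial_Ring.prime l"
  shows "\<exists>g. \<forall>z. ev f (z ^ l) = ev f z ^ l + of_nat l * ev g z"
proof (induction f)
  case 0
  have "l > 0" using l prime_gt_0_nat by blast
  then show ?case by (intro exI[of _ 0]) (simp add: zero_power)
next
  case (pCons a f)
  then obtain g where g: "\<And>z. ev f (z ^ l) = ev f z ^ l + of_nat l * ev g z" by blast
  obtain E where E: "([:a:] + pCons 0 f) ^ l - ([:a:] ^ l + (pCons 0 f) ^ l) = of_nat l * E"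
    using frobenius_dvd[OF l, of "[:a:]" "pCons 0 f"] by blast
  obtain b where b: "a ^ l - a = int l * b" using int_fermat[OF l, of a] by blast
  have "ev (pCons a f) (z ^ l) = ev (pCons a f) z ^ l + of_nat l * ev (Polynomial.monom 1 l * g - E - [:b:]) z" for z
  proof -
    have E': "(of_int a + z * ev f z) ^ l - (of_int a ^ l + (z * ev f z) ^ l) = of_nat l * ev E z"
      using arg_cong[OF E, of "\<lambda>p. ev p z"] by simp
    have b': "of_int a ^ l - of_int a = (of_nat l * of_int b :: complex)"
      using arg_cong[OF b, of "of_int :: int \<Rightarrow> complex"] by simp
    show ?thesis using E' b' by (simp add: g algebra_simps power_mult_distrib)
  qed
  then show ?case by blast
qed

text \<open>\<open>f\<close> has least degree among the integer polynomials annihilating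
  \<open>z\<close> and is made primitive. Multiplicativity of contents then makes the cofactor
  \<open>h\<close> integral, as arguments modulo a prime require. In general pseudo-division leaves
  a constant \<open>c\<close>.\<close>

lemma minimal_integer_polynomial:
  fixes z :: complex
  assumes z: "z ^ N = 1" "N > 0"
  obtains f h where "ev f z = 0" "f * h = Polynomial.monom 1 N - 1"
    "\<And>p. ev p z = 0 \<Longrightarrow> \<exists>c q. c \<noteq> 0 \<and> Polynomial.smult c p = f * q"
proof -
  define P :: "int poly \<Rightarrow> bool" where "P f \<longleftrightarrow> f \<noteq> 0 \<and> ev f z = 0" for f
  let ?X = "Polynomial.monom 1 N - 1 :: int poly"
  have X: "P ?X"
  proof -
    have "Polynomial.coeff ?X N = 1" using z(2) by simp
    then have "?X \<noteq> 0" by (metis coeff_0 zero_neq_one)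
    then show ?thesis using z by (simp add: P_def)
  qed
  define f0 where "f0 = arg_min Polynomial.degree P"
  have f0: "P f0" "\<And>g. P g \<Longrightarrow> Polynomial.degree f0 \<le> Polynomial.degree g"
    using arg_min_natI[of P, OF X] arg_min_nat_le[of P] unfolding f0_def by auto
  define f where "f = primitive_part f0"
  have f0f: "f0 = Polynomial.smult (content f0) f" by (simp add: f_def)
  have f0ne: "f0 \<noteq> 0" using f0(1) by (simp add: P_def)
  have f: "f \<noteq> 0" "content f = 1" "Polynomial.degree f = Polynomial.degree f0"
    using f0ne by (auto simp: f_def)
  have "of_int (content f0) * ev f z = 0" using f0(1) f0f by (metis P_def ev_smult)
  then have fz: "ev f z = 0" using f0ne by simp
  have div: "\<exists>c q. c \<noteq> 0 \<and> Polynomial.smult c p = f * q" if p: "ev p z = 0" for p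
  proof -
    obtain q r where qr: "pseudo_divmod p f = (q, r)" by (cases "pseudo_divmod p f")
    define c where "c = Polynomial.coeff f (Polynomial.degree f) ^ (Suc (Polynomial.degree p) - Polynomial.degree f)"
    note pd = pseudo_divmod[OF f(1) qr]
    have e: "Polynomial.smult c p = f * q + r" using pd(1) by (simp add: c_def)
    have "ev (Polynomial.smult c p) z = ev (f * q + r) z" by (simp only: e)
    then have "ev r z = 0" using p fz by simp
    then have "r = 0" using pd(2) f0(2)[of r] f(3) unfolding P_def by linarith
    moreover have "c \<noteq> 0" using f(1) by (simp add: c_def)
    ultimately show ?thesis using e by auto
  qed
  obtain c q where cq: "c \<noteq> 0" "Polynomial.smult c ?X = f * q"
    using div[of ?X] X by (auto simp: P_def)
  have "content (Polynomial.smult c ?X) = content q" unfolding cq(2) by (simp add: content_mult f(2))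
  then have "normalize c dvd content q" by (metis content_smult dvd_triv_left normalize_mult_normalize_left dvd_refl dvd_mult2)
  then have "[:c:] dvd q" by (simp add: const_poly_dvd_iff_dvd_content)
  then obtain h where h: "q = Polynomial.smult c h" by (auto simp: dvd_def)
  have "Polynomial.smult c ?X = Polynomial.smult c (f * h)" using cq(2) h by simp
  then have "?X = f * h" using cq(1) by (metis smult_cancel)
  then show ?thesis using that[OF fz _ div] by metis
qed

text \<open>Dedekind's argument for the irreducibility of cyclotomic polynomials. If
  \<open>f\<close> did not vanish at \<open>z ^ l\<close>, then \<open>h\<close> would, and
  differentiating X^N - 1 writes \<open>N\<close> times a unit as a multiple of the value of
  \<open>f\<close> there, which Frobenius makes a multiple of \<open>l\<close>. As \<open>l\<close>
  is coprime to \<open>N\<close>, it would be invertible in the ring generated by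
  \<open>z\<close>.\<close>

lemma conjugate_prime:
  fixes z :: complex
  assumes z: "z ^ N = 1" "N > 0" and l: "Factorial_Ring.prime l" "\<not> l dvd N" and p: "ev p z = 0"
  shows "ev p (z ^ l) = 0"
proof -
  have l2: "l \<ge> 2" using l prime_ge_2_nat by blast
  obtain f h where f: "ev f z = 0" "f * h = Polynomial.monom 1 N - 1"
    "\<And>p. ev p z = 0 \<Longrightarrow> \<exists>c q. c \<noteq> 0 \<and> Polynomial.smult c p = f * q"
    using minimal_integer_polynomial[OF z] by metis
  have fl: "ev f (z ^ l) = 0"
  proof (rule ccontr)
    assume nz: "ev f (z ^ l) \<noteq> 0"
    have zl: "(z ^ l) ^ N = 1" by (metis power_commutes power_mult power_one mult.commute z(1))
    have "ev f (z ^ l) * ev h (z ^ l) = ev (Polynomial.monom 1 N - 1) (z ^ l)" by (simp only: ev_mult[symmetric] f(2))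
    then have h0: "ev h (z ^ l) = 0" using zl nz by simp
    have "pderiv (f * h) = pderiv (Polynomial.monom 1 N) - pderiv 1" by (simp only: f(2) pderiv_diff)
    then have "f * pderiv h + h * pderiv f = Polynomial.monom (int N) (N - 1)"
      by (simp add: pderiv_mult pderiv_monom pderiv_1)
    then have "ev (f * pderiv h + h * pderiv f) (z ^ l) = ev (Polynomial.monom (int N) (N - 1)) (z ^ l)" by simp
    then have d: "ev f (z ^ l) * ev (pderiv h) (z ^ l) = of_nat N * (z ^ l) ^ (N - 1)" using h0 by simp
    obtain g where g: "\<And>z. ev f (z ^ l) = ev f z ^ l + of_nat l * ev g z" using ev_frobenius[OF l(1)] by blast
    have fg: "ev f (z ^ l) = of_nat l * ev g z" using g[of z] f(1) l2 by (simp add: zero_power)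
    obtain h2 where h2: "\<And>z. ev (pderiv h) (z ^ l) = ev h2 z" using ev_power_arg by metis
    have "of_nat N * ((z ^ l) ^ (N - 1) * z ^ l) = of_nat l * (ev g z * ev h2 z * z ^ l)"
      by (simp only: mult.assoc[symmetric] d[symmetric] fg h2)
    moreover have "(z ^ l) ^ (N - 1) * z ^ l = 1" using zl z(2) by (metis power_minus_mult)
    ultimately have "of_nat N = of_nat l * (ev g z * ev h2 z * z ^ l)" by (simp only: mult_1_right)
    then have key: "of_nat N = of_nat l * ev (g * h2 * Polynomial.monom 1 l) z" by (simp only: ev_mult ev_monom of_int_1 mult_1_left)
    have "coprime l N" by (rule prime_imp_coprime[OF l])
    then have gcd1: "gcd (int l) (int N) = 1" by (simp only: gcd_int_int_eq coprime_imp_gcd_eq_1 of_nat_1)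
    have "\<exists>a b. a * int l + b * int N = 1" unfolding gcd1[symmetric] by (rule bezout_int)
    then obtain a b where ab: "a * int l + b * int N = 1" by (elim exE)
    have "of_int (a * int l + b * int N) = (1 :: complex)" by (simp only: ab of_int_1)
    then have "of_int a * of_nat l + of_int b * of_nat N = (1 :: complex)" by simp
    then have "of_nat l * ev ([:a:] + Polynomial.smult b (g * h2 * Polynomial.monom 1 l)) z = 1"
      unfolding key by (simp add: algebra_simps)
    then show False using ev_ne_inverse_nat[OF z l2] by blast
  qed
  obtain c q where cq: "c \<noteq> 0" "Polynomial.smult c p = f * q" using f(3)[OF p] by blast
  have "of_int c * ev p (z ^ l) = 0" using arg_cong[OF cq(2), of "\<lambda>p. ev p (z ^ l)"] fl by simp
  then show ?thesis using cq(1) by simp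
qed

lemma conjugate_root_of_unity:
  fixes z :: complex
  assumes z: "z ^ N = 1" "N > 0" and a: "coprime a N" and p: "ev p z = 0"
  shows "ev p (z ^ a) = 0"
  using a
proof (induction a rule: less_induct)
  case (less a)
  show ?case
  proof (cases "a \<le> 1")
    case True
    show ?thesis
    proof (cases "a = 0")
      case True
      then have "N = 1" using less.prems by simp
      then show ?thesis using z p True by simp
    next
      case False
      then have "a = 1" using True by simp
      then show ?thesis using p by simp
    qed
  next
    case False
    then obtain l where l: "Factorial_Ring.prime l" "l dvd a" using prime_factor_nat[of a] by auto
    then obtain b where b: "a = b * l" by (metis dvd_def mult.commute)
    have l2: "l \<ge> 2" using l prime_ge_2_nat by blast
    have b0: "b > 0" using False b by (cases b) auto
    have cb: "coprime b N" "coprime l N" using less.prems b by auto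
    have "b < a" using b b0 l2 by simp
    then have IH: "ev p (z ^ b) = 0" using less.IH cb by blast
    have zb: "(z ^ b) ^ N = 1" by (metis power_mult power_one mult.commute z(1))
    have "\<not> l dvd N" using cb(2) l2 coprime_absorb_left[of l N] by auto
    then have "ev p ((z ^ b) ^ l) = 0" using conjugate_prime[OF zb z(2) l(1) _ IH] by blast
    then show ?thesis by (simp add: b power_mult)
  qed
qed

subsection \<open>Cyclotomic fields\<close>

lemma zeta_cis: "zeta n = cis (2 * pi / n)"
  by (simp add: zeta_def cis_conv_exp mult_ac)

lemma zeta_pow: "zeta n ^ k = cis (2 * pi * k / n)"
  unfolding zeta_cis Complex.DeMoivre by (rule arg_cong[of _ _ cis]) simp

lemma zeta_pow_self: "n > 0 \<Longrightarrow> zeta n ^ n = 1"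
  by (simp add: zeta_pow)

lemma zeta_mult_pow:
  assumes "m > 0" shows "zeta (n * m) ^ m = zeta n"
proof -
  have "2 * pi * real m / real (n * m) = 2 * pi / real n" using assms by simp
  then show ?thesis unfolding zeta_pow unfolding zeta_cis by (simp only:)
qed

lemma root_of_unity_zeta_power:
  assumes "n > 0" "w ^ n = 1" obtains k where "w = zeta n ^ k"
proof -
  have "w \<in> (\<lambda>k. cis (2 * pi * real k / real n)) ` {..<n}"
    using Complex.bij_betw_roots_unity[OF assms(1)] assms(2) by (simp add: bij_betw_def)
  then obtain k where "w = cis (2 * pi * real k / real n)" by (elim imageE)
  then have "w = zeta n ^ k" by (simp only: zeta_pow)
  then show ?thesis by (rule that)
qed

text \<open>Encoded by integer polynomials so that, once denominators are cleared, relations fall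
  under \<open>conjugate_root_of_unity\<close>.\<close>

definition cyc_field :: "nat \<Rightarrow> complex set" where
  "cyc_field n = {ev p (zeta n) / ev q (zeta n) | p q. ev q (zeta n) \<noteq> 0}"

lemma cyc_fieldI: "ev q (zeta n) \<noteq> 0 \<Longrightarrow> ev p (zeta n) / ev q (zeta n) \<in> cyc_field n"
  unfolding cyc_field_def by (intro CollectI exI[of _ p] exI[of _ q] conjI refl)

lemma cyc_fieldE:
  assumes "x \<in> cyc_field n"
  obtains p q where "x = ev p (zeta n) / ev q (zeta n)" "ev q (zeta n) \<noteq> 0"
  using assms unfolding cyc_field_def by (elim CollectE exE conjE) (rule that)

lemma cyc_field_ev: "ev p (zeta n) \<in> cyc_field n"
  using cyc_fieldI[of 1 n p] by simp

lemma cyc_field_add: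
  assumes "x \<in> cyc_field n" "y \<in> cyc_field n" shows "x + y \<in> cyc_field n"
proof -
  obtain p q p' q' where "x = ev p (zeta n) / ev q (zeta n)" "ev q (zeta n) \<noteq> 0"
    "y = ev p' (zeta n) / ev q' (zeta n)" "ev q' (zeta n) \<noteq> 0" using assms by (metis cyc_fieldE)
  then have "x + y = ev (p * q' + p' * q) (zeta n) / ev (q * q') (zeta n)" "ev (q * q') (zeta n) \<noteq> 0"
    by (simp_all add: add_frac_eq)
  then show ?thesis using cyc_fieldI by metis
qed

lemma cyc_field_mult:
  assumes "x \<in> cyc_field n" "y \<in> cyc_field n" shows "x * y \<in> cyc_field n"
proof -
  obtain p q p' q' where "x = ev p (zeta n) / ev q (zeta n)" "ev q (zeta n) \<noteq> 0"
    "y = ev p' (zeta n) / ev q' (zeta n)" "ev q' (zeta n) \<noteq> 0" using assms by (metis cyc_fieldE)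
  then have "x * y = ev (p * p') (zeta n) / ev (q * q') (zeta n)" "ev (q * q') (zeta n) \<noteq> 0"
    by simp_all
  then show ?thesis using cyc_fieldI by metis
qed

lemma cyc_field_inverse:
  assumes "x \<in> cyc_field n" shows "inverse x \<in> cyc_field n"
proof -
  obtain p q where x: "x = ev p (zeta n) / ev q (zeta n)" "ev q (zeta n) \<noteq> 0" using assms by (rule cyc_fieldE)
  show ?thesis
  proof (cases "ev p (zeta n) = 0")
    case True
    then show ?thesis using x cyc_field_ev[of 0 n] by simp
  next
    case False
    then show ?thesis using x cyc_fieldI[of p n q] by simp
  qed
qed

lemma cyc_field_of_rat: "of_rat r \<in> cyc_field n"
proof -
  obtain a b where ab: "quotient_of r = (a, b)" by (cases "quotient_of r") auto
  have b: "b > 0" using quotient_of_denom_pos[OF ab] .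
  have "(of_rat r :: complex) = of_int a / of_int b" by (simp add: quotient_of_div[OF ab] of_rat_divide)
  also have "\<dots> = ev [:a:] (zeta n) / ev [:b:] (zeta n)" by simp
  finally show ?thesis using cyc_fieldI[of "[:b:]" n "[:a:]"] b by simp
qed

lemma cyc_field_uminus: "x \<in> cyc_field n \<Longrightarrow> - x \<in> cyc_field n"
  using cyc_field_mult[OF cyc_field_of_rat[of "-1"]] by simp

lemma cyc_field_diff: "x \<in> cyc_field n \<Longrightarrow> y \<in> cyc_field n \<Longrightarrow> x - y \<in> cyc_field n"
  using cyc_field_add[of x n "- y"] cyc_field_uminus[of y n] by simp

lemma cyc_field_divide: "x \<in> cyc_field n \<Longrightarrow> y \<in> cyc_field n \<Longrightarrow> x / y \<in> cyc_field n"
  by (simp add: divide_inverse cyc_field_mult cyc_field_inverse)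

lemma cyc_field_mono:
  assumes "n dvd m" "m > 0" shows "cyc_field n \<subseteq> cyc_field m"
proof
  fix x assume "x \<in> cyc_field n"
  then obtain p q where x: "x = ev p (zeta n) / ev q (zeta n)" "ev q (zeta n) \<noteq> 0" by (rule cyc_fieldE)
  obtain k where k: "m = n * k" using assms(1) by blast
  then have "k > 0" using assms(2) by (cases k) auto
  then have z: "zeta n = zeta m ^ k" unfolding k by (simp add: zeta_mult_pow)
  obtain p' where p': "\<And>z. ev p (z ^ k) = ev p' z" using ev_power_arg by metis
  obtain q' where q': "\<And>z. ev q (z ^ k) = ev q' z" using ev_power_arg by metis
  show "x \<in> cyc_field m" using x cyc_fieldI[of q' m p'] unfolding z p' q' by simp
qed

lemma root_of_unity_in_cyc_field:
  assumes "n > 0" "w ^ n = 1" shows "w \<in> cyc_field n"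
proof -
  obtain k where "w = zeta n ^ k" using root_of_unity_zeta_power[OF assms] .
  then show ?thesis using cyc_field_ev[of "Polynomial.monom 1 k" n] by simp
qed

lemma root_of_unity_power_inj:
  fixes w v :: complex
  assumes N: "N > 0" "w ^ N = 1" "v ^ N = 1" and a: "coprime a N" and eq: "w ^ a = v ^ a"
  shows "w = v"
proof -
  obtain x where x: "[a * x = Suc 0] (mod N)" using cong_solve_coprime_nat[OF a] by blast
  have inv: "(y ^ a) ^ x = y" if "y ^ N = 1" for y :: complex
  proof -
    have "(y ^ a) ^ x = y ^ (a * x)" by (simp add: power_mult)
    also have "\<dots> = y ^ ((a * x) mod N)" by (rule root_power_mod[OF that])
    also have "\<dots> = y ^ (1 mod N)" using x by (simp only: cong_def One_nat_def)
    also have "\<dots> = y" by (simp only: root_power_mod[OF that, of 1, symmetric] power_one_right)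
    finally show ?thesis .
  qed
  have "w = (w ^ a) ^ x" by (rule inv[OF N(2), symmetric])
  also have "\<dots> = v" unfolding eq by (rule inv[OF N(3)])
  finally show ?thesis .
qed

subsection \<open>Roots of unity with cyclotomic cross ratios\<close>

definition cross_ratios_in :: "complex set \<Rightarrow> complex set \<Rightarrow> bool" where
  "cross_ratios_in S F \<longleftrightarrow> (\<forall>a\<in>S. \<forall>b\<in>S. \<forall>c\<in>S. \<forall>d\<in>S. distinct [a, b, c, d] \<longrightarrow> cross_ratio a b c d \<in> F)"

text \<open>With denominators cleared, the value of the cross ratio is an integer polynomial
  relation for \<open>zeta N\<close>. Replacing \<open>zeta N\<close> by \<open>zeta N ^ a\<close>
  raises the four roots to the power \<open>a\<close> and fixes \<open>zeta n\<close>; eliminating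
  \<open>p / q\<close> from both relations leaves the claim.\<close>

lemma cross_ratio_conjugate:
  assumes N: "N > 0" "n > 0" "n dvd N" and a: "coprime a N" "[a = 1] (mod n)"
    and w: "w1 ^ N = 1" "w2 ^ N = 1" "w3 ^ N = 1" "w4 ^ N = 1" "distinct [w1, w2, w3, w4]"
    and cr: "cross_ratio w1 w2 w3 w4 \<in> cyc_field n"
  shows "((w1 - w3) * (w2 - w4)) * ((w1 ^ a - w4 ^ a) * (w2 ^ a - w3 ^ a)) =
    ((w1 - w4) * (w2 - w3)) * ((w1 ^ a - w3 ^ a) * (w2 ^ a - w4 ^ a))"
proof -
  obtain k1 where k1: "w1 = zeta N ^ k1" using root_of_unity_zeta_power[OF N(1) w(1)] .
  obtain k2 where k2: "w2 = zeta N ^ k2" using root_of_unity_zeta_power[OF N(1) w(2)] .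
  obtain k3 where k3: "w3 = zeta N ^ k3" using root_of_unity_zeta_power[OF N(1) w(3)] .
  obtain k4 where k4: "w4 = zeta N ^ k4" using root_of_unity_zeta_power[OF N(1) w(4)] .
  note k = k1 k2 k3 k4
  obtain p q where pq: "cross_ratio w1 w2 w3 w4 = ev p (zeta n) / ev q (zeta n)" "ev q (zeta n) \<noteq> 0"
    by (rule cyc_fieldE[OF cr])
  obtain m where m: "N = n * m" using N(3) by blast
  have m0: "m > 0" using m N(1) by (cases m) auto
  have zn: "zeta N ^ m = zeta n" unfolding m by (rule zeta_mult_pow[OF m0])
  have zna: "(zeta N ^ a) ^ m = zeta n"
  proof -
    have "(zeta N ^ a) ^ m = (zeta N ^ m) ^ a" by (simp only: power_mult[symmetric] mult.commute)
    also have "\<dots> = zeta n ^ (a mod n)" unfolding zn by (rule root_power_mod[OF zeta_pow_self[OF N(2)]])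
    also have "\<dots> = zeta n ^ (1 mod n)" using a(2) by (simp add: cong_def)
    also have "\<dots> = zeta n" by (simp only: root_power_mod[OF zeta_pow_self[OF N(2)], of 1, symmetric] power_one_right)
    finally show ?thesis .
  qed
  obtain p' where p': "\<And>z. ev p (z ^ m) = ev p' z" using ev_power_arg by metis
  obtain q' where q': "\<And>z. ev q (z ^ m) = ev q' z" using ev_power_arg by metis
  let ?m = "\<lambda>k. Polynomial.monom 1 k :: int poly"
  define R where "R = (?m k1 - ?m k3) * (?m k2 - ?m k4) * q' - p' * ((?m k1 - ?m k4) * (?m k2 - ?m k3))"
  have e1: "(w1 - w3) * (w2 - w4) * ev q (zeta n) = ev p (zeta n) * ((w1 - w4) * (w2 - w3))"
    using pq w(5) by (simp add: cross_ratio_def frac_eq_eq)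
  have pw: "(zeta N ^ a) ^ j = (zeta N ^ j) ^ a" for j
    unfolding power_mult[symmetric] by (subst mult.commute) (rule refl)
  have "ev R (zeta N) = 0"
    using e1 by (simp add: R_def k p'[symmetric] q'[symmetric] zn)
  then have "ev R (zeta N ^ a) = 0" by (rule conjugate_root_of_unity[OF zeta_pow_self[OF N(1)] N(1) a(1)])
  then have e2: "(w1 ^ a - w3 ^ a) * (w2 ^ a - w4 ^ a) * ev q (zeta n) = ev p (zeta n) * ((w1 ^ a - w4 ^ a) * (w2 ^ a - w3 ^ a))"
    unfolding R_def k1 k2 k3 k4 ev_diff ev_mult ev_monom p'[symmetric] q'[symmetric] zna pw[of k1] pw[of k2] pw[of k3] pw[of k4]
      of_int_1 mult_1_left right_minus_eq .
  \<comment> \<open>Nonzero because a cross ratio of four distinct points is, so it can be cancelled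
    at the end.\<close>
  have p0: "ev p (zeta n) \<noteq> 0" using e1 pq(2) w(5) by auto
  let ?P = "ev p (zeta n)" and ?Q = "ev q (zeta n)"
  have "(?P * ?Q) * (((w1 - w3) * (w2 - w4)) * ((w1 ^ a - w4 ^ a) * (w2 ^ a - w3 ^ a)))
    = ((w1 - w3) * (w2 - w4) * ?Q) * (?P * ((w1 ^ a - w4 ^ a) * (w2 ^ a - w3 ^ a)))" by (simp only: mult_ac)
  also have "\<dots> = (?P * ((w1 - w4) * (w2 - w3))) * ((w1 ^ a - w3 ^ a) * (w2 ^ a - w4 ^ a) * ?Q)"
    by (simp only: e1 e2)
  also have "\<dots> = (?P * ?Q) * (((w1 - w4) * (w2 - w3)) * ((w1 ^ a - w3 ^ a) * (w2 ^ a - w4 ^ a)))" by (simp only: mult_ac)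
  finally show ?thesis using p0 pq(2) by simp
qed

text \<open>With \<open>w1\<close>, \<open>w2\<close>, \<open>w3\<close> fixed,
  \<open>cross_ratio_conjugate\<close> for a variable fourth point is the equation of a Moebius
  transformation. Injectivity of the power map keeps it nondegenerate.\<close>

lemma moebius_conjugate:
  assumes N: "N > 0" "n > 0" "n dvd N" and a: "coprime a N" "[a = 1] (mod n)"
    and S: "\<And>w. w \<in> S \<Longrightarrow> w ^ N = 1" and cr: "cross_ratios_in S (cyc_field n)"
    and w: "w1 \<in> S" "w2 \<in> S" "w3 \<in> S" "w1 \<noteq> w2" "w1 \<noteq> w3" "w2 \<noteq> w3"
  shows "\<exists>\<alpha> \<beta> \<gamma> \<delta>. \<alpha> * \<delta> \<noteq> \<beta> * \<gamma> \<and> (\<forall>w\<in>S. w ^ a * (\<gamma> * w + \<delta>) = \<alpha> * w + \<beta>)"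
proof -
  have ne: "x ^ a \<noteq> y ^ a" if "x \<in> S" "y \<in> S" "x \<noteq> y" for x y
    using root_of_unity_power_inj[OF N(1) S[OF that(1)] S[OF that(2)] a(1)] that(3) by blast
  define c1 where "c1 = (w3 - w2) * (w3 ^ a - w1 ^ a)"
  define c2 where "c2 = (w3 - w1) * (w3 ^ a - w2 ^ a)"
  have c: "c1 \<noteq> 0" "c2 \<noteq> 0" using w ne by (auto simp: c1_def c2_def)
  have rel: "c1 * ((x - w1) * (x ^ a - w2 ^ a)) = c2 * ((x - w2) * (x ^ a - w1 ^ a))" if x: "x \<in> S" for x
  proof (cases "x = w1 \<or> x = w2 \<or> x = w3")
    case True
    then show ?thesis by (auto simp: c1_def c2_def)
  next
    case False
    then have d: "distinct [x, w3, w1, w2]" using w by auto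
    then have "cross_ratio x w3 w1 w2 \<in> cyc_field n" using cr x w unfolding cross_ratios_in_def by blast
    from cross_ratio_conjugate[OF N a S[OF x] S[OF w(3)] S[OF w(1)] S[OF w(2)] d this]
    have "((x - w1) * (w3 - w2)) * ((x ^ a - w2 ^ a) * (w3 ^ a - w1 ^ a)) =
      ((x - w2) * (w3 - w1)) * ((x ^ a - w1 ^ a) * (w3 ^ a - w2 ^ a))" .
    then show ?thesis by (simp only: c1_def c2_def mult_ac)
  qed
  define \<alpha> \<beta> \<gamma> \<delta> where "\<alpha> = c1 * w2 ^ a - c2 * w1 ^ a" and "\<beta> = c2 * w1 ^ a * w2 - c1 * w2 ^ a * w1"
    and "\<gamma> = c1 - c2" and "\<delta> = c2 * w2 - c1 * w1"
  have "\<alpha> * \<delta> - \<beta> * \<gamma> = c1 * c2 * ((w1 ^ a - w2 ^ a) * (w1 - w2))"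
    by (simp add: \<alpha>_def \<beta>_def \<gamma>_def \<delta>_def algebra_simps)
  moreover have "c1 * c2 * ((w1 ^ a - w2 ^ a) * (w1 - w2)) \<noteq> 0" using c w ne by simp
  ultimately have "\<alpha> * \<delta> \<noteq> \<beta> * \<gamma>" by auto
  moreover have "x ^ a * (\<gamma> * x + \<delta>) = \<alpha> * x + \<beta>" if "x \<in> S" for x
    using rel[OF that] by (simp add: \<alpha>_def \<beta>_def \<gamma>_def \<delta>_def algebra_simps)
  ultimately show ?thesis by blast
qed

section \<open>Counting roots of unity by polynomials\<close>

text \<open>In the applications \<open>c\<close> is the unknown value \<open>w ^ (a - e)\<close> or
  \<open>w ^ (a + e)\<close>, an \<open>h\<close>-th root of unity.\<close>

lemma card_union_of_roots:
  fixes f :: "complex \<Rightarrow> complex poly"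
  assumes h: "h > 0" and S: "\<And>w. w \<in> S \<Longrightarrow> \<exists>c. c ^ h = 1 \<and> poly (f c) w = 0"
    and f: "\<And>c. c ^ h = 1 \<Longrightarrow> f c \<noteq> 0 \<and> Polynomial.degree (f c) \<le> d"
  shows "finite S \<and> card S \<le> h * d"
proof -
  let ?C = "{c::complex. c ^ h = 1}"
  have C: "finite ?C" "card ?C = h" using h card_roots_unity_eq finite_roots_unity[of h] by auto
  have sub: "S \<subseteq> (\<Union>c\<in>?C. {w. poly (f c) w = 0})" using S by blast
  have fin: "finite {w. poly (f c) w = 0}" if "c \<in> ?C" for c using f that poly_roots_finite by blast
  have finU: "finite (\<Union>c\<in>?C. {w. poly (f c) w = 0})" using C fin by blast
  have "card S \<le> card (\<Union>c\<in>?C. {w. poly (f c) w = 0})" by (rule card_mono[OF finU sub])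
  also have "\<dots> \<le> (\<Sum>c\<in>?C. card {w. poly (f c) w = 0})" by (rule card_UN_le[OF C(1)])
  also have "\<dots> \<le> (\<Sum>c\<in>?C. d)"
  proof (rule sum_mono)
    fix c assume "c \<in> ?C"
    then have "f c \<noteq> 0" "Polynomial.degree (f c) \<le> d" using f by auto
    then show "card {w. poly (f c) w = 0} \<le> d" using card_poly_roots_bound le_trans by blast
  qed
  also have "\<dots> = h * d" using C(2) by simp
  finally show ?thesis using finite_subset[OF sub finU] by simp
qed

text \<open>\<open>M\<close> is the exponent of \<open>S\<close>. Containing 1 is a normalization,
  reached by dividing by an element; it identifies the constant in the degenerate cases of
  \<open>bound_plus_one\<close> and \<open>bound_minus_one\<close>.\<close>

locale cyclotomic_cross_ratios =
  fixes n :: nat and S :: "complex set" and M :: nat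
  assumes n: "n > 0" and one: "1 \<in> S" and cr: "cross_ratios_in S (cyc_field n)"
    and M: "M > 0" and exponent: "(\<forall>w\<in>S. w ^ k = 1) \<longleftrightarrow> M dvd k"
begin

lemma S_root: "w \<in> S \<Longrightarrow> M dvd k \<Longrightarrow> w ^ k = 1"
  using exponent by blast

text \<open>For good \<open>a\<close> the automorphism \<open>\<zeta>\<^sub>N \<mapsto> \<zeta>\<^sub>N\<^sup>a\<close> fixes \<open>\<rat>(\<zeta>\<^sub>n)\<close> pointwise. Its level \<open>N\<close> may be any common
  multiple of \<open>n\<close> and of the exponent \<open>M\<close> of the roots of unity in \<open>S\<close>.\<close>

definition good :: "nat \<Rightarrow> nat \<Rightarrow> bool" where
  "good a N \<longleftrightarrow> N > 0 \<and> M dvd N \<and> n dvd N \<and> coprime a N \<and> [a = 1] (mod n)"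

lemma good_moebius:
  assumes "good a N" "\<not> (finite S \<and> card S \<le> 2)"
  obtains \<alpha> \<beta> \<gamma> \<delta> where "\<alpha> * \<delta> \<noteq> \<beta> * \<gamma>" "\<And>w. w \<in> S \<Longrightarrow> w ^ a * (\<gamma> * w + \<delta>) = \<alpha> * w + \<beta>"
proof -
  have "\<exists>T\<subseteq>S. finite T \<and> card T = 3"
  proof (cases "finite S")
    case True
    then show ?thesis using assms(2) obtain_subset_with_card_n[of 3 S] by force
  next
    case False
    then show ?thesis using infinite_arbitrarily_large by blast
  qed
  then obtain w1 w2 w3 where "w1 \<in> S" "w2 \<in> S" "w3 \<in> S" "w1 \<noteq> w2" "w1 \<noteq> w3" "w2 \<noteq> w3"
    by (auto simp: card_3_iff)
  then show ?thesis
    using moebius_conjugate[of N n a S w1 w2 w3] assms(1) n cr S_root[of _ N] that unfolding good_def by metis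
qed

text \<open>On \<open>S\<close> the power \<open>w ^ a\<close> is \<open>c * w ^ e\<close> with
  \<open>c ^ h = 1\<close>. For \<open>e \<ge> 2\<close> the coefficients
  \<open>c * \<delta>\<close> and \<open>c * \<gamma>\<close> in degrees \<open>e\<close> and
  \<open>e + 1\<close> are untouched by the linear part, so the polynomial is not zero.\<close>

lemma bound_pos:
  assumes a: "good a N" and e: "e \<ge> 2" "a \<ge> e" and h: "h > 0" "M dvd (a - e) * h"
  shows "finite S \<and> card S \<le> h * (e + 1)"
proof (cases "finite S \<and> card S \<le> 2")
  case True
  moreover have "2 \<le> h * (e + 1)" using h e by (cases h) auto
  ultimately show ?thesis by linarith
next
  case False
  obtain \<alpha> \<beta> \<gamma> \<delta> where m: "\<alpha> * \<delta> \<noteq> \<beta> * \<gamma>" "\<And>w. w \<in> S \<Longrightarrow> w ^ a * (\<gamma> * w + \<delta>) = \<alpha> * w + \<beta>"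
    using good_moebius[OF a False] by metis
  define f where "f c = Polynomial.monom (c * \<gamma>) (e + 1) + Polynomial.monom (c * \<delta>) e - [:\<beta>, \<alpha>:]" for c
  have pf: "poly (f c) x = c * x ^ e * (\<gamma> * x + \<delta>) - (\<alpha> * x + \<beta>)" for c x
    by (simp add: f_def poly_monom algebra_simps)
  show ?thesis
  proof (rule card_union_of_roots[OF h(1), of S f])
    fix w assume w: "w \<in> S"
    have "w ^ a = w ^ (a - e) * w ^ e" using e by (simp add: power_add[symmetric])
    then have "poly (f (w ^ (a - e))) w = 0" unfolding pf using m(2)[OF w] by simp
    moreover have "(w ^ (a - e)) ^ h = 1" using S_root[OF w h(2)] by (simp add: power_mult)
    ultimately show "\<exists>c. c ^ h = 1 \<and> poly (f c) w = 0" by blast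
  next
    fix c :: complex assume "c ^ h = 1"
    then have c: "c \<noteq> 0" using h(1) by (auto simp: zero_power)
    have "Polynomial.coeff (f c) (e + 1) = c * \<gamma>" "Polynomial.coeff (f c) e = c * \<delta>"
      using e by (auto simp: f_def coeff_pCons split: nat.splits)
    then have "f c \<noteq> 0" using c m(1) by (metis coeff_0 mult_eq_0_iff mult_zero_right)
    moreover have "Polynomial.degree (f c) \<le> e + 1" unfolding f_def
      using e by (intro degree_diff_le degree_add_le) (auto intro: order_trans[OF degree_monom_le] order_trans[OF degree_pCons_le])
    ultimately show "f c \<noteq> 0 \<and> Polynomial.degree (f c) \<le> e + 1" by blast
  qed
qed

text \<open>The counterpart for \<open>a\<close> near \<open>- e\<close>, after multiplication by
  \<open>w ^ e\<close>; now \<open>\<alpha>\<close> and \<open>\<beta>\<close> are the top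
  coefficients.\<close>

lemma bound_neg:
  assumes a: "good a N" and e: "e \<ge> 2" and h: "h > 0" "M dvd (a + e) * h"
  shows "finite S \<and> card S \<le> h * (e + 1)"
proof (cases "finite S \<and> card S \<le> 2")
  case True
  moreover have "2 \<le> h * (e + 1)" using h e by (cases h) auto
  ultimately show ?thesis by linarith
next
  case False
  obtain \<alpha> \<beta> \<gamma> \<delta> where m: "\<alpha> * \<delta> \<noteq> \<beta> * \<gamma>" "\<And>w. w \<in> S \<Longrightarrow> w ^ a * (\<gamma> * w + \<delta>) = \<alpha> * w + \<beta>"
    using good_moebius[OF a False] by metis
  define f where "f c = Polynomial.monom \<alpha> (e + 1) + Polynomial.monom \<beta> e - [:c * \<delta>, c * \<gamma>:]" for c
  have pf: "poly (f c) x = x ^ e * (\<alpha> * x + \<beta>) - c * (\<gamma> * x + \<delta>)" for c x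
    by (simp add: f_def poly_monom algebra_simps)
  show ?thesis
  proof (rule card_union_of_roots[OF h(1), of S f])
    fix w assume w: "w \<in> S"
    have "w ^ e * (\<alpha> * w + \<beta>) = w ^ (a + e) * (\<gamma> * w + \<delta>)" using m(2)[OF w] by (simp add: power_add mult_ac)
    then have "poly (f (w ^ (a + e))) w = 0" unfolding pf by simp
    moreover have "(w ^ (a + e)) ^ h = 1" using S_root[OF w h(2)] by (simp add: power_mult)
    ultimately show "\<exists>c. c ^ h = 1 \<and> poly (f c) w = 0" by blast
  next
    fix c :: complex assume "c ^ h = 1"
    have "Polynomial.coeff (f c) (e + 1) = \<alpha>" "Polynomial.coeff (f c) e = \<beta>"
      using e by (auto simp: f_def coeff_pCons split: nat.splits)
    then have "f c \<noteq> 0" using m(1) by (metis coeff_0 mult_zero_left)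
    moreover have "Polynomial.degree (f c) \<le> e + 1" unfolding f_def
      using e by (intro degree_diff_le degree_add_le) (auto intro: order_trans[OF degree_monom_le] order_trans[OF degree_pCons_le])
    ultimately show "f c \<noteq> 0 \<and> Polynomial.degree (f c) \<le> e + 1" by blast
  qed
qed

text \<open>For \<open>e = 1\<close> the polynomial may vanish identically. Then
  \<open>w ^ a = c * w\<close> on \<open>S\<close>, the element 1 gives \<open>c = 1\<close>, and
  \<open>M\<close> would divide \<open>a - 1\<close>.\<close>

lemma bound_plus_one:
  assumes a: "good a N" and h: "h > 0" "M dvd (a - 1) * h" "a \<ge> 1" and nt: "\<not> M dvd a - 1"
  shows "finite S \<and> card S \<le> h * 2"
proof (cases "finite S \<and> card S \<le> 2")
  case True
  then show ?thesis using h by (metis le_trans mult_le_mono1 nat_mult_1 Suc_leI One_nat_def)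
next
  case False
  obtain \<alpha> \<beta> \<gamma> \<delta> where m: "\<alpha> * \<delta> \<noteq> \<beta> * \<gamma>" "\<And>w. w \<in> S \<Longrightarrow> w ^ a * (\<gamma> * w + \<delta>) = \<alpha> * w + \<beta>"
    using good_moebius[OF a False] by metis
  define f where "f c = [:- \<beta>, c * \<delta> - \<alpha>, c * \<gamma>:]" for c
  have pf: "poly (f c) x = c * x * (\<gamma> * x + \<delta>) - (\<alpha> * x + \<beta>)" for c x
    by (simp add: f_def algebra_simps)
  show ?thesis
  proof (rule card_union_of_roots[OF h(1), of S f])
    fix w assume w: "w \<in> S"
    have "w ^ a = w ^ (a - 1) * w" using h(3) by (simp add: power_add[symmetric] power_Suc2[symmetric] del: power_Suc)
    then have "poly (f (w ^ (a - 1))) w = 0" unfolding pf using m(2)[OF w] by simp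
    moreover have "(w ^ (a - 1)) ^ h = 1" using S_root[OF w h(2)] by (simp add: power_mult)
    ultimately show "\<exists>c. c ^ h = 1 \<and> poly (f c) w = 0" by blast
  next
    fix c :: complex assume "c ^ h = 1"
    then have c: "c \<noteq> 0" using h(1) by (auto simp: zero_power)
    have "f c \<noteq> 0"
    proof
      assume "f c = 0"
      then have z: "\<beta> = 0" "c * \<delta> = \<alpha>" "\<gamma> = 0" using c by (auto simp: f_def)
      then have \<delta>: "\<delta> \<noteq> 0" using m(1) by auto
      have wa: "w ^ a = c * w" if "w \<in> S" for w
      proof -
        have "w ^ a * \<delta> = (c * w) * \<delta>" using m(2)[OF that] z by (simp add: mult_ac)
        then show ?thesis using \<delta> by simp
      qed
      have "c = 1" using wa[OF one] by simp
      have "w ^ (a - 1) = 1" if "w \<in> S" for w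
      proof -
        have "w \<noteq> 0" using S_root[OF that dvd_refl] M by (auto simp: zero_power)
        moreover have "w ^ (a - 1) * w = 1 * w"
          using wa[OF that] \<open>c = 1\<close> h(3) by (metis One_nat_def Suc_pred power_Suc2 less_eq_Suc_le)
        ultimately show ?thesis by simp
      qed
      then show False using nt exponent by blast
    qed
    then show "f c \<noteq> 0 \<and> Polynomial.degree (f c) \<le> 2"
      by (auto simp: f_def intro: order_trans[OF degree_pCons_le])
  qed
qed

text \<open>The polynomial vanishes identically only if \<open>w ^ (a + 1)\<close> is constant on
  \<open>S\<close>, hence 1, which \<open>nt\<close> excludes.\<close>

lemma bound_minus_one:
  assumes a: "good a N" and h: "h > 0" "M dvd (a + 1) * h" and nt: "\<not> M dvd a + 1"
  shows "finite S \<and> card S \<le> h * 2"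
proof (cases "finite S \<and> card S \<le> 2")
  case True
  then show ?thesis using h by (metis le_trans mult_le_mono1 nat_mult_1 Suc_leI One_nat_def)
next
  case False
  obtain \<alpha> \<beta> \<gamma> \<delta> where m: "\<alpha> * \<delta> \<noteq> \<beta> * \<gamma>" "\<And>w. w \<in> S \<Longrightarrow> w ^ a * (\<gamma> * w + \<delta>) = \<alpha> * w + \<beta>"
    using good_moebius[OF a False] by metis
  define f where "f c = [:- (c * \<delta>), \<beta> - c * \<gamma>, \<alpha>:]" for c
  have pf: "poly (f c) x = x * (\<alpha> * x + \<beta>) - c * (\<gamma> * x + \<delta>)" for c x
    by (simp add: f_def algebra_simps)
  show ?thesis
  proof (rule card_union_of_roots[OF h(1), of S f])
    fix w assume w: "w \<in> S"
    have "w * (\<alpha> * w + \<beta>) = w ^ (a + 1) * (\<gamma> * w + \<delta>)" using m(2)[OF w] by (simp add: mult_ac)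
    then have "poly (f (w ^ (a + 1))) w = 0" unfolding pf by simp
    moreover have "(w ^ (a + 1)) ^ h = 1" using S_root[OF w h(2)] by (simp only: power_mult)
    ultimately show "\<exists>c. c ^ h = 1 \<and> poly (f c) w = 0" by blast
  next
    fix c :: complex assume "c ^ h = 1"
    then have c: "c \<noteq> 0" using h(1) by (auto simp: zero_power)
    have "f c \<noteq> 0"
    proof
      assume "f c = 0"
      then have z: "\<delta> = 0" "\<beta> = c * \<gamma>" "\<alpha> = 0" using c by (auto simp: f_def)
      then have \<gamma>: "\<gamma> \<noteq> 0" using m(1) by auto
      have wa: "w ^ (a + 1) = c" if "w \<in> S" for w
      proof -
        have "w ^ (a + 1) * \<gamma> = c * \<gamma>" using m(2)[OF that] z by (simp add: mult_ac)
        then show ?thesis using \<gamma> by simp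
      qed
      have "c = 1" using wa[OF one] by simp
      then show False using nt exponent wa by blast
    qed
    then show "f c \<noteq> 0 \<and> Polynomial.degree (f c) \<le> 2"
      by (auto simp: f_def intro: order_trans[OF degree_pCons_le])
  qed
qed

end

section \<open>Choosing exponents for the conjugation\<close>

lemma prime_power_part:
  fixes p M :: nat
  assumes p: "Factorial_Ring.prime p" and "\<not> p ^ Suc k dvd M"
  shows "\<exists>q. \<not> p dvd q \<and> M dvd p ^ k * q \<and> q dvd M"
  using assms(2)
proof (induction k arbitrary: M)
  case 0
  then show ?case by (intro exI[of _ M]) auto
next
  case (Suc k)
  show ?case
  proof (cases "p dvd M")
    case True
    then obtain M' where M': "M = p * M'" by blast
    have "\<not> p ^ Suc k dvd M'" using Suc.prems M' by auto
    from Suc.IH[OF this] obtain q where q: "\<not> p dvd q" "M' dvd p ^ k * q" "q dvd M'" by blast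
    have "p * M' dvd p * (p ^ k * q)" using q(2) by (rule mult_dvd_mono[OF dvd_refl])
    then have "M dvd p ^ Suc k * q" unfolding M' by (simp add: mult.assoc)
    moreover have "q dvd M" unfolding M' using q(3) by simp
    ultimately show ?thesis using q(1) by blast
  next
    case False
    then show ?thesis by (intro exI[of _ M]) auto
  qed
qed

lemma mod_eq_1I: "a = 1 + m * j \<Longrightarrow> 1 < m \<Longrightarrow> a mod m = (1::nat)"
  by (simp only: mod_mult_self2 mod_less)

lemma one_plus_mod: "n dvd x \<Longrightarrow> (1 + x) mod n = 1 mod (n::nat)"
  by (elim dvdE) (simp only: mod_mult_self2)

lemma coprime_add_mult:
  fixes e q :: nat assumes "coprime e q" shows "coprime (e + k * q) q"
proof (rule coprimeI)
  fix c assume c: "c dvd e + k * q" "c dvd q"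
  then have "c dvd e" by (simp add: dvd_add_left_iff)
  then show "is_unit c" using c(2) assms coprime_common_divisor by blast
qed

lemma coprime_of_add_eq_mult:
  fixes a e q :: nat assumes "a + e = k * q" "coprime e q" shows "coprime a q"
proof (rule coprimeI)
  fix c assume c: "c dvd a" "c dvd q"
  then have "c dvd a + e" using assms(1) by simp
  then have "c dvd e" using c(1) by (simp add: dvd_add_right_iff)
  then show "is_unit c" using c(2) assms(2) coprime_common_divisor by blast
qed

lemma coprime_Suc_self: "coprime (1 + h) (h::nat)"
  using coprime_Suc_left_nat[of h] by simp

lemma odd_square_eq: "odd q \<Longrightarrow> \<exists>k. q * q = 8 * k + (1::nat)"
proof -
  assume "odd q"
  then have "q mod 8 = 1 \<or> q mod 8 = 3 \<or> q mod 8 = 5 \<or> q mod 8 = 7" by presburger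
  then have "q * q mod 8 = 1" using mod_mult_eq[of q 8 q, symmetric] by auto
  then show ?thesis using mult_div_mod_eq[of 8 "q * q"] by metis
qed

lemma square_eq_mod_12:
  assumes "odd q" "\<not> 3 dvd q" shows "\<exists>k. q * q = 12 * k + (1::nat)"
proof -
  have "q mod 12 = 1 \<or> q mod 12 = 5 \<or> q mod 12 = 7 \<or> q mod 12 = 11" using assms by presburger
  then have "q * q mod 12 = 1" using mod_mult_eq[of q 12 q, symmetric] by auto
  then show ?thesis using mult_div_mod_eq[of 12 "q * q"] by metis
qed

lemma not_dvd_mult_right: "t > 0 \<Longrightarrow> \<not> a dvd b \<Longrightarrow> \<not> a * t dvd b * (t::nat)"
  by simp

lemma coprime_odd_4: "odd a \<Longrightarrow> coprime (a::nat) 4"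
  using coprime_power_right_iff[of a 2 2] by simp

lemma coprime_odd_8: "odd a \<Longrightarrow> coprime (a::nat) 8"
  using coprime_power_right_iff[of a 2 3] by simp

lemma coprime_12: "odd a \<Longrightarrow> \<not> 3 dvd a \<Longrightarrow> coprime (a::nat) 12"
proof -
  assume a: "odd a" "\<not> 3 dvd a"
  have "coprime 3 a" using a(2) by (intro prime_imp_coprime) auto
  then have "coprime a (4 * 3)" using coprime_odd_4[OF a(1)] by (simp only: coprime_mult_right_iff coprime_commute simp_thms)
  then show ?thesis by simp
qed

context cyclotomic_cross_ratios begin

lemma goodI:
  assumes "N > 0" "M dvd N" "n dvd N" "coprime a N" "a mod n = 1 mod n"
  shows "good a N"
  using assms by (simp add: good_def cong_def)

text \<open>The exponent \<open>1 + x\<close> negates a primitive \<open>N\<close>-th root of unity,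
  so \<open>w ^ a\<close> is \<open>w\<close> or \<open>- w\<close> on \<open>S\<close>: this is
  \<open>bound_plus_one\<close> with \<open>h = 2\<close>.\<close>

lemma half_step:
  assumes N: "N = 2 * x" "even x" "M dvd N" "n dvd x" and nt: "\<not> M dvd x" "N > 0"
  shows "finite S \<and> card S \<le> 4"
proof -
  have "coprime (1 + x) (2 * x)"
    using coprime_Suc_self[of x] assms(2) by (simp only: coprime_mult_right_iff) simp
  moreover have "(1 + x) mod n = 1 mod n" using N(4) by (rule one_plus_mod)
  ultimately have "good (1 + x) N" using N nt by (intro goodI) (auto intro: dvd_mult)
  from bound_plus_one[OF this, of 2] N nt show ?thesis by (simp add: mult.commute)
qed

lemma bound_3:
  assumes "n = 3" shows "finite S \<and> card S \<le> 6"
proof (cases "4 dvd M")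
  case True
  then obtain t where t: "M = 4 * t" by blast
  have "\<not> M dvd 6 * t" unfolding t by (rule not_dvd_mult_right) (use t M in auto)
  then have "finite S \<and> card S \<le> 4"
    using half_step[of "12 * t" "6 * t"] t M assms by simp
  then show ?thesis by simp
next
  case False
  then have "\<not> 2 ^ Suc 1 dvd M" by simp
  from prime_power_part[OF _ this] obtain q where q: "odd q" "M dvd 2 * q" by auto
  \<comment> \<open>Since -2 is 1 modulo 3, \<open>a\<close> can be -2 modulo the whole odd part,
    even if 3 divides it; then \<open>w ^ (a + 2)\<close> is 1 or -1.\<close>
  define a where "a = 9 * q - 2"
  have q0: "q > 0" using q(1) by (cases q) auto
  have a2: "a + 2 = 9 * q" using q0 by (simp add: a_def)
  have "odd a" using q(1) a2 by presburger
  moreover have "coprime a (3 * q)" by (rule coprime_of_add_eq_mult[of a 2 3]) (use a2 q(1) in auto)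
  ultimately have "coprime a (2 * (3 * q))" by (simp only: coprime_mult_right_iff) simp
  moreover have "a mod 3 = 1" using a2 by presburger
  ultimately have "good a (2 * (3 * q))" using q q0 assms by (intro goodI) (auto intro: dvd_trans)
  moreover have "M dvd (a + 2) * 2" unfolding a2 using dvd_mult2[OF q(2), of 9] by (simp add: mult_ac)
  ultimately show ?thesis using bound_neg[of a "2 * (3 * q)" 2 2] by simp
qed

lemma bound_4:
  assumes "n = 4" shows "finite S \<and> card S \<le> 6"
proof -
  consider "8 dvd M" | "4 dvd M" "\<not> 8 dvd M" | "\<not> 4 dvd M" by blast
  then show ?thesis
  proof cases
    case 1
    then obtain t where t: "M = 8 * t" by blast
    have "\<not> M dvd 4 * t" unfolding t by (rule not_dvd_mult_right) (use t M in auto)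
    then have "finite S \<and> card S \<le> 4"
      using half_step[of "8 * t" "4 * t"] t M assms by simp
    then show ?thesis by simp
  next
    case 2
    then have "\<not> 2 ^ Suc 2 dvd M" by simp
    from prime_power_part[OF _ this] obtain q where q: "odd q" "M dvd 4 * q" by auto
    \<comment> \<open>For odd \<open>q\<close>, \<open>2 * q\<close> is 2 modulo 4, so this is -1
      modulo \<open>q\<close> and 1 modulo 4.\<close>
    define a where "a = 2 * q - 1"
    have q0: "q > 0" using q(1) by (cases q) auto
    have a1: "a + 1 = 2 * q" using q0 by (simp add: a_def)
    have "odd a" using a1 by presburger
    moreover have "coprime a q" by (rule coprime_of_add_eq_mult[of a 1 2]) (use a1 in auto)
    ultimately have "coprime a (4 * q)" using coprime_odd_4[of a] by (simp only: coprime_mult_right_iff simp_thms)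
    moreover have "a mod 4 = 1" using a1 q(1) by presburger
    ultimately have g: "good a (4 * q)" using q q0 assms by (intro goodI) auto
    have "\<not> 4 dvd 2 * q" using q(1) by presburger
    then have "\<not> M dvd a + 1" using 2(1) a1 dvd_trans by metis
    moreover have "M dvd (a + 1) * 2" unfolding a1 using q(2) by simp
    ultimately show ?thesis using bound_minus_one[OF g, of 2] by simp
  next
    case 3
    then have "\<not> 2 ^ Suc 1 dvd M" by simp
    from prime_power_part[OF _ this] obtain q where q: "odd q" "M dvd 2 * q" by auto
    have q0: "q > 0" using q(1) by (cases q) auto
    \<comment> \<open>\<open>q * q\<close> is 1 modulo 8, so \<open>a\<close> is 5 and hence 1
      modulo 4, while it is 2 modulo \<open>q\<close>.\<close>
    define a where "a = 2 + (3 * q) * q"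
    have "odd a" using q(1) by (simp add: a_def)
    moreover have "coprime a q" unfolding a_def by (rule coprime_add_mult) (use q(1) in simp)
    ultimately have "coprime a (4 * q)" using coprime_odd_4[of a] by (simp only: coprime_mult_right_iff simp_thms)
    moreover obtain k where "q * q = 8 * k + 1" using odd_square_eq[OF q(1)] by blast
    then have "a = 1 + 4 * (6 * k + 1)" by (simp add: a_def mult.assoc)
    then have "a mod 4 = 1" by (rule mod_eq_1I) simp
    ultimately have g: "good a (4 * q)" using q q0 assms by (intro goodI) (auto intro: dvd_trans)
    have "M dvd (a - 2) * 2" using dvd_mult2[OF q(2), of "3 * q"] by (simp add: a_def mult_ac)
    from bound_pos[OF g, of 2 2, OF _ _ _ this] show ?thesis by (simp add: a_def)
  qed
qed

lemma bound_5:
  assumes "n = 5" shows "finite S \<and> card S \<le> 10"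
proof (cases "4 dvd M")
  case True
  then obtain t where t: "M = 4 * t" by blast
  have "\<not> M dvd 10 * t" unfolding t by (rule not_dvd_mult_right) (use t M in auto)
  then have "finite S \<and> card S \<le> 4"
    using half_step[of "20 * t" "10 * t"] t M assms by simp
  then show ?thesis by simp
next
  case False
  then have "\<not> 2 ^ Suc 1 dvd M" by simp
  from prime_power_part[OF _ this] obtain q where q: "odd q" "M dvd 2 * q" by auto
  \<comment> \<open>As for 3, now with -4 being 1 modulo 5; this is where \<open>e = 4\<close> and
    the bound 10 come from.\<close>
  define a where "a = 25 * q - 4"
  have q0: "q > 0" using q(1) by (cases q) auto
  have a4: "a + 4 = 25 * q" using q0 by (simp add: a_def)
  have "odd (a + 4)" unfolding a4 using q(1) by simp
  then have "odd a" by simp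
  moreover have "coprime a (5 * q)"
    by (rule coprime_of_add_eq_mult[of a 4 5]) (use a4 q(1) coprime_odd_4[of "5 * q"] in \<open>auto simp: coprime_commute\<close>)
  ultimately have "coprime a (2 * (5 * q))" by (simp only: coprime_mult_right_iff) simp
  moreover have "a = 1 + 5 * (5 * q - 1)" using q0 by (simp add: a_def algebra_simps)
  then have "a mod 5 = 1" by (rule mod_eq_1I) simp
  ultimately have "good a (2 * (5 * q))" using q q0 assms by (intro goodI) (auto intro: dvd_trans)
  moreover have "M dvd (a + 4) * 2" unfolding a4 using dvd_mult2[OF q(2), of 25] by (simp add: mult_ac)
  ultimately show ?thesis using bound_neg[of a "2 * (5 * q)" 4 2] by simp
qed

lemma bound_8:
  assumes "n = 8" shows "finite S \<and> card S \<le> 8"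
proof (cases "16 dvd M")
  case True
  then obtain t where t: "M = 16 * t" by blast
  have "\<not> M dvd 8 * t" unfolding t by (rule not_dvd_mult_right) (use t M in auto)
  then have "finite S \<and> card S \<le> 4"
    using half_step[of "16 * t" "8 * t"] t M assms by simp
  then show ?thesis by simp
next
  case False
  then have "\<not> 2 ^ Suc 3 dvd M" by simp
  from prime_power_part[OF _ this] obtain q where q: "odd q" "M dvd 8 * q" by auto
  have q0: "q > 0" using q(1) by (cases q) auto
  obtain k where k: "q * q = 8 * k + 1" using odd_square_eq[OF q(1)] by blast
  show ?thesis
  proof (cases "M dvd 2 * (q * q)")
    case False
    \<comment> \<open>This is -1 modulo \<open>q\<close>, and 1 modulo 8 because
      \<open>q * q\<close> is. The case assumption is exactly that \<open>M\<close> does not divide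
      \<open>a + 1\<close>.\<close>
    define a where "a = 2 * (q * q) - 1"
    have a1: "a + 1 = 2 * (q * q)" using q0 by (simp add: a_def)
    then have a1': "a + 1 = (2 * q) * q" by simp
    have "odd a" using a1 by presburger
    moreover have "coprime a q" by (rule coprime_of_add_eq_mult[OF a1']) simp
    ultimately have "coprime a (8 * q)" using coprime_odd_8[of a] by (simp only: coprime_mult_right_iff simp_thms)
    moreover have "a = 1 + 8 * (2 * k)" using a1 k by simp
    then have "a mod 8 = 1" by (rule mod_eq_1I) simp
    ultimately have g: "good a (8 * q)" using q q0 assms by (intro goodI) auto
    have "M dvd (a + 1) * 4" unfolding a1 using dvd_mult2[OF q(2), of q] by (simp add: mult_ac)
    moreover have "\<not> M dvd a + 1" unfolding a1 by (rule False)
    ultimately show ?thesis using bound_minus_one[OF g, of 4] by simp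
  next
    case True
    \<comment> \<open>In the exceptional case \<open>M\<close> has at most one factor 2, so
      \<open>h = 2\<close> suffices for \<open>e = 2\<close>; modulo 8 this is 2 + 7, hence
      1.\<close>
    define a where "a = 2 + (7 * q) * q"
    have "odd a" using q(1) by (simp add: a_def)
    moreover have "coprime a q" unfolding a_def by (rule coprime_add_mult) (use q(1) in simp)
    ultimately have "coprime a (8 * q)" using coprime_odd_8[of a] by (simp only: coprime_mult_right_iff simp_thms)
    moreover have "a = 1 + 8 * (7 * k + 1)" using k by (simp add: a_def mult.assoc)
    then have "a mod 8 = 1" by (rule mod_eq_1I) simp
    ultimately have g: "good a (8 * q)" using q q0 assms by (intro goodI) auto
    have "M dvd (a - 2) * 2" using dvd_mult2[OF True, of 7] by (simp add: a_def mult_ac)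
    from bound_pos[OF g, of 2 2, OF _ _ _ this] show ?thesis by (simp add: a_def)
  qed
qed

lemma bound_12:
  assumes "n = 12" shows "finite S \<and> card S \<le> 12"
proof -
  consider "8 dvd M" | "9 dvd M" | "\<not> 8 dvd M" "\<not> 9 dvd M" by blast
  then show ?thesis
  proof cases
    case 1
    then obtain t where t: "M = 8 * t" by blast
    have "\<not> M dvd 12 * t" unfolding t by (rule not_dvd_mult_right) (use t M in auto)
    then have "finite S \<and> card S \<le> 4"
      using half_step[of "24 * t" "12 * t"] t M assms by simp
    then show ?thesis by simp
  next
    case 2
    then obtain t where t: "M = 9 * t" by blast
    \<comment> \<open>The exponent \<open>1 + 12 * t\<close> multiplies a primitive root of unity of
      order \<open>36 * t\<close> by a cube root of unity, hence \<open>h = 3\<close>.\<close>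
    have "\<not> 3 dvd 1 + 12 * t" by presburger
    then have "coprime 3 (1 + 12 * t)" by (intro prime_imp_coprime) auto
    then have "coprime (1 + 12 * t) (3 * (12 * t))"
      using coprime_Suc_self[of "12 * t"] by (simp only: coprime_mult_right_iff coprime_commute simp_thms)
    moreover have "(1 + 12 * t) mod 12 = 1" by presburger
    ultimately have g: "good (1 + 12 * t) (3 * (12 * t))"
      using t M assms by (intro goodI) auto
    have "\<not> M dvd 12 * t" unfolding t by (rule not_dvd_mult_right) (use t M in auto)
    then have "\<not> M dvd (1 + 12 * t) - 1" by simp
    moreover have "M dvd ((1 + 12 * t) - 1) * 3" using t by (simp add: dvd_def)
    ultimately show ?thesis using bound_plus_one[OF g, of 3] by simp
  next
    case 3
    then have "\<not> 3 ^ Suc 1 dvd M" by simp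
    from prime_power_part[OF _ this] obtain q1 where q1: "\<not> 3 dvd q1" "M dvd 3 * q1" "q1 dvd M" by auto
    have "\<not> 2 ^ Suc 2 dvd q1" using 3(1) q1(3) dvd_trans by auto
    from prime_power_part[OF _ this] obtain q where q: "odd q" "q1 dvd 4 * q" "q dvd q1" by auto
    have q3: "\<not> 3 dvd q" using q1(1) q(3) dvd_trans by blast
    have "3 * q1 dvd 3 * (4 * q)" using q(2) by (rule mult_dvd_mono[OF dvd_refl])
    with q1(2) have "M dvd 3 * (4 * q)" by (rule dvd_trans)
    then have Mq: "M dvd 12 * q" by simp
    have q0: "q > 0" using q(1) by (cases q) auto
    obtain k where k: "q * q = 12 * k + 1" using square_eq_mod_12[OF q(1) q3] by blast
    show ?thesis
    proof (cases "M dvd 2 * (q * q)")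
      case False
      \<comment> \<open>Squares of numbers prime to 6 are 1 modulo 12, so this is 1 modulo 12 and -1
        modulo \<open>q\<close>; the quotient 6 of 12 by 2 becomes \<open>h\<close>.\<close>
      define a where "a = 2 * (q * q) - 1"
      have a1: "a + 1 = 2 * (q * q)" using q0 by (simp add: a_def)
      then have a1': "a + 1 = (2 * q) * q" by simp
      have "a = 1 + 12 * (2 * k)" using a1 k by simp
      then have am: "a mod 12 = 1" by (rule mod_eq_1I) simp
      then have "odd a" "\<not> 3 dvd a" by presburger+
      moreover have "coprime a q" by (rule coprime_of_add_eq_mult[OF a1']) simp
      ultimately have "coprime a (12 * q)" using coprime_12[of a] by (simp only: coprime_mult_right_iff simp_thms)
      then have g: "good a (12 * q)" using Mq q0 assms am by (intro goodI) auto
      have "M dvd (a + 1) * 6" unfolding a1 using dvd_mult2[OF Mq, of q] by (simp add: mult_ac)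
      moreover have "\<not> M dvd a + 1" unfolding a1 by (rule False)
      ultimately show ?thesis using bound_minus_one[OF g, of 6] by simp
    next
      case True
      define a where "a = 2 + (11 * q) * q"
      have "a = 1 + 12 * (11 * k + 1)" using k by (simp add: a_def mult.assoc)
      then have am: "a mod 12 = 1" by (rule mod_eq_1I) simp
      then have "odd a" "\<not> 3 dvd a" by presburger+
      moreover have "coprime a q" unfolding a_def by (rule coprime_add_mult) (use q(1) in simp)
      ultimately have "coprime a (12 * q)" using coprime_12[of a] by (simp only: coprime_mult_right_iff simp_thms)
      then have g: "good a (12 * q)" using Mq q0 assms am by (intro goodI) auto
      have "M dvd (a - 2) * 2" using dvd_mult2[OF True, of 11] by (simp add: a_def mult_ac)
      from bound_pos[OF g, of 2 2, OF _ _ _ this] show ?thesis by (simp add: a_def)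
    qed
  qed
qed

text \<open>If a prime \<open>p\<close> dividing \<open>n\<close> can be split off \<open>N\<close>,
  the exponent \<open>1 + N / p\<close> multiplies a primitive \<open>N\<close>-th root by a
  \<open>p\<close>-th root of unity. Otherwise \<open>n\<close> and \<open>N / n\<close> are
  coprime, and an exponent that is 1 modulo \<open>n\<close> and 2 modulo \<open>N / n\<close> gives
  \<open>h = n\<close> and \<open>e = 2\<close>. Evenness of \<open>n\<close> makes
  \<open>N / n\<close> odd, so that 2 is invertible there.\<close>

lemma bound_even:
  assumes "even n" shows "finite S \<and> card S \<le> 3 * n"
proof -
  define N where "N = lcm M n"
  have N: "N > 0" "M dvd N" "n dvd N" using M n by (auto simp: N_def lcm_pos_nat)
  show ?thesis
  proof (cases "\<exists>p x. Factorial_Ring.prime p \<and> p dvd n \<and> N = p * x \<and> n dvd x")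
    case True
    then obtain p x where p: "Factorial_Ring.prime p" "p dvd n" "N = p * x" "n dvd x" by blast
    have p2: "p \<ge> 2" using p(1) prime_ge_2_nat by blast
    have x0: "x > 0" using N(1) p(3) by (cases x) auto
    obtain y where y: "x = y * p" using dvd_trans[OF p(2,4)] by (auto simp: dvd_def mult.commute)
    have "coprime (1 + x) p" unfolding y by (rule coprime_add_mult) simp
    then have "coprime (1 + x) N" unfolding p(3) using coprime_Suc_self[of x] by (simp only: coprime_mult_right_iff simp_thms)
    moreover have "(1 + x) mod n = 1 mod n" using p(4) by (rule one_plus_mod)
    ultimately have g: "good (1 + x) N" using N by (intro goodI)
    have "\<not> M dvd x"
    proof
      assume "M dvd x"
      then have "N dvd x" unfolding N_def using p(4) by (rule lcm_least)
      then have "N \<le> x" using x0 by (rule dvd_imp_le)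
      then show False using p(3) p2 x0 by simp
    qed
    then have "finite S \<and> card S \<le> p * 2"
      using bound_plus_one[OF g, of p] N(2) p(3) p2 by (simp add: mult.commute)
    moreover have "p \<le> n" using p(2) n by (intro dvd_imp_le) auto
    ultimately show ?thesis by simp
  next
    case False
    obtain k where k: "N = n * k" using N(3) by blast
    have cop: "coprime n k"
    proof (rule ccontr)
      assume "\<not> coprime n k"
      then obtain p where p: "Factorial_Ring.prime p" "p dvd n" "p dvd k"
      proof -
        obtain c where c: "c dvd n" "c dvd k" "\<not> is_unit c" using \<open>\<not> coprime n k\<close> by (rule not_coprimeE)
        then obtain p where p: "Factorial_Ring.prime p" "p dvd c" using prime_factor_nat[of c] by auto
        show thesis by (rule that[OF p(1) dvd_trans[OF p(2) c(1)] dvd_trans[OF p(2) c(2)]])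
      qed
      then obtain k' where "k = p * k'" by blast
      then have "N = p * (n * k')" using k by simp
      moreover have "n dvd n * k'" by simp
      ultimately show False using False p by blast
    qed
    have k2: "coprime 2 k" by (rule coprime_divisors[OF assms dvd_refl cop])
    obtain x where x: "[x = 1] (mod n)" "[x = 2] (mod k)"
      using binary_chinese_remainder_nat[OF cop, of 1 2] by blast
    \<comment> \<open>The multiple of \<open>N\<close> ensures \<open>a \<ge> 2\<close> and keeps
      both congruences.\<close>
    define a where "a = x + 2 * N"
    have a1: "a = x + n * (2 * k)" and a2: "a = x + k * (2 * n)" by (simp_all add: a_def k)
    have "a mod n = x mod n" unfolding a1 by (rule mod_mult_self2)
    moreover have "a mod k = x mod k" unfolding a2 by (rule mod_mult_self2)
    ultimately have an: "[a = 1] (mod n)" and ak: "[a = 2] (mod k)" using x by (simp_all only: cong_def)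
    have a2: "a \<ge> 2" using N(1) by (simp add: a_def)
    have "coprime a n" using cong_imp_coprime[OF cong_sym[OF an]] by simp
    moreover have "coprime a k" using cong_imp_coprime[OF cong_sym[OF ak] k2] .
    ultimately have "coprime a N" unfolding k by (simp only: coprime_mult_right_iff simp_thms)
    then have g: "good a N" using N an by (simp add: good_def)
    have "k dvd a - 2" using ak a2 by (simp add: cong_altdef_nat)
    then have "n * k dvd (a - 2) * n" by (simp add: mult.commute)
    then have "M dvd (a - 2) * n" using N(2) unfolding k by (rule dvd_trans[rotated])
    from bound_pos[OF g _ a2 n this] show ?thesis by (simp add: mult.commute)
  qed
qed

end

lemma exponent_exists:
  assumes "N > 0" "\<And>w. w \<in> S \<Longrightarrow> w ^ N = (1::complex)"
  shows "\<exists>M>0. \<forall>k. (\<forall>w\<in>S. w ^ k = 1) \<longleftrightarrow> M dvd k"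
proof -
  define P where "P m \<longleftrightarrow> m > 0 \<and> (\<forall>w\<in>S. w ^ m = 1)" for m :: nat
  define M where "M = (LEAST m. P m)"
  have "P N" using assms by (simp add: P_def)
  then have M: "P M" "\<And>m. P m \<Longrightarrow> M \<le> m" unfolding M_def by (auto intro: LeastI Least_le)
  have "(\<forall>w\<in>S. w ^ k = 1) \<longleftrightarrow> M dvd k" for k
  proof
    assume h: "\<forall>w\<in>S. w ^ k = 1"
    have "w ^ (k mod M) = 1" if "w \<in> S" for w
      using root_power_mod[of w M k] M(1) h that by (simp add: P_def)
    then have "\<not> k mod M > 0" using M(2)[of "k mod M"] M(1) unfolding P_def by (metis mod_less_divisor not_less)
    then show "M dvd k" by auto
  next
    assume "M dvd k"
    then obtain j where "k = M * j" by blast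
    then show "\<forall>w\<in>S. w ^ k = 1" using M(1) by (simp add: P_def power_mult)
  qed
  then show ?thesis using M(1) unfolding P_def by blast
qed

lemma cross_ratio_scale: "r \<noteq> 0 \<Longrightarrow> cross_ratio (a / r) (b / r) (c / r) (d / r) = cross_ratio a b c d"
  by (simp add: cross_ratio_def diff_divide_distrib[symmetric])

text \<open>The value \<open>6 n\<close> is the bound \<open>3 m\<close> for even \<open>m\<close>, taken at \<open>m = 2 n\<close> if \<open>n\<close> is odd.\<close>

definition direction_bound :: "nat \<Rightarrow> nat" where
  "direction_bound n = (if n = 3 \<or> n = 4 then 6 else if n = 5 then 10 else if n = 8 then 8 else if n = 12 then 12 else 6 * n)"

lemma cross_ratios_in_mono: "cross_ratios_in S F \<Longrightarrow> F \<subseteq> G \<Longrightarrow> cross_ratios_in S G"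
  unfolding cross_ratios_in_def by blast

text \<open>Dividing by one element puts 1 into the set and keeps all cross ratios.\<close>

lemma roots_of_unity_card_bound:
  assumes n: "n > 0" and S: "N > 0" "\<And>w. w \<in> S \<Longrightarrow> w ^ N = 1" "S \<noteq> {}"
    and cr: "cross_ratios_in S (cyc_field n)"
  shows "finite S \<and> card S \<le> direction_bound n"
proof -
  obtain w0 where w0: "w0 \<in> S" using S(3) by blast
  have w00: "w0 \<noteq> 0" using S(1) S(2)[OF w0] by (auto simp: zero_power)
  define T where "T = (\<lambda>w. w / w0) ` S"
  have inj: "inj_on (\<lambda>w. w / w0) S" using w00 by (auto intro: inj_onI)
  have cT: "card T = card S" "finite T \<longleftrightarrow> finite S" unfolding T_def using inj by (auto simp: card_image finite_image_iff)
  have one: "1 \<in> T" using w0 w00 by (force simp: T_def)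
  have TN: "w ^ N = 1" if "w \<in> T" for w
    using that S(2) w0 by (auto simp: T_def power_divide)
  have crT: "cross_ratios_in T (cyc_field n)"
    unfolding cross_ratios_in_def T_def
  proof (intro ballI impI, elim imageE)
    fix a b c d a' b' c' d' assume h: "distinct [a, b, c, d]" "a = a' / w0" "b = b' / w0" "c = c' / w0" "d = d' / w0"
      "a' \<in> S" "b' \<in> S" "c' \<in> S" "d' \<in> S"
    have "distinct [a', b', c', d']" using h(1) unfolding h(2-5) by auto
    then have "cross_ratio a' b' c' d' \<in> cyc_field n" using cr h(6-9) unfolding cross_ratios_in_def by blast
    then show "cross_ratio a b c d \<in> cyc_field n" unfolding h(2-5) cross_ratio_scale[OF w00] .
  qed
  obtain M where M: "M > 0" "\<And>k. (\<forall>w\<in>T. w ^ k = 1) \<longleftrightarrow> M dvd k" using exponent_exists[OF S(1) TN] by blast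
  have loc: "cyclotomic_cross_ratios n T M" using n one crT M by (intro cyclotomic_cross_ratios.intro)
  have "cyc_field n \<subseteq> cyc_field (2 * n)" using n by (intro cyc_field_mono) auto
  then have loc2: "cyclotomic_cross_ratios (2 * n) T M"
    using n one cross_ratios_in_mono[OF crT] M by (intro cyclotomic_cross_ratios.intro) auto
  have "finite T \<and> card T \<le> 3 * (2 * n)" by (rule cyclotomic_cross_ratios.bound_even[OF loc2]) simp
  moreover have "finite T \<and> card T \<le> direction_bound n" if "n \<in> {3,4,5,8,12}"
    using that cyclotomic_cross_ratios.bound_3[OF loc] cyclotomic_cross_ratios.bound_4[OF loc]
      cyclotomic_cross_ratios.bound_5[OF loc] cyclotomic_cross_ratios.bound_8[OF loc] cyclotomic_cross_ratios.bound_12[OF loc]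
    unfolding direction_bound_def by auto
  ultimately show ?thesis unfolding cT by (auto simp: direction_bound_def split: if_splits)
qed

subsection \<open>The cross ratio 1/5\<close>

lemma ev_sum: "ev (sum f A) z = (\<Sum>i\<in>A. ev (f i) z)"
  by (induction A rule: infinite_finite_induct) auto

lemma weighted_geometric_sum:
  fixes e :: complex
  shows "(e - 1) * (\<Sum>j<n. of_nat j * e ^ j) = of_nat n * e ^ n - e * (\<Sum>j<n. e ^ j)"
  by (induction n) (auto simp: algebra_simps)

text \<open>For an \<open>N\<close>-th root of unity \<open>e \<noteq> 1\<close> the weighted geometric sum inverts \<open>e - 1\<close> up to the factor \<open>N\<close>.\<close>

lemma root_difference_inverse:
  fixes z :: complex
  assumes z: "z ^ N = 1" "N > 0" and ab: "z ^ a \<noteq> z ^ b"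
  obtains p where "(z ^ a - z ^ b) * ev p z = of_nat N"
proof
  \<comment> \<open>Chosen so that \<open>z ^ b'\<close> is the inverse of
    \<open>z ^ b\<close>.\<close>
  define b' where "b' = b * (N - 1)"
  have "b + b' = N * b" using z(2) by (cases N) (auto simp: b'_def)
  then have bb: "z ^ b * z ^ b' = 1" using z(1) by (metis power_add power_mult power_one)
  define e where "e = z ^ (a + b')"
  have e1: "e - 1 = (z ^ a - z ^ b) * z ^ b'" by (simp add: e_def power_add left_diff_distrib bb)
  have "z ^ b' \<noteq> 0" using bb by (metis mult_zero_right zero_neq_one)
  then have ne: "e \<noteq> 1" using e1 ab by auto
  have eN: "e ^ N = 1" unfolding e_def by (metis power_mult mult.commute power_one z(1))
  have "(e - 1) * (\<Sum>j<N. e ^ j) = e ^ N - 1" by (simp add: power_diff_1_eq)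
  then have s0: "(\<Sum>j<N. e ^ j) = 0" using ne eN by simp
  let ?p = "Polynomial.monom 1 b' * (\<Sum>j<N. Polynomial.monom (int j) ((a + b') * j))"
  have "ev ?p z = z ^ b' * (\<Sum>j<N. of_nat j * e ^ j)"
    by (simp only: ev_mult ev_sum ev_monom) (simp add: e_def power_mult)
  then have "(z ^ a - z ^ b) * ev ?p z = (e - 1) * (\<Sum>j<N. of_nat j * e ^ j)" by (simp only: e1 mult.assoc)
  also have "\<dots> = of_nat N" by (simp add: weighted_geometric_sum s0 eN)
  finally show "(z ^ a - z ^ b) * ev ?p z = of_nat N" .
qed

text \<open>The product \<open>A = (w1 - w4) (w2 - w3)\<close> is a sum of four roots of unity up to sign, so \<open>A ^ k\<close> grows
  like \<open>4 ^ k\<close> under every rational functional, whereas divisibility of \<open>A\<close> by \<open>5\<close> forces multiples of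
  \<open>5 ^ k\<close>, up to a fixed denominator. So the functional vanishes on the ideal of some \<open>A ^ k\<close>, but \<open>A\<close>
  divides \<open>N * N\<close>.\<close>

lemma cross_ratio_ne_fifth:
  fixes w1 w2 w3 w4 :: complex
  assumes N: "N > 0" and w: "w1 ^ N = 1" "w2 ^ N = 1" "w3 ^ N = 1" "w4 ^ N = 1"
    and ne: "w1 \<noteq> w4" "w2 \<noteq> w3"
  shows "(w1 - w4) * (w2 - w3) \<noteq> 5 * ((w1 - w3) * (w2 - w4))"
proof
  assume eq: "(w1 - w4) * (w2 - w3) = 5 * ((w1 - w3) * (w2 - w4))"
  define z where "z = zeta N"
  have z: "z ^ N = 1" unfolding z_def by (rule zeta_pow_self[OF N])
  obtain k1 where k1: "w1 = z ^ k1" unfolding z_def using root_of_unity_zeta_power[OF N w(1)] .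
  obtain k2 where k2: "w2 = z ^ k2" unfolding z_def using root_of_unity_zeta_power[OF N w(2)] .
  obtain k3 where k3: "w3 = z ^ k3" unfolding z_def using root_of_unity_zeta_power[OF N w(3)] .
  obtain k4 where k4: "w4 = z ^ k4" unfolding z_def using root_of_unity_zeta_power[OF N w(4)] .
  define A where "A = (w1 - w4) * (w2 - w3)"
  define D where "D = (Polynomial.monom 1 k1 - Polynomial.monom 1 k3) * (Polynomial.monom 1 k2 - Polynomial.monom 1 k4 :: int poly)"
  have AD: "A = of_int 5 * ev D z" using eq by (simp add: A_def D_def k1 k2 k3 k4)
  define B where "B = (\<Sum>j<N. \<bar>rat_functional (z ^ j)\<bar>)"
  have B: "\<bar>rat_functional (z ^ j)\<bar> \<le> B" for j
  proof -
    have "\<bar>rat_functional (z ^ (j mod N))\<bar> \<le> B" unfolding B_def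
      using N by (intro member_le_sum) auto
    then show ?thesis by (simp only: root_power_mod[OF z, of j, symmetric])
  qed
  \<comment> \<open>Each further factor \<open>A\<close> splits a term into four of the same
    shape.\<close>
  have bound: "\<bar>rat_functional (A ^ k * z ^ j)\<bar> \<le> 4 ^ k * B" for k j
  proof (induction k arbitrary: j)
    case 0
    show ?case using B by simp
  next
    case (Suc k)
    have "A ^ Suc k * z ^ j = A ^ k * z ^ (k1 + k2 + j) - A ^ k * z ^ (k1 + k3 + j)
        - A ^ k * z ^ (k4 + k2 + j) + A ^ k * z ^ (k4 + k3 + j)"
      unfolding power_Suc by (simp add: A_def k1 k2 k3 k4 power_add algebra_simps)
    then have "rat_functional (A ^ Suc k * z ^ j) = rat_functional (A ^ k * z ^ (k1 + k2 + j)) - rat_functional (A ^ k * z ^ (k1 + k3 + j))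
        - rat_functional (A ^ k * z ^ (k4 + k2 + j)) + rat_functional (A ^ k * z ^ (k4 + k3 + j))"
      by (simp only: rat_functional_add rat_functional_diff)
    then have "\<bar>rat_functional (A ^ Suc k * z ^ j)\<bar> \<le> 4 * (4 ^ k * B)"
      using Suc.IH[of "k1 + k2 + j"] Suc.IH[of "k1 + k3 + j"] Suc.IH[of "k4 + k2 + j"] Suc.IH[of "k4 + k3 + j"]
      by linarith
    then show ?case by simp
  qed
  obtain m :: int where m: "m > 0" "\<And>p. of_int m * rat_functional (ev p z) \<in> \<int>"
    using common_denominator[OF z N] by blast
  \<comment> \<open>For this \<open>k\<close> a nonzero value would be at least
    \<open>5 ^ k / m\<close> in modulus, which exceeds the bound \<open>4 ^ k * B\<close>.\<close>
  obtain k where k: "of_rat (of_int m * B) < (5 / 4 :: real) ^ k"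
    using real_arch_pow[of "5 / 4"] by auto
  have "of_rat (of_int m * B) < (of_rat ((5 / 4) ^ k) :: real)" using k by (simp add: of_rat_power of_rat_divide)
  then have "of_int m * B < (5 / 4) ^ k" by (simp only: of_rat_less)
  then have k': "of_int m * (4 ^ k * B) < 5 ^ k" by (simp add: power_divide field_simps)
  have zero: "rat_functional (A ^ k * z ^ j) = 0" for j
  proof (rule ccontr)
    assume nz: "rat_functional (A ^ k * z ^ j) \<noteq> 0"
    have "A ^ k * z ^ j = of_int (5 ^ k) * ev (D ^ k * Polynomial.monom 1 j) z"
      unfolding AD power_mult_distrib by simp
    then have e: "rat_functional (A ^ k * z ^ j) = of_int (5 ^ k) * rat_functional (ev (D ^ k * Polynomial.monom 1 j) z)"
      by (simp only: rat_functional_int)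
    obtain c where c: "of_int m * rat_functional (ev (D ^ k * Polynomial.monom 1 j) z) = of_int c"
      using m(2) Ints_cases by metis
    have mc: "of_int m * rat_functional (A ^ k * z ^ j) = of_int (5 ^ k * c)"
      unfolding e of_int_mult c[symmetric] by (simp only: mult_ac)
    have "c \<noteq> 0" using mc nz m(1) by auto
    then have "(5::int) ^ k \<le> \<bar>5 ^ k * c\<bar>" by (simp add: abs_mult)
    then have "(of_int (5 ^ k) :: rat) \<le> of_int \<bar>5 ^ k * c\<bar>" by (simp only: of_int_le_iff)
    also have "\<dots> = \<bar>of_int m * rat_functional (A ^ k * z ^ j)\<bar>" by (simp only: mc of_int_abs)
    also have "\<dots> = of_int m * \<bar>rat_functional (A ^ k * z ^ j)\<bar>" using m(1) by (simp add: abs_mult)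
    also have "\<dots> \<le> of_int m * (4 ^ k * B)" using m(1) bound by (intro mult_left_mono) auto
    finally show False using k' by simp
  qed
  have zero': "rat_functional (A ^ k * (z ^ j * ev p z)) = 0" for j p
  proof (induction p arbitrary: j)
    case (pCons a p)
    have "A ^ k * (z ^ j * ev (pCons a p) z) = of_int a * (A ^ k * z ^ j) + A ^ k * (z ^ Suc j * ev p z)"
      by (simp add: algebra_simps)
    then show ?case using zero[of j] pCons.IH[of "Suc j"] by (simp only: rat_functional_add rat_functional_int mult_zero_right add_0_right)
  qed simp
  obtain p where p: "(z ^ k1 - z ^ k4) * ev p z = of_nat N"
    using root_difference_inverse[OF z N, of k1 k4] ne(1) k1 k4 by metis
  obtain q where q: "(z ^ k2 - z ^ k3) * ev q z = of_nat N"
    using root_difference_inverse[OF z N, of k2 k3] ne(2) k2 k3 by metis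
  have "A * ev (p * q) z = of_nat (N * N)"
    using arg_cong2[OF p q, of "(*)"] by (simp add: A_def k1 k2 k3 k4 mult_ac)
  then have "A ^ k * ev ((p * q) ^ k) z = of_nat (N * N) ^ k" by (simp only: ev_power power_mult_distrib[symmetric])
  then have "rat_functional (of_nat ((N * N) ^ k) * 1) = 0" using zero'[of 0 "(p * q) ^ k"] by simp
  then have "of_nat ((N * N) ^ k) * rat_functional 1 = 0" by (simp only: rat_functional_of_nat)
  then show False using N by simp
qed

subsection \<open>The fields\<close>

lemma complex_field_simps [simp]:
  "carrier complex_field = UNIV" "monoid.mult complex_field = (*)" "one complex_field = 1"
  "ring.zero complex_field = 0" "add complex_field = (+)"
  by (simp_all add: ring_of_type_algebra_def)

lemma complex_field_a_inv: "a_inv complex_field x = - x"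
proof -
  interpret field complex_field by (rule field_from_type_algebra)
  have "x \<oplus>\<^bsub>complex_field\<^esub> (- x) = \<zero>\<^bsub>complex_field\<^esub>" by simp
  then show ?thesis using minus_equality[of "- x" x] by (simp add: add.commute)
qed

lemma complex_field_m_inv: "x \<noteq> 0 \<Longrightarrow> m_inv complex_field x = inverse x"
proof -
  assume x: "x \<noteq> 0"
  interpret field complex_field by (rule field_from_type_algebra)
  show ?thesis using comm_inv_char[of x "inverse x"] x by simp
qed

lemma field_gen_incl: "x \<in> S \<Longrightarrow> x \<in> field_gen S"
  unfolding field_gen_def by (rule generate_field.incl)

lemma field_gen_1: "1 \<in> field_gen S"
  using generate_field.one[of complex_field S] by (simp add: field_gen_def)

lemma field_gen_add: "x \<in> field_gen S \<Longrightarrow> y \<in> field_gen S \<Longrightarrow> x + y \<in> field_gen S"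
  using generate_field.eng_add[of x complex_field S y] by (simp add: field_gen_def)

lemma field_gen_mult: "x \<in> field_gen S \<Longrightarrow> y \<in> field_gen S \<Longrightarrow> x * y \<in> field_gen S"
  using generate_field.eng_mult[of x complex_field S y] by (simp add: field_gen_def)

lemma field_gen_uminus: "x \<in> field_gen S \<Longrightarrow> - x \<in> field_gen S"
  using generate_field.a_inv[of x complex_field S] by (simp add: field_gen_def complex_field_a_inv)

lemma field_gen_0: "0 \<in> field_gen S"
  using field_gen_add[OF field_gen_1 field_gen_uminus[OF field_gen_1]] by simp

lemma field_gen_inverse: "x \<in> field_gen S \<Longrightarrow> inverse x \<in> field_gen S"
  using generate_field.m_inv[of x complex_field S] field_gen_0[of S]
  by (cases "x = 0") (simp_all add: field_gen_def complex_field_m_inv)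

lemma field_gen_diff: "x \<in> field_gen S \<Longrightarrow> y \<in> field_gen S \<Longrightarrow> x - y \<in> field_gen S"
  using field_gen_add[of x S "- y"] field_gen_uminus[of y S] by simp

lemma field_gen_divide: "x \<in> field_gen S \<Longrightarrow> y \<in> field_gen S \<Longrightarrow> x / y \<in> field_gen S"
  by (simp add: divide_inverse field_gen_mult field_gen_inverse)

lemma field_gen_of_nat: "of_nat k \<in> field_gen S"
  by (induction k) (auto intro: field_gen_0 field_gen_1 field_gen_add)

lemma field_gen_zeta_subset: "field_gen {zeta n} \<subseteq> cyc_field n"
proof
  fix x assume "x \<in> field_gen {zeta n}"
  then have "x \<in> generate_field complex_field {zeta n}" by (simp only: field_gen_def)
  then show "x \<in> cyc_field n"
  proof (induction rule: generate_field.induct)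
    case one
    then show ?case using cyc_field_ev[of 1 n] by simp
  next
    case (incl h)
    then show ?case using cyc_field_ev[of "Polynomial.monom 1 1" n] by simp
  next
    case (a_inv h)
    then show ?case by (simp add: complex_field_a_inv cyc_field_uminus)
  next
    case (m_inv h)
    then show ?case by (simp add: complex_field_m_inv cyc_field_inverse)
  next
    case (eng_add h1 h2)
    then show ?case by (simp add: cyc_field_add)
  next
    case (eng_mult h1 h2)
    then show ?case by (simp add: cyc_field_mult)
  qed
qed

lemma finite_dimension_imp_spanned:
  assumes "ring.finite_dimension complex_field \<rat> E"
  shows "\<exists>B. finite B \<and> E \<subseteq> rat_vs.span B"
proof -
  interpret field complex_field by (rule field_from_type_algebra)
  obtain n where "dimension n \<rat> E" using assms by (auto simp: finite_dimension_def)
  then show ?thesis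
  proof (induction n "\<rat> :: complex set" E rule: dimension.induct)
    case zero_dim
    show ?case by (intro exI[of _ "{}"]) simp
  next
    case (Suc_dim v E n)
    then obtain B where B: "finite B" "E \<subseteq> rat_vs.span B" by blast
    have "line_extension \<rat> v E \<subseteq> rat_vs.span (insert v B)"
    proof
      fix x assume "x \<in> line_extension \<rat> v E"
      then obtain k e where ke: "k \<in> \<rat>" "e \<in> E" "x = k * v + e" using line_extension_mem_iff by auto
      obtain q where q: "k = of_rat q" using ke(1) by (auto simp: Rats_def)
      have "e \<in> rat_vs.span (insert v B)" using B(2) ke(2) rat_vs.span_mono[of B "insert v B"] by blast
      moreover have "of_rat q * v \<in> rat_vs.span (insert v B)" by (intro rat_vs.span_scale rat_vs.span_base) simp
      ultimately show "x \<in> rat_vs.span (insert v B)" unfolding ke(3) q using rat_vs.span_add by blast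
    qed
    then show ?case using B(1) by (intro exI[of _ "insert v B"]) auto
  qed
qed

text \<open>The elements of \<open>K\<close> in any cyclotomic field span a space of finite
  dimension. Each member of a finite basis chosen among them lies in some cyclotomic field, and the
  product of the levels serves for all.\<close>

lemma cyclotomic_part_bounded:
  assumes "ring.finite_dimension complex_field \<rat> K"
  shows "\<exists>n>0. \<forall>N>0. K \<inter> cyc_field N \<subseteq> cyc_field n"
proof -
  obtain B0 where B0: "finite B0" "K \<subseteq> rat_vs.span B0" using finite_dimension_imp_spanned[OF assms] by blast
  define E where "E = K \<inter> (\<Union>N\<in>{0<..}. cyc_field N)"
  obtain B where B: "B \<subseteq> E" "rat_vs.independent B" "E \<subseteq> rat_vs.span B"
    using rat_vs.maximal_independent_subset[of E] by blast
  have "B \<subseteq> rat_vs.span B0" using B(1) B0(2) by (auto simp: E_def)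
  then have finB: "finite B" using rat_vs.independent_span_bound[OF B0(1) B(2)] by blast
  have "\<forall>b\<in>B. \<exists>N>0. b \<in> cyc_field N" using B(1) by (auto simp: E_def)
  then obtain f where f: "\<And>b. b \<in> B \<Longrightarrow> f b > 0 \<and> b \<in> cyc_field (f b)" by metis
  define n where "n = (\<Prod>b\<in>B. f b)"
  have n: "n > 0" unfolding n_def using f by (intro prod_pos) auto
  have "b \<in> cyc_field n" if "b \<in> B" for b
  proof -
    have "f b dvd n" unfolding n_def using finB that by (rule dvd_prodI)
    then show ?thesis using cyc_field_mono[OF _ n] f[OF that] by blast
  qed
  then have Bn: "B \<subseteq> cyc_field n" by blast
  have "rat_vs.subspace (cyc_field n)"
    unfolding rat_vs.subspace_def using cyc_field_of_rat[of 0 n] by (auto intro: cyc_field_add cyc_field_mult cyc_field_of_rat)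
  then have "rat_vs.span B \<subseteq> cyc_field n" by (rule rat_vs.span_minimal[OF Bn])
  then have "E \<subseteq> cyc_field n" using B(3) by blast
  then have "\<forall>N>0. K \<inter> cyc_field N \<subseteq> cyc_field n" by (auto simp: E_def)
  then show ?thesis using n by blast
qed

subsection \<open>Fewer than four directions\<close>

lemma lborel_distr_reflect: "distr lborel borel (\<lambda>t. c - t) = (lborel :: real measure)"
  using lborel_real_affine[of "-1" c] by (simp add: density_1)

lemma xray_reflection:
  assumes T: "closed T" and f: "\<And>t. p + t *\<^sub>R u \<in> L \<longleftrightarrow> p + (c - t) *\<^sub>R u \<in> T"
  shows "xray u L p = xray u T p"
proof -
  have "closed ((\<lambda>t. p + t *\<^sub>R u) -` T)" by (intro closed_vimage T continuous_intros)
  then have m: "{t. p + t *\<^sub>R u \<in> T} \<in> sets borel" by (simp add: vimage_def)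
  have "xray u T p = measure (distr lborel borel (\<lambda>t. c - t)) {t. p + t *\<^sub>R u \<in> T}"
    by (simp add: xray_def lborel_distr_reflect)
  also have "\<dots> = xray u L p" using m by (simp add: measure_distr vimage_def xray_def f)
  finally show ?thesis by simp
qed

text \<open>The affine reflection of the triangle along the direction of one of its vertices (seen from the
  centroid) maps it to its negative and every line in that direction to itself.\<close>

lemma xray_triangle_uminus:
  fixes a b c u :: complex
  assumes sum: "a + b + c = 0" and bc: "cross b c \<noteq> 0" and u: "a = s *\<^sub>R u" "s \<noteq> 0"
  shows "xray u (uminus ` (convex hull {a, b, c})) = xray u (convex hull {a, b, c})"
proof (rule ext)
  fix p
  let ?T = "convex hull {a, b, c}"
  \<comment> \<open>The linear functional with value -2 at \<open>a\<close> and 1 at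
    \<open>b\<close> and \<open>c\<close>; thus \<open>f\<close> moves points only along
    \<open>a\<close> and sends \<open>a\<close>, \<open>b\<close>, \<open>c\<close> to
    \<open>- a\<close>, \<open>- c\<close>, \<open>- b\<close>.\<close>
  define g where "g z = - cross z (b - c) / cross b c" for z
  define f where "f z = z + g z *\<^sub>R a" for z
  have a: "a = - b - c" using sum by (simp add: algebra_simps add_eq_0_iff2)
  have g: "g (x + y) = g x + g y" "g (t *\<^sub>R x) = t * g x" for x y t
    using bc by (simp_all add: g_def add_divide_distrib diff_divide_distrib algebra_simps)
  have ga: "g a = -2" "g b = 1" "g c = 1"
  proof -
    have cb: "cross c b = - cross b c" by (rule cross_commute)
    show "g a = -2" "g b = 1" "g c = 1" using bc by (simp_all add: g_def a cb)
  qed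
  have lin: "linear f" by (rule linearI) (simp_all add: f_def g algebra_simps)
  have fv: "f a = - a" "f b = - c" "f c = - b"
  proof -
    show "f a = - a" by (simp add: f_def ga scaleR_conv_of_real)
    show "f b = - c" "f c = - b" by (simp_all add: f_def ga a)
  qed
  have inv: "f (f z) = z" for z
    by (simp add: f_def g ga algebra_simps)
  have "uminus ` ?T = convex hull (uminus ` {a, b, c})" by (rule convex_hull_linear_image) (simp add: linear_uminus)
  also have "uminus ` {a, b, c} = f ` {a, b, c}" by (auto simp: fv)
  also have "convex hull (f ` {a, b, c}) = f ` ?T" by (rule convex_hull_linear_image[OF lin, symmetric])
  finally have im: "uminus ` ?T = f ` ?T" .
  have fT: "z \<in> uminus ` ?T \<longleftrightarrow> f z \<in> ?T" for z
    unfolding im by (metis image_iff inv)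
  have "s * g u = -2" using g(2)[of s u] ga(1) u(1) by simp
  then have sg: "t + s * (g p + t * g u) = s * g p - t" for t
    by (simp add: distrib_left mult.left_commute[of s])
  have "f (p + t *\<^sub>R u) = p + (t + s * (g p + t * g u)) *\<^sub>R u" for t
    unfolding f_def g by (subst u(1)) (simp add: scaleR_left_distrib mult.commute)
  then have "f (p + t *\<^sub>R u) = p + (s * g p - t) *\<^sub>R u" for t unfolding sg .
  then show "xray u (uminus ` ?T) p = xray u ?T p"
    by (intro xray_reflection[of _ p u _ "s * g p"] compact_imp_closed finite_imp_compact_convex_hull) (auto simp: fT)
qed

lemma not_determined_three:
  assumes u: "norm u1 = 1" "norm u2 = 1" "norm u3 = 1"
    and np: "cross u1 u2 \<noteq> 0" "cross u2 u3 \<noteq> 0" "cross u3 u1 \<noteq> 0"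
  shows "\<not> determined_by_xrays {u1, u2, u3}"
proof -
  \<comment> \<open>The coefficients of the linear relation between three plane vectors: the
    vertices point along the directions and their centroid is 0.\<close>
  define a b c where "a = cross u2 u3 *\<^sub>R u1" and "b = cross u3 u1 *\<^sub>R u2" and "c = cross u1 u2 *\<^sub>R u3"
  have sum: "a + b + c = 0"
    by (simp add: a_def b_def c_def cross_def complex_eq_iff algebra_simps)
  have ab: "cross a b \<noteq> 0" "cross b c \<noteq> 0" "cross c a \<noteq> 0" using np by (simp_all add: a_def b_def c_def)
  let ?T = "convex hull {a, b, c}" and ?L = "uminus ` (convex hull {a, b, c})"
  have rot: "{b, c, a} = {a, b, c}" "{c, a, b} = {a, b, c}" by auto
  have x1: "xray u1 ?L = xray u1 ?T"
    by (rule xray_triangle_uminus[OF sum ab(2), of "cross u2 u3"]) (use np in \<open>auto simp: a_def\<close>)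
  have x2: "xray u2 ?L = xray u2 ?T"
    using xray_triangle_uminus[of b c a, OF _ ab(3), of "cross u3 u1" u2] sum np unfolding rot by (auto simp: b_def add_ac)
  have x3: "xray u3 ?L = xray u3 ?T"
    using xray_triangle_uminus[of c a b, OF _ ab(1), of "cross u1 u2" u3] sum np unfolding rot by (auto simp: c_def add_ac)
  have ncol: "\<not> collinear {a, b, c}"
  proof
    assume "collinear {a, b, c}"
    then obtain w where w: "\<And>x y. x \<in> {a, b, c} \<Longrightarrow> y \<in> {a, b, c} \<Longrightarrow> \<exists>k. x - y = k *\<^sub>R w"
      unfolding collinear_def by blast
    obtain k where k: "a - c = k *\<^sub>R w" using w[of a c] by auto
    obtain l where l: "b - c = l *\<^sub>R w" using w[of b c] by auto
    have "cross (a - c) (b - c) = 0" unfolding k l by simp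
    moreover have a: "a = - b - c" using sum by (simp add: algebra_simps add_eq_0_iff2)
    have "cross a b = cross b c" "cross a c = - cross b c" using cross_commute[of c b] by (simp_all add: a)
    then have "cross (a - c) (b - c) = 3 * cross b c" using cross_commute[of c b] by simp
    ultimately show False using ab(2) by simp
  qed
  have int: "interior ?T \<noteq> {}"
  proof -
    have "(1/3) *\<^sub>R a + (1/3) *\<^sub>R b + (1/3) *\<^sub>R c \<in> interior ?T"
      unfolding interior_convex_hull_3_minimal[OF ncol DIM_complex]
      by (intro CollectI exI[of _ "1/3"]) simp
    then show ?thesis by blast
  qed
  have T: "convex_body ?T" unfolding convex_body_def using int by (simp add: finite_imp_compact_convex_hull)
  have L: "convex_body ?L" unfolding convex_body_def
    using int by (auto simp: interior_negations finite_imp_compact_convex_hull intro: compact_negations convex_negations)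
  have "a \<notin> ?L"
  proof
    assume "a \<in> ?L"
    then have ma: "- a \<in> ?T" by force
    \<comment> \<open>\<open>h\<close> is 2 at \<open>a\<close> and -1 at \<open>b\<close> and
      \<open>c\<close>, so \<open>?T\<close> lies in the half plane \<open>h \<ge> -1\<close> and
      misses \<open>- a\<close>.\<close>
    define h where "h z = cross z (b - c) / cross b c" for z
    have h: "h (x + y) = h x + h y" "h (t *\<^sub>R x) = t * h x" for x y t
      using ab(2) by (simp_all add: h_def add_divide_distrib diff_divide_distrib algebra_simps)
    have a: "a = - b - c" using sum by (simp add: algebra_simps add_eq_0_iff2)
    have cb: "cross c b = - cross b c" by (rule cross_commute)
    have hv: "h a = 2" "h b = -1" "h c = -1" "h (- a) = -2" using ab(2) by (simp_all add: h_def a cb)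
    have "convex {z. h z \<ge> -1}"
    proof (rule convexI)
      fix x y and r t :: real
      assume xy: "x \<in> {z. h z \<ge> -1}" "y \<in> {z. h z \<ge> -1}" and rt: "0 \<le> r" "0 \<le> t" "r + t = 1"
      have "r * h x \<ge> r * -1" "t * h y \<ge> t * -1"
        using mult_left_mono[of "-1" "h x" r] mult_left_mono[of "-1" "h y" t] xy rt by auto
      then show "r *\<^sub>R x + t *\<^sub>R y \<in> {z. h z \<ge> -1}" using rt(3) by (simp add: h)
    qed
    then have "?T \<subseteq> {z. h z \<ge> -1}" by (intro hull_minimal) (auto simp: hv)
    then show False using ma hv(4) by auto
  qed
  moreover have "a \<in> ?T" by (simp add: hull_inc)
  ultimately have "?T \<noteq> ?L" by blast
  then show ?thesis unfolding determined_by_xrays_def using T L x1 x2 x3 by auto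
qed

lemma determined_by_xrays_mono: "U \<subseteq> U' \<Longrightarrow> determined_by_xrays U \<Longrightarrow> determined_by_xrays U'"
  unfolding determined_by_xrays_def by blast

lemma parallel_sym:
  assumes "parallel u v" shows "parallel v u"
proof -
  obtain c where c: "c \<noteq> 0" "v = c *\<^sub>R u" using assms unfolding parallel_def by blast
  then have "u = (1 / c) *\<^sub>R v" by simp
  then show ?thesis unfolding parallel_def using c(1) by (metis divide_eq_0_iff one_neq_zero)
qed

lemma unit_parallel_iff:
  assumes "norm u = 1" "norm v = 1" "parallel u v" shows "v = u \<or> v = - u"
proof -
  obtain c :: real where c: "v = c *\<^sub>R u" using assms(3) by (auto simp: parallel_def)
  then have "\<bar>c\<bar> = 1" using assms(1,2) by simp
  then have "c = 1 \<or> c = -1" by linarith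
  then show ?thesis using c by auto
qed

lemma extend_directions:
  assumes "finite U" "\<And>u. u \<in> U \<Longrightarrow> norm u = 1" "pairwise (\<lambda>u v. \<not> parallel u v) U"
  shows "\<exists>v. v \<notin> U \<and> norm v = 1 \<and> pairwise (\<lambda>u v. \<not> parallel u v) (insert v U)"
proof -
  let ?W = "U \<union> uminus ` U"
  define n where "n = Suc (card ?W)"
  have "card {z::complex. z ^ n = 1} = n" by (rule card_roots_unity_eq) (simp add: n_def)
  then have "\<not> {z::complex. z ^ n = 1} \<subseteq> ?W"
    using card_mono[of ?W "{z::complex. z ^ n = 1}"] assms(1) by (auto simp: n_def)
  then obtain v where v: "v ^ n = 1" "v \<notin> ?W" by blast
  have nv: "norm v = 1" using v(1) by (metis norm_power norm_one power_eq_1_iff n_def nat.distinct(1) norm_ge_zero abs_of_nonneg)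
  have "\<not> parallel u v" if "u \<in> U" for u
    using unit_parallel_iff[OF assms(2)[OF that] nv] v(2) that by auto
  then have "pairwise (\<lambda>u v. \<not> parallel u v) (insert v U)"
    unfolding pairwise_insert using assms(3) parallel_sym by blast
  then show ?thesis using v(2) nv by blast
qed

text \<open>More directions determine at least as much, so the set may be enlarged to three
  directions.\<close>

lemma not_determined_few:
  assumes U: "finite U" "\<And>u. u \<in> U \<Longrightarrow> norm u = 1" "pairwise (\<lambda>u v. \<not> parallel u v) U" "card U < 4"
  shows "\<not> determined_by_xrays U"
  using U
proof (induction "3 - card U" arbitrary: U)
  case 0
  then have "card U = 3" by simp
  then obtain u1 u2 u3 where u: "U = {u1, u2, u3}" "u1 \<noteq> u2" "u1 \<noteq> u3" "u2 \<noteq> u3" by (auto simp: card_3_iff)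
  have np: "cross u v \<noteq> 0" if "u \<in> U" "v \<in> U" "u \<noteq> v" for u v
    using parallel_if_cross_0[OF 0(3)[OF that(1)] 0(3)[OF that(2)]] 0(4) that by (auto simp: pairwise_def)
  show ?case unfolding u(1) by (rule not_determined_three) (use u 0(3) np in auto)
next
  case (Suc k)
  obtain v where v: "v \<notin> U" "norm v = 1" "pairwise (\<lambda>u v. \<not> parallel u v) (insert v U)"
    using extend_directions[OF Suc.prems(1,2,3)] by blast
  have "card (insert v U) = Suc (card U)" using v(1) Suc.prems(1) by simp
  then have "\<not> determined_by_xrays (insert v U)"
    using v Suc.prems Suc.hyps(2) by (intro Suc.hyps(1)) auto
  then show ?case using determined_by_xrays_mono[of U "insert v U"] by blast
qed

subsection \<open>Directions of Delone sets\<close>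

text \<open>\<open>u\<close> is a real multiple of a difference z, so its square is z / cnj z. Here
  the conjugates in \<open>K_field\<close> enter.\<close>

lemma Lambda_direction_square:
  assumes "Lambda_direction \<Lambda> u" shows "norm u = 1" "u ^ 2 \<in> K_field \<Lambda>"
proof -
  show u: "norm u = 1" using assms by (simp add: Lambda_direction_def)
  obtain z c where z: "z \<in> differences \<Lambda>" "z \<noteq> 0" "c \<noteq> 0" "z = c *\<^sub>R u"
    using assms unfolding Lambda_direction_def parallel_def by blast
  have "u ^ 2 * cnj u = (cnj u * u) * u" by (simp add: power2_eq_square mult_ac)
  then have "u ^ 2 * cnj u = u" by (simp only: cnj_mult_self_unit[OF u] mult_1_left)
  then have "u ^ 2 * cnj z = z" unfolding z(4) by simp
  then have "u ^ 2 = z / cnj z" using z(2) by (metis complex_cnj_zero_iff nonzero_mult_div_cancel_right)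
  moreover have "z \<in> K_field \<Lambda>" "cnj z \<in> K_field \<Lambda>" using z(1) unfolding K_field_def by (auto intro!: field_gen_incl)
  ultimately show "u ^ 2 \<in> K_field \<Lambda>" using field_gen_divide unfolding K_field_def by metis
qed

text \<open>Read on the squares of the directions, the common cross ratio lies in
  \<open>K_field \<Lambda>\<close>; read on the roots of unity, it lies in
  \<open>cyc_field N\<close>.\<close>

lemma not_determined_imp_cross_ratios:
  assumes U: "nonparallel_Lambda_directions \<Lambda> U" "card U \<ge> 3" "\<not> determined_by_xrays U"
  obtains N \<omega> where "N > 0" "inj_on \<omega> U" "\<And>u. u \<in> U \<Longrightarrow> \<omega> u ^ N = (1::complex)"
    "\<And>a b c d. a \<in> U \<Longrightarrow> b \<in> U \<Longrightarrow> c \<in> U \<Longrightarrow> d \<in> U \<Longrightarrow>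
      cross_ratio (\<omega> a) (\<omega> b) (\<omega> c) (\<omega> d) = cross_ratio (a ^ 2) (b ^ 2) (c ^ 2) (d ^ 2)"
    "cross_ratios_in (\<omega> ` U) (K_field \<Lambda> \<inter> cyc_field N)"
proof -
  have dir: "Lambda_direction \<Lambda> u" if "u \<in> U" for u using U(1) that by (simp add: nonparallel_Lambda_directions_def)
  have par: "pairwise (\<lambda>u v. \<not> parallel u v) U" using U(1) by (simp add: nonparallel_Lambda_directions_def)
  obtain N :: nat and \<omega> A B where w: "N > 0" "inj_on \<omega> U" "\<And>u. u \<in> U \<Longrightarrow> \<omega> u ^ N = 1" "A * cnj A \<noteq> B * cnj B"
      "\<And>u. u \<in> U \<Longrightarrow> \<omega> u * A - cnj B = u ^ 2 * (\<omega> u * B - cnj A)"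
    using not_determined_imp_roots_of_unity[OF U(3) Lambda_direction_square(1)[OF dir] par U(2)] by metis
  have cr: "cross_ratio (\<omega> a) (\<omega> b) (\<omega> c) (\<omega> d) = cross_ratio (a ^ 2) (b ^ 2) (c ^ 2) (d ^ 2)"
    if h: "a \<in> U" "b \<in> U" "c \<in> U" "d \<in> U" for a b c d
  proof -
    define f where "f i = (if i = 1 then a else if i = 2 then b else if i = 3 then c else d)" for i :: nat
    have fU: "f i \<in> U" for i using h by (simp add: f_def)
    have "cross_ratio ((f 1) ^ 2) ((f 2) ^ 2) ((f 3) ^ 2) ((f 4) ^ 2) = cross_ratio (\<omega> (f 1)) (\<omega> (f 2)) (\<omega> (f 3)) (\<omega> (f 4))"
    proof (rule cross_ratio_moebius[of A "- cnj A" "- cnj B" B "\<lambda>i. \<omega> (f i)" "\<lambda>i. (f i) ^ 2"])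
      show "A * - cnj A \<noteq> - cnj B * B" using w(4) by (simp add: mult.commute)
      show "A * \<omega> (f i) + - cnj B = f i ^ 2 * (B * \<omega> (f i) + - cnj A)" for i
        using w(5)[OF fU, of i] by (simp add: mult.commute)
    qed
    then show ?thesis by (simp add: f_def)
  qed
  have "cross_ratios_in (\<omega> ` U) (K_field \<Lambda> \<inter> cyc_field N)"
    unfolding cross_ratios_in_def
  proof (intro ballI impI, elim imageE)
    fix a b c d a' b' c' d'
    assume e: "a = \<omega> a'" "b = \<omega> b'" "c = \<omega> c'" "d = \<omega> d'" and h: "a' \<in> U" "b' \<in> U" "c' \<in> U" "d' \<in> U"
    have "cross_ratio a b c d \<in> K_field \<Lambda>"
      unfolding e cr[OF h] unfolding cross_ratio_def K_field_def
      using h Lambda_direction_square(2)[OF dir] unfolding K_field_def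
      by (intro field_gen_divide field_gen_mult field_gen_diff) auto
    moreover have "\<omega> u \<in> cyc_field N" if "u \<in> U" for u using root_of_unity_in_cyc_field[OF w(1) w(3)[OF that]] .
    then have "cross_ratio a b c d \<in> cyc_field N"
      unfolding e cross_ratio_def using h by (intro cyc_field_divide cyc_field_mult cyc_field_diff) auto
    ultimately show "cross_ratio a b c d \<in> K_field \<Lambda> \<inter> cyc_field N" by blast
  qed
  then show ?thesis using that[OF w(1,2,3) cr] by blast
qed

lemma direction_bound_ge: "n > 0 \<Longrightarrow> direction_bound n \<ge> 6"
  by (auto simp: direction_bound_def)

lemma determined_if_many:
  assumes n: "n > 0" and K: "\<And>N. N > 0 \<Longrightarrow> K_field \<Lambda> \<inter> cyc_field N \<subseteq> cyc_field n"
    and U: "nonparallel_Lambda_directions \<Lambda> U" "card U = Suc (direction_bound n)"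
  shows "determined_by_xrays U"
proof (rule ccontr)
  assume nd: "\<not> determined_by_xrays U"
  have c3: "card U \<ge> 3" using U(2) direction_bound_ge[OF n] by simp
  obtain N \<omega> where w: "N > 0" "inj_on \<omega> U" "\<And>u. u \<in> U \<Longrightarrow> \<omega> u ^ N = (1::complex)"
    "cross_ratios_in (\<omega> ` U) (K_field \<Lambda> \<inter> cyc_field N)"
    using not_determined_imp_cross_ratios[OF U(1) c3 nd] by metis
  have "U \<noteq> {}" using c3 by auto
  then have "finite (\<omega> ` U) \<and> card (\<omega> ` U) \<le> direction_bound n"
    using w(1,3) by (intro roots_of_unity_card_bound[OF n w(1)] cross_ratios_in_mono[OF w(4)] K) auto
  then show False using card_image[OF w(2)] U(2) by simp
qed

text \<open>Points of \<Lambda> within R of 0, 4 R and 4 R \<i> give two differences, each within 2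
  R of one of two perpendicular vectors of length 4 R.\<close>

lemma exists_nonparallel_differences:
  assumes "relatively_dense \<Lambda>"
  obtains d1 d2 where "d1 \<in> differences \<Lambda>" "d2 \<in> differences \<Lambda>" "cross d1 d2 \<noteq> 0"
proof -
  obtain R where R: "R > 0" "\<And>z. ball z R \<inter> \<Lambda> \<noteq> {}" using assms by (auto simp: relatively_dense_def)
  obtain v where v: "v \<in> \<Lambda>" "norm v < R" using R(2)[of 0] by auto
  obtain w where w: "w \<in> \<Lambda>" "norm (of_real (4 * R) - w) < R" using R(2)[of "of_real (4 * R)"] by (auto simp: dist_norm)
  obtain x where x: "x \<in> \<Lambda>" "norm (\<i> * of_real (4 * R) - x) < R" using R(2)[of "\<i> * of_real (4 * R)"] by (auto simp: dist_norm)
  have bv: "\<bar>Re v\<bar> < R" "\<bar>Im v\<bar> < R" using v abs_Re_le_cmod[of v] abs_Im_le_cmod[of v] by linarith+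
  have bw: "\<bar>4 * R - Re w\<bar> < R" "\<bar>Im w\<bar> < R"
    using w abs_Re_le_cmod[of "of_real (4 * R) - w"] abs_Im_le_cmod[of "of_real (4 * R) - w"] by auto
  have bx: "\<bar>Re x\<bar> < R" "\<bar>4 * R - Im x\<bar> < R"
    using x abs_Re_le_cmod[of "\<i> * of_real (4 * R) - x"] abs_Im_le_cmod[of "\<i> * of_real (4 * R) - x"] by auto
  have p: "Re (w - v) > 2 * R" "\<bar>Im (w - v)\<bar> < 2 * R" "\<bar>Re (x - v)\<bar> < 2 * R" "Im (x - v) > 2 * R"
    using bv bw bx by auto
  have "\<bar>Im (w - v) * Re (x - v)\<bar> \<le> (2 * R) * (2 * R)"
    unfolding abs_mult using p R(1) by (intro mult_mono) auto
  moreover have "(2 * R) * (2 * R) < Re (w - v) * Im (x - v)"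
    using p R(1) by (intro mult_strict_mono) auto
  ultimately have "cross (w - v) (x - v) \<noteq> 0" unfolding cross_def by linarith
  moreover have "w - v \<in> differences \<Lambda>" "x - v \<in> differences \<Lambda>" using v w x by (auto simp: differences_def)
  ultimately show ?thesis using that by blast
qed

lemma directions_of_field_elements:
  assumes hom: "Hom \<Lambda>" and X: "finite F" "F \<subseteq> K_field \<Lambda>" and z: "z \<in> F" "z \<noteq> 0"
  shows "Lambda_direction \<Lambda> (z /\<^sub>R norm z)"
proof -
  \<comment> \<open>Adjoining 0 makes \<open>h z - h 0\<close>, a positive multiple of
    \<open>z\<close>, a difference of points of \<Lambda>.\<close>
  have "finite (insert 0 F) \<and> insert 0 F \<subseteq> K_field \<Lambda>" using X field_gen_0 by (simp add: K_field_def)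
  then obtain h where h: "homothety h" "h ` insert 0 F \<subseteq> \<Lambda>" using hom unfolding Hom_def by blast
  obtain l :: real and t where l: "l > 0" "h = (\<lambda>z. of_real l * z + t)" using h(1) by (auto simp: homothety_def)
  have "h z - h 0 \<in> differences \<Lambda>" using h(2) z(1) unfolding differences_def by blast
  moreover have "h z - h 0 = l *\<^sub>R z" by (simp add: l scaleR_conv_of_real)
  ultimately have "l *\<^sub>R z \<in> differences \<Lambda>" by simp
  moreover have "parallel (z /\<^sub>R norm z) (l *\<^sub>R z)"
    unfolding parallel_def using l z(2) by (intro exI[of _ "l * norm z"]) simp
  ultimately show ?thesis unfolding Lambda_direction_def using l z(2) by (auto intro!: bexI[of _ "l *\<^sub>R z"])
qed

lemma sgn_square: "(z /\<^sub>R norm z) ^ 2 = z / cnj z" if "z \<noteq> 0" for z :: complex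
proof -
  have "(z /\<^sub>R norm z) ^ 2 = z ^ 2 / of_real (norm z) ^ 2"
    by (simp add: scaleR_conv_of_real power_mult_distrib power_divide divide_inverse power_inverse mult.commute)
  also have "of_real (norm z) ^ 2 = z * cnj z" using complex_norm_square[of z] by simp
  also have "z ^ 2 / (z * cnj z) = z / cnj z" using that by (simp add: power2_eq_square)
  finally show ?thesis .
qed

lemma exists_four_directions:
  assumes dense: "relatively_dense \<Lambda>" and hom: "Hom \<Lambda>"
  shows "\<exists>U. nonparallel_Lambda_directions \<Lambda> U \<and> card U = 4 \<and> determined_by_xrays U"
proof -
  obtain d1 d2 where d: "d1 \<in> differences \<Lambda>" "d2 \<in> differences \<Lambda>" "cross d1 d2 \<noteq> 0"
    using exists_nonparallel_differences[OF dense] .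
  \<comment> \<open>Parameters with cross ratio (3 (-2)) / ((-5) 6) = 1 / 5; integers keep
    \<open>x i\<close> in \<open>K_field \<Lambda>\<close>.\<close>
  define s :: "nat \<Rightarrow> real" where "s i = (if i = 1 then 0 else if i = 2 then 3 else if i = 3 then -3 else 5)" for i
  define x where "x i = d1 + s i *\<^sub>R d2" for i
  define u where "u i = x i /\<^sub>R norm (x i)" for i
  let ?I = "{1, 2, 3, 4::nat}"
  have dK: "d1 \<in> K_field \<Lambda>" "d2 \<in> K_field \<Lambda>" using d by (auto simp: K_field_def intro!: field_gen_incl)
  have xK: "x i \<in> K_field \<Lambda>" for i
  proof -
    have "x i = d1 \<or> x i = d1 + of_nat 3 * d2 \<or> x i = d1 - of_nat 3 * d2 \<or> x i = d1 + of_nat 5 * d2"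
      by (simp add: x_def s_def scaleR_conv_of_real)
    then show ?thesis using dK unfolding K_field_def
      by (elim disjE; simp only:) (intro field_gen_add field_gen_diff field_gen_mult field_gen_of_nat; assumption)+
  qed
  have cx: "cross (x i) (x j) = (s j - s i) * cross d1 d2" for i j
    using cross_commute[of d2 d1] by (simp add: x_def algebra_simps)
  have s_inj: "s i \<noteq> s j" if "i \<in> ?I" "j \<in> ?I" "i \<noteq> j" for i j using that by (auto simp: s_def)
  have x0: "x i \<noteq> 0" for i
  proof
    assume "x i = 0"
    moreover have "cross (x i) d2 = cross d1 d2" by (simp add: x_def)
    ultimately show False using d(3) by simp
  qed
  have npar: "\<not> parallel (u i) (u j)" if "i \<in> ?I" "j \<in> ?I" "i \<noteq> j" for i j
  proof
    assume "parallel (u i) (u j)"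
    then obtain c where "u j = c *\<^sub>R u i" by (auto simp: parallel_def)
    then have "cross (u i) (u j) = 0" by simp
    then have "cross (x i) (x j) = 0" using x0 by (simp add: u_def)
    then show False using cx s_inj[OF that] d(3) by simp
  qed
  have u_par: "parallel v v" for v unfolding parallel_def by (intro exI[of _ 1]) simp
  have u_inj: "inj_on u ?I" using npar u_par by (intro inj_onI) metis
  define U where "U = u ` ?I"
  have dir: "Lambda_direction \<Lambda> (u i)" if "i \<in> ?I" for i
    unfolding u_def by (rule directions_of_field_elements[OF hom, of "x ` ?I"]) (use xK x0 that in auto)
  have pw: "pairwise (\<lambda>u v. \<not> parallel u v) U"
    unfolding U_def pairwise_image by (rule pairwiseI) (use npar in blast)
  have "finite U" "\<forall>v\<in>U. Lambda_direction \<Lambda> v" unfolding U_def using dir by auto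
  then have U: "nonparallel_Lambda_directions \<Lambda> U"
    unfolding nonparallel_Lambda_directions_def using pw by (intro conjI)
  have card: "card U = 4" unfolding U_def using card_image[OF u_inj] by simp
  have c3: "card U \<ge> 3" using card by simp
  have "determined_by_xrays U"
  proof (rule ccontr)
    assume nd: "\<not> determined_by_xrays U"
    obtain N \<omega> where w: "N > 0" "inj_on \<omega> U" "\<And>v. v \<in> U \<Longrightarrow> \<omega> v ^ N = (1::complex)"
      "\<And>a b c d. a \<in> U \<Longrightarrow> b \<in> U \<Longrightarrow> c \<in> U \<Longrightarrow> d \<in> U \<Longrightarrow>
        cross_ratio (\<omega> a) (\<omega> b) (\<omega> c) (\<omega> d) = cross_ratio (a ^ 2) (b ^ 2) (c ^ 2) (d ^ 2)"
      "cross_ratios_in (\<omega> ` U) (K_field \<Lambda> \<inter> cyc_field N)"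
      by (rule not_determined_imp_cross_ratios[OF U c3 nd]) (rule that; assumption)
    have uU: "u i \<in> U" if "i \<in> ?I" for i using that unfolding U_def by (rule imageI)
    have "cross_ratio ((u 1) ^ 2) ((u 2) ^ 2) ((u 3) ^ 2) ((u 4) ^ 2) =
      cross_ratio (of_real (s 1)) (of_real (s 2)) (of_real (s 3)) (of_real (s 4))"
    \<comment> \<open>The square of \<open>u i\<close> is \<open>x i / cnj (x i)\<close>, a Moebius
      image of \<open>s i\<close>; it is nondegenerate because \<open>d1\<close> and
      \<open>d2\<close> are not parallel.\<close>
    proof (rule cross_ratio_moebius[of d2 "cnj d1" d1 "cnj d2" "\<lambda>i. of_real (s i)" "\<lambda>i. (u i) ^ 2"])
      show "d2 * cnj d1 \<noteq> d1 * cnj d2"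
        using d(3) by (auto simp: cross_def complex_eq_iff algebra_simps)
      show "d2 * of_real (s i) + d1 = u i ^ 2 * (cnj d2 * of_real (s i) + cnj d1)" for i
      proof -
        have "d2 * of_real (s i) + d1 = x i" "cnj d2 * of_real (s i) + cnj d1 = cnj (x i)"
          by (simp_all add: x_def scaleR_conv_of_real mult.commute add.commute)
        then show ?thesis using x0[of i] unfolding u_def by (simp only: sgn_square[OF x0]) simp
      qed
    qed
    also have "\<dots> = 1 / 5" by (simp add: s_def cross_ratio_def)
    finally have cr: "cross_ratio (\<omega> (u 1)) (\<omega> (u 2)) (\<omega> (u 3)) (\<omega> (u 4)) = 1 / 5"
      using w(4)[of "u 1" "u 2" "u 3" "u 4"] uU by simp
    have ne: "\<omega> (u i) \<noteq> \<omega> (u j)" if "i \<in> ?I" "j \<in> ?I" "i \<noteq> j" for i j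
      using that u_inj w(2) uU unfolding inj_on_def by metis
    have ne': "\<omega> (u 1) \<noteq> \<omega> (u 4)" "\<omega> (u 2) \<noteq> \<omega> (u 3)" using ne[of 1 4] ne[of 2 3] by auto
    have "(\<omega> (u 1) - \<omega> (u 4)) * (\<omega> (u 2) - \<omega> (u 3)) = 5 * ((\<omega> (u 1) - \<omega> (u 3)) * (\<omega> (u 2) - \<omega> (u 4)))"
      using cr ne' unfolding cross_ratio_def by (auto simp: frac_eq_eq mult_ac)
    moreover have "(\<omega> (u 1) - \<omega> (u 4)) * (\<omega> (u 2) - \<omega> (u 3)) \<noteq> 5 * ((\<omega> (u 1) - \<omega> (u 3)) * (\<omega> (u 2) - \<omega> (u 4)))"
      by (rule cross_ratio_ne_fifth[OF w(1)]) (use w(3) uU ne' in auto)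
    ultimately show False by blast
  qed
  then show ?thesis using U card by blast
qed

theorem theorem6p2:
  shows
    "(\<forall>\<Lambda>. algebraic_Delone \<Lambda> \<longrightarrow>
        (\<exists>U. nonparallel_Lambda_directions \<Lambda> U \<and> card U = 4 \<and> determined_by_xrays U) \<and>
        (\<forall>U. nonparallel_Lambda_directions \<Lambda> U \<and> card U < 4 \<longrightarrow> \<not> determined_by_xrays U) \<and>
        (\<exists>c>0. \<forall>U. nonparallel_Lambda_directions \<Lambda> U \<and> card U = c \<longrightarrow> determined_by_xrays U))
     \<and>
     (\<exists>c :: nat \<Rightarrow> nat.
        (\<forall>n\<ge>3. c n > 0 \<and>
           (\<forall>\<Lambda> U. cyclotomic_Delone n \<Lambda> \<and> nonparallel_Lambda_directions \<Lambda> U \<and> card U = c n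
              \<longrightarrow> determined_by_xrays U)) \<and>
        c 3 = 7 \<and> c 4 = 7 \<and> c 5 = 11 \<and> c 8 = 9 \<and> c 12 = 13)"
proof (intro conjI allI impI)
  fix \<Lambda> assume \<Lambda>: "algebraic_Delone \<Lambda>"
  show "\<exists>U. nonparallel_Lambda_directions \<Lambda> U \<and> card U = 4 \<and> determined_by_xrays U"
    using \<Lambda> by (intro exists_four_directions) (auto simp: algebraic_Delone_def Delone_def)
  obtain n where n: "n > 0" "\<forall>N>0. K_field \<Lambda> \<inter> cyc_field N \<subseteq> cyc_field n"
    using cyclotomic_part_bounded[of "K_field \<Lambda>"] \<Lambda> by (auto simp: algebraic_Delone_def Alg_def)
  show "\<exists>c>0. \<forall>U. nonparallel_Lambda_directions \<Lambda> U \<and> card U = c \<longrightarrow> determined_by_xrays U"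
    using determined_if_many[OF n(1), of \<Lambda>] n(2) by (intro exI[of _ "Suc (direction_bound n)"]) auto
next
  fix \<Lambda> U assume "nonparallel_Lambda_directions \<Lambda> U \<and> card U < 4"
  then show "\<not> determined_by_xrays U"
    by (intro not_determined_few) (auto simp: nonparallel_Lambda_directions_def Lambda_direction_def)
next
  have det: "determined_by_xrays U"
    if "n \<ge> 3" "cyclotomic_Delone n \<Lambda>" "nonparallel_Lambda_directions \<Lambda> U" "card U = Suc (direction_bound n)" for n \<Lambda> U
  proof -
    have "K_field \<Lambda> \<subseteq> cyc_field n" using that(2) field_gen_zeta_subset[of n] by (auto simp: cyclotomic_Delone_def Cyc_def)
    then show ?thesis using that by (intro determined_if_many[of n \<Lambda>]) auto
  qed
  show "\<exists>c :: nat \<Rightarrow> nat.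
        (\<forall>n\<ge>3. c n > 0 \<and>
           (\<forall>\<Lambda> U. cyclotomic_Delone n \<Lambda> \<and> nonparallel_Lambda_directions \<Lambda> U \<and> card U = c n
              \<longrightarrow> determined_by_xrays U)) \<and>
        c 3 = 7 \<and> c 4 = 7 \<and> c 5 = 11 \<and> c 8 = 9 \<and> c 12 = 13"
  proof (intro exI[of _ "\<lambda>n. Suc (direction_bound n)"] conjI allI impI)
    fix n \<Lambda> U
    assume "3 \<le> n" and "cyclotomic_Delone n \<Lambda> \<and> nonparallel_Lambda_directions \<Lambda> U \<and> card U = Suc (direction_bound n)"
    then show "determined_by_xrays U" by (elim conjE) (rule det)
  qed (simp_all add: direction_bound_def)
qed

end
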